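(* Let $s\ge1$ be fixed and let $X(n)=\{x_1(n)<\dots<x_s(n)\}\subset\mathbb{Z}$, $n=1,2,\dots$, be a regular sequence, i.e. the limits $a_i=\lim_{n\to\infty}x_i(n)/\sqrt n$ and $d_{ij}=\lim_{n\to\infty}(x_i(n)-x_j(n))$ exist, finite or infinite, for all $i,j$. If $X(n)$ splits, i.e. $X(n)=X'(n)\cup X''(n)$ with the distance between $X'(n)$ and $X''(n)$ tending to $\infty$, then $$\lim_{n\to\infty}\boldsymbol{\varrho}(n,X(n))=\lim_{n\to\infty}\boldsymbol{\varrho}(n,X'(n))\cdot\lim_{n\to\infty}\boldsymbol{\varrho}(n,X''(n)).$$ If $X(n)$ is nonsplit (all $x_i(n)$ stay at bounded distance from each other, so that $a_1=a_2=\dots=a_s=:a$), then $$\lim_{n\to\infty}\boldsymbol{\varrho}(n,X(n))=\det\big[\mathsf{S}(d_{ij},a)\big]_{1\le i,j\le s}.$$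
   Context: A partition $\lambda=(\lambda_1\ge\lambda_2\ge\dots\ge 0)$ of $n$ is identified with its Young diagram; $\dim\lambda$ is the number of standard Young tableaux of shape $\lambda$. The Plancherel measure on partitions of $n$ is $M_n(\lambda)=(\dim\lambda)^2/n!$. The descent set of $\lambda$ is $\mathcal{D}(\lambda)=\{\lambda_i-i:i=1,2,\dots\}\subset\mathbb{Z}$ (with $\lambda_i=0$ for large $i$), and $\boldsymbol{\varrho}(n,X)=M_n(\{\lambda:X\subset\mathcal{D}(\lambda)\})$ for finite $X\subset\mathbb{Z}$. The discrete sine kernel is $\mathsf{S}(k,a)$ for $k\in\mathbb{Z}\cup\{\infty\}$ and real $a$: for $|a|<2$, $\mathsf{S}(k,a)=\frac{\sin(\arccos(a/2)\,k)}{\pi k}$ for $k\ne0$, $\mathsf{S}(0,a)=\frac{\arccos(a/2)}{\pi}$, $\mathsf{S}(\infty,a)=0$; for $a\ge2$, $\mathsf{S}(k,a)=0$ for all $k$; for $a\le-2$, $\mathsf{S}(k,a)=0$ if $k\ne0$ and $\mathsf{S}(0,a)=1$.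
   Formalization: In the split case X'(n) and X''(n) are themselves required to be regular sequences (automatic for fixed index sets); otherwise, e.g. X'(n) alternating between two points with different a_i, the limits of ρ(n,X'(n)) and ρ(n,X''(n)) need not exist. *)

theory Defs
  imports "HOL-Analysis.Analysis" "Jordan_Normal_Form.Determinant"
begin

(* Indices are shifted by one: the part lambda_i, i = 1, 2, ..., is lam (i - 1). *)
definition is_partition :: "nat \<Rightarrow> (nat \<Rightarrow> nat) \<Rightarrow> bool" where
  "is_partition n lam \<longleftrightarrow>
     antimono lam \<and> finite {i. lam i \<noteq> 0} \<and> (\<Sum>i | lam i \<noteq> 0. lam i) = n"

definition diagram :: "(nat \<Rightarrow> nat) \<Rightarrow> (nat \<times> nat) set" where
  "diagram lam = {(i, j). j < lam i}"

(* Being extensional (i.e. undefined outside the diagram) makes a tableau a unique HOL function,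
   so that tableaux can be counted by card. *)
definition standard_tableaux :: "(nat \<Rightarrow> nat) \<Rightarrow> (nat \<times> nat \<Rightarrow> nat) set" where
  "standard_tableaux lam =
     {T. T \<in> extensional (diagram lam) \<and>
         bij_betw T (diagram lam) {1..card (diagram lam)} \<and>
         (\<forall>i j j'. j < j' \<and> (i, j) \<in> diagram lam \<and> (i, j') \<in> diagram lam
             \<longrightarrow> T (i, j) < T (i, j')) \<and>
         (\<forall>i i' j. i < i' \<and> (i, j) \<in> diagram lam \<and> (i', j) \<in> diagram lam
             \<longrightarrow> T (i, j) < T (i', j))}"

definition dim_partition :: "(nat \<Rightarrow> nat) \<Rightarrow> nat" where
  "dim_partition lam = card (standard_tableaux lam)"

definition plancherel :: "nat \<Rightarrow> (nat \<Rightarrow> nat) set \<Rightarrow> real" where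
  "plancherel n A = (\<Sum>lam | is_partition n lam \<and> lam \<in> A. (real (dim_partition lam))\<^sup>2 / fact n)"

lemma finite_partitions: "finite {lam. is_partition n lam}"
proof -
  have "{lam. is_partition n lam} \<subseteq> {f. \<forall>i. (i \<in> {..<n} \<longrightarrow> f i \<in> {..n}) \<and> (i \<notin> {..<n} \<longrightarrow> f i = 0)}"
  proof (rule subsetI)
    fix lam assume "lam \<in> {lam. is_partition n lam}"
    then have fin: "finite {i. lam i \<noteq> 0}" and s: "(\<Sum>i | lam i \<noteq> 0. lam i) = n"
      and anti: "antimono lam"
      by (auto simp: is_partition_def)
    have le: "lam i \<le> n" for i
    proof (cases "lam i = 0")
      case False
      then have "lam i \<le> (\<Sum>i | lam i \<noteq> 0. lam i)"
        by (intro member_le_sum) (use fin in auto)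
      then show ?thesis unfolding s .
    qed simp
    have zero: "lam i = 0" if "i \<notin> {..<n}" for i
    proof (rule ccontr)
      assume "lam i \<noteq> 0"
      then have nz: "lam j \<noteq> 0" if "j \<le> i" for j
        using antimonoD[OF anti that] by linarith
      then have "{..i} \<subseteq> {i. lam i \<noteq> 0}" by auto
      then have "card {..i} \<le> card {i. lam i \<noteq> 0}"
        using fin card_mono by blast
      also have "\<dots> = (\<Sum>i | lam i \<noteq> 0. 1)" by simp
      also have "\<dots> \<le> (\<Sum>i | lam i \<noteq> 0. lam i)"
        by (intro sum_mono) auto
      finally show False unfolding s using that by simp
    qed
    show "lam \<in> {f. \<forall>i. (i \<in> {..<n} \<longrightarrow> f i \<in> {..n}) \<and> (i \<notin> {..<n} \<longrightarrow> f i = 0)}"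
      using le zero by auto
  qed
  moreover have "finite {f. \<forall>i::nat. (i \<in> {..<n} \<longrightarrow> f i \<in> {..n}) \<and> (i \<notin> {..<n} \<longrightarrow> f i = 0)}"
    by (rule finite_set_of_finite_funs) auto
  ultimately show ?thesis
    by (rule finite_subset)
qed

(* lambda_i - i for i = 1, 2, ..., with i replaced by i + 1. *)
definition descents :: "(nat \<Rightarrow> nat) \<Rightarrow> int set" where
  "descents lam = range (\<lambda>i. int (lam i) - int (i + 1))"

definition rho :: "nat \<Rightarrow> int set \<Rightarrow> real" where
  "rho n X = plancherel n {lam. X \<subseteq> descents lam}"

(* The first argument stands for an element of the integers or an infinite limit d_ij; the second
   is extended-real because the limits a_i may be infinite, in which case the clauses
   a >= 2 and a <= -2 apply. *)
definition sine_kernel :: "ereal \<Rightarrow> ereal \<Rightarrow> real" where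
  "sine_kernel k a =
     (if a \<ge> 2 then 0
      else if a \<le> -2 then (if k = 0 then 1 else 0)
      else if \<bar>k\<bar> = \<infinity> then 0
      else if k = 0 then arccos (real_of_ereal a / 2) / pi
      else sin (arccos (real_of_ereal a / 2) * real_of_ereal k) / (pi * real_of_ereal k))"

(* Elements are indexed by {..<s} instead of {1..s}, while n runs over 1, 2, .... *)
definition points :: "nat \<Rightarrow> (nat \<Rightarrow> nat \<Rightarrow> int) \<Rightarrow> nat \<Rightarrow> int set" where
  "points s x n = (\<lambda>i. x i n) ` {..<s}"

definition regular_with ::
    "nat \<Rightarrow> (nat \<Rightarrow> nat \<Rightarrow> int) \<Rightarrow> (nat \<Rightarrow> ereal) \<Rightarrow> (nat \<Rightarrow> nat \<Rightarrow> ereal) \<Rightarrow> bool" where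
  "regular_with s x a d \<longleftrightarrow>
     s \<ge> 1 \<and>
     (\<forall>n\<ge>1. strict_mono_on {..<s} (\<lambda>i. x i n)) \<and>
     (\<forall>i<s. (\<lambda>n. ereal (real_of_int (x i n) / sqrt (real n))) \<longlonglongrightarrow> a i) \<and>
     (\<forall>i<s. \<forall>j<s. (\<lambda>n. ereal (real_of_int (x i n - x j n))) \<longlonglongrightarrow> d i j)"

definition regular_sequence :: "(nat \<Rightarrow> int set) \<Rightarrow> bool" where
  "regular_sequence X \<longleftrightarrow>
     (\<exists>s x a d. regular_with s x a d \<and> (\<forall>n\<ge>1. X n = points s x n))"

(* Regularity of X' and X'' makes sense of the limits of rho n (X' n) and rho n (X'' n): without
   it, X' could alternate between two points of X with different a_i. It holds automatically when
   X' and X'' consist of the points x_i with i in fixed complementary index sets; see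
   regular_sequence_subfamily. *)
definition splits_into ::
    "(nat \<Rightarrow> int set) \<Rightarrow> (nat \<Rightarrow> int set) \<Rightarrow> (nat \<Rightarrow> int set) \<Rightarrow> bool" where
  "splits_into X X' X'' \<longleftrightarrow>
     regular_sequence X' \<and> regular_sequence X'' \<and>
     (\<forall>n\<ge>1. X n = X' n \<union> X'' n) \<and>
     filterlim (\<lambda>n. setdist (real_of_int ` X' n) (real_of_int ` X'' n)) at_top sequentially"

definition nonsplit :: "nat \<Rightarrow> (nat \<Rightarrow> nat \<Rightarrow> int) \<Rightarrow> bool" where
  "nonsplit s x \<longleftrightarrow> (\<exists>C. \<forall>n\<ge>1. \<forall>i<s. \<forall>j<s. \<bar>x i n - x j n\<bar> \<le> C)"

lemma regular_sequence_subfamily: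
  assumes "regular_with s x a d" "I \<subseteq> {..<s}" "I \<noteq> {}"
  shows "regular_sequence (\<lambda>n. (\<lambda>i. x i n) ` I)"
proof -
  have fin: "finite I" using assms(2) finite_subset by blast
  define e where "e k = sorted_list_of_set I ! k" for k
  have len: "length (sorted_list_of_set I) = card I" by simp
  have e_in: "e k \<in> I" if "k < card I" for k
    using that fin nth_mem[of k "sorted_list_of_set I"] by (simp add: e_def)
  then have e_less: "e k < s" if "k < card I" for k
    using assms(2) that by blast
  have e_mono: "e k < e l" if "k < l" "l < card I" for k l
    using that sorted_wrt_nth_less[OF strict_sorted_list_of_set[of I], of k l] by (simp add: e_def)
  have e_img: "e ` {..<card I} = I"
  proof -
    have "e ` {..<card I} = set (sorted_list_of_set I)"
      unfolding set_conv_nth e_def by (auto simp: len)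
    then show ?thesis using fin by simp
  qed
  have "regular_with (card I) (\<lambda>k. x (e k)) (\<lambda>k. a (e k)) (\<lambda>k l. d (e k) (e l))"
    unfolding regular_with_def
  proof (intro conjI allI impI)
    show "1 \<le> card I"
      using assms(3) fin by (simp add: Suc_le_eq card_gt_0_iff)
    show "strict_mono_on {..<card I} (\<lambda>k. x (e k) n)" if "1 \<le> n" for n
    proof (rule strict_mono_onI)
      fix k l assume "k \<in> {..<card I}" "l \<in> {..<card I}" "k < l"
      moreover have "strict_mono_on {..<s} (\<lambda>i. x i n)"
        using assms(1) that by (simp add: regular_with_def)
      ultimately show "x (e k) n < x (e l) n"
        using strict_mono_onD[of "{..<s}" "\<lambda>i. x i n" "e k" "e l"] e_less e_mono by simp
    qed
    show "(\<lambda>n. ereal (real_of_int (x (e k) n) / sqrt (real n))) \<longlonglongrightarrow> a (e k)" if "k < card I" for k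
      using assms(1) e_less[OF that] unfolding regular_with_def by blast
    show "(\<lambda>n. ereal (real_of_int (x (e k) n - x (e l) n))) \<longlonglongrightarrow> d (e k) (e l)"
      if "k < card I" "l < card I" for k l
      using assms(1) e_less[OF that(1)] e_less[OF that(2)] unfolding regular_with_def by blast
  qed
  moreover have "(\<lambda>i. x i n) ` I = points (card I) (\<lambda>k. x (e k)) n" for n
    unfolding points_def by (subst e_img[symmetric]) (simp add: image_image)
  ultimately show ?thesis
    unfolding regular_sequence_def by blast
qed

end

theory Submission
  imports Defs "HOL-Complex_Analysis.Great_Picard" "HOL-Probability.Characteristic_Functions" "HOL-Real_Asymp.Real_Asymp"
begin

text \<open>
  Randomise \<open>n\<close> by a Poisson variable of mean \<open>r\<^sup>2\<close>. By the branching rule, adding and removing boxes are the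
  operators \<open>hop 1\<close> and \<open>hop (-1)\<close> on functions of descent sets, whose commutator is the identity, and the
  events \<open>x \<in> D(\<lambda>)\<close> are products of a creation and an annihilation operator. The generating series of all
  correlations therefore satisfies a linear differential equation in \<open>r\<close>, which is also satisfied by the
  determinant of a kernel; the initial values agree, being vacuum expectations, so the Poissonized correlations
  are determinants of the discrete Bessel kernel \<open>\<Sum>k\<ge>1. J\<^bsub>x+k\<^esub>(2r) J\<^bsub>y+k\<^esub>(2r)\<close>.

  The three-term recurrence and the orthogonality of \<open>k \<mapsto> J\<^bsub>x+k\<^esub>(2r)\<close> determine the limits of the weighted sums
  \<open>\<Sum>k. p(k/r) J\<^bsub>x+k\<^esub>(2r) J\<^bsub>y+k\<^esub>(2r)\<close> for polynomials \<open>p\<close>; approximating the step function by polynomials gives the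
  discrete sine kernel inside \<open>|a| < 2\<close>, and monotonicity of the diagonal together with Cauchy-Schwarz gives the
  rest.

  For depoissonization, the Poissonized correlations with mean \<open>n exp (t / sqrt n)\<close>, which converge for each real
  \<open>t\<close>, give the Laplace transform of the weights on the scale \<open>sqrt n\<close>. Montel's theorem extends the limit to
  imaginary \<open>t\<close>, and a Gaussian average in \<open>t\<close> localises to \<open>|k - n| \<le> \<delta> sqrt n\<close>, where the correlations vary little
  because consecutive ones differ by \<open>O(1 / sqrt n)\<close>.
\<close>

section \<open>Fermions on Maya sets\<close>

text \<open>A function f on sets of integers stands for a vector, f S being the coefficient of S,
  and evaluation at \<open>vac\<close> is the left vacuum. As \<open>hop 1\<close> evaluates f at
  sets with one more box, on coefficient vectors it removes a box, and \<open>hop (-1)\<close> adds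
  one.

  Everything up to the determinant is algebra with power series in r. The differential equation
  couples infinitely many index pairs, but a coefficient is determined by earlier ones at
  neighbouring indices, so uniqueness is an induction on the order with x and y arbitrary and needs
  no convergence. The product formula and the three-term recurrence of the Bessel functions come
  from the same induction.

  What shapes the depoissonization is that the kernel asymptotics rest on positivity, monotonicity
  and Cauchy-Schwarz, hence are available for real r only, whereas extracting the term of size n by
  a contour integral would ask for complex r. Two a priori facts take over: 0 <= rho <= 1 bounds the
  tilted transforms locally uniformly on the complex plane, and consecutive Plancherel measures are
  close.\<close>

definition maya :: "int set \<Rightarrow> bool" where
  "maya S \<longleftrightarrow> finite (S \<inter> {0..}) \<and> finite ({..<0} - S)"

text \<open>Applied to the indicator of T, this is supported on the sets S that reach T by moving
  one particle by e, so a coefficient vector moves the opposite way to the argument.\<close>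

definition hop :: "int \<Rightarrow> (int set \<Rightarrow> real) \<Rightarrow> int set \<Rightarrow> real" where
  "hop e f S = (if maya S then \<Sum>z | z \<in> S \<and> z + e \<notin> S. f (insert (z + e) (S - {z})) else 0)"

text \<open>The Jordan-Wigner sign, which makes \<open>create\<close> and \<open>annih\<close> anticommute.\<close>
definition jw :: "int set \<Rightarrow> int \<Rightarrow> real" where
  "jw S x = (-1) ^ card {z \<in> S. x < z}"

text \<open>On the indicator of T with x not in T this is, up to sign, the indicator of
  \<open>insert x T\<close>; dually \<open>annih\<close> takes a particle out.\<close>

definition create :: "int \<Rightarrow> (int set \<Rightarrow> real) \<Rightarrow> int set \<Rightarrow> real" where
  "create x f S = (if maya S \<and> x \<in> S then jw S x * f (S - {x}) else 0)"

definition annih :: "int \<Rightarrow> (int set \<Rightarrow> real) \<Rightarrow> int set \<Rightarrow> real" where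
  "annih y f S = (if maya S \<and> y \<notin> S then jw S y * f (insert y S) else 0)"

lemma maya_insert [simp]: "maya (insert x S) \<longleftrightarrow> maya S"
proof -
  have "finite ({..<0} - S)" if "finite ({..<0} - insert x S)"
    by (rule finite_subset[of _ "insert x ({..<0} - insert x S)"]) (use that in auto)
  moreover have "finite ({..<0} - insert x S)" if "finite ({..<0} - S)"
    by (rule finite_subset[of _ "{..<0} - S"]) (use that in auto)
  moreover have "finite (insert x S \<inter> {0..}) = finite (S \<inter> {0..})"
    by (simp add: Int_insert_left)
  ultimately show ?thesis unfolding maya_def by blast
qed

lemma maya_Diff [simp]: "maya (S - {x}) \<longleftrightarrow> maya S"
  by (metis insert_Diff_single maya_insert)

lemma maya_above: "maya S \<Longrightarrow> finite {z \<in> S. x < z}"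
  by (rule finite_subset[of _ "(S \<inter> {0..}) \<union> {x..0}"]) (auto simp: maya_def)

lemma maya_corners:
  assumes "maya S" "e = 1 \<or> e = -1"
  shows "finite {z. z \<in> S \<and> z + e \<notin> S}"
proof -
  have "{z. z \<in> S \<and> z + e \<notin> S} \<subseteq> (S \<inter> {0..}) \<union> ((\<lambda>z. z - e) ` ({..<0} - S)) \<union> {-1}"
  proof (rule subsetI)
    fix z assume z: "z \<in> {z. z \<in> S \<and> z + e \<notin> S}"
    show "z \<in> (S \<inter> {0..}) \<union> ((\<lambda>z. z - e) ` ({..<0} - S)) \<union> {-1}"
    proof (cases "z \<ge> 0 \<or> z = -1")
      case False
      then have "z + e \<in> {..<0} - S" using z assms(2) by auto
      then have "z + e - e \<in> (\<lambda>z. z - e) ` ({..<0} - S)" by (rule imageI)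
      then show ?thesis by simp
    qed (use z in auto)
  qed
  then show ?thesis
    by (rule finite_subset) (use assms(1) in \<open>auto simp: maya_def\<close>)
qed

lemma jw_square [simp]: "jw S x * jw S x = 1"
  unfolding jw_def by (simp flip: power_add mult_2)

text \<open>A hop to a neighbouring place jumps over no third point, so the number of particles
  above x stays the same.\<close>

lemma jw_hop:
  assumes "z \<in> S" "z + e \<notin> S" "z \<noteq> x" "z + e \<noteq> x" "e = 1 \<or> e = -1"
  shows "jw (insert (z + e) (S - {z})) x = jw S x"
proof (cases "x < z")
  case True
  then have "x < z + e" using assms by auto
  then have eq: "{w \<in> insert (z + e) (S - {z}). x < w} = insert (z + e) ({w \<in> S. x < w} - {z})"
    using assms by auto
  have "card (insert (z + e) ({w \<in> S. x < w} - {z})) = card {w \<in> S. x < w}"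
  proof (cases "finite {w \<in> S. x < w}")
    case True
    then show ?thesis using assms \<open>x < z\<close> card_Suc_Diff1[of "{w \<in> S. x < w}" z] by (subst card_insert_disjoint) auto
  next
    case False
    then show ?thesis by simp
  qed
  then show ?thesis unfolding jw_def eq by simp
next
  case False
  then have "\<not> x < z + e" using assms by auto
  then have eq: "{w \<in> insert (z + e) (S - {z}). x < w} = {w \<in> S. x < w}"
    using assms False by auto
  then show ?thesis unfolding jw_def by simp
qed

lemma jw_insert:
  assumes "maya S" "y \<notin> S"
  shows "jw (insert y S) x = (if x < y then - jw S x else jw S x)"
proof (cases "x < y")
  case True
  then have "{z \<in> insert y S. x < z} = insert y {z \<in> S. x < z}" by auto
  then show ?thesis using True assms maya_above[OF assms(1)] by (simp add: jw_def)
next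
  case False
  then have "{z \<in> insert y S. x < z} = {z \<in> S. x < z}" by auto
  then show ?thesis using False by (simp add: jw_def)
qed

lemma jw_Diff:
  assumes "maya S" "y \<in> S"
  shows "jw (S - {y}) x = (if x < y then - jw S x else jw S x)"
  using jw_insert[of "S - {y}" y x] assms by (auto simp: insert_absorb)

lemma jw_Suc: "maya S \<Longrightarrow> jw S x = (if x + 1 \<in> S then - jw S (x + 1) else jw S (x + 1))"
proof -
  assume m: "maya S"
  have "{z \<in> S. x < z} = (if x + 1 \<in> S then insert (x + 1) {z \<in> S. x + 1 < z} else {z \<in> S. x + 1 < z})"
    by (auto simp: less_le)
  then show ?thesis using maya_above[OF m] by (simp add: jw_def)
qed

lemma jw_pm:
  assumes "maya S" "e = 1 \<or> e = -1"
  shows "x \<in> S \<Longrightarrow> x + e \<in> S \<Longrightarrow> jw S (x + e) = - jw S x"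
    and "x \<notin> S \<Longrightarrow> x + e \<notin> S \<Longrightarrow> jw S (x + e) = jw S x"
  using assms(2) jw_Suc[OF assms(1), of x] jw_Suc[OF assms(1), of "x - 1"] by auto

text \<open>If x is in S, moves that vacate x die on the left, while on the right a particle of S -
  {x} may hop from x - e onto x; this surplus cancels against the last summand because the signs at
  neighbouring occupied places are opposite. If x is not in S, only the hop from x - e onto x
  survives.\<close>

lemma hop_create:
  assumes e: "e = 1 \<or> e = -1"
  shows "hop e (create x f) = (\<lambda>S. create x (hop e f) S + create (x - e) f S)"
proof
  fix S
  show "hop e (create x f) S = create x (hop e f) S + create (x - e) f S"
  proof (cases "maya S")
    case False
    then show ?thesis by (simp add: hop_def create_def)
  next
    case m: True
    let ?A = "{z. z \<in> S \<and> z + e \<notin> S}"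
    have fin: "finite ?A" by (rule maya_corners[OF m e])
    have L: "hop e (create x f) S = (\<Sum>z\<in>?A. create x f (insert (z + e) (S - {z})))"
      using m by (simp add: hop_def)
    show ?thesis
    proof (cases "x \<in> S")
      case xS: True
      have "hop e (create x f) S = (\<Sum>z\<in>?A - {x}. create x f (insert (z + e) (S - {z})))"
        unfolding L using e m fin by (intro sum.mono_neutral_right) (auto simp: create_def)
      also have "\<dots> = (\<Sum>z\<in>?A - {x}. jw S x * f (insert (z + e) (S - {x} - {z})))"
      proof (rule sum.cong)
        fix z assume z: "z \<in> ?A - {x}"
        then have "z + e \<noteq> x" using xS by auto
        then have s: "insert (z + e) (S - {z}) - {x} = insert (z + e) (S - {x} - {z})" by auto
        show "create x f (insert (z + e) (S - {z})) = jw S x * f (insert (z + e) (S - {x} - {z}))"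
          using z xS m jw_hop[of z S e x] e \<open>z + e \<noteq> x\<close> unfolding create_def s by auto
      qed simp
      finally have 1: "hop e (create x f) S = \<dots>" .
      let ?B = "{z. z \<in> S - {x} \<and> z + e \<notin> S - {x}}"
      have B: "?B = (?A - {x}) \<union> (if x - e \<in> S then {x - e} else {})"
        using e xS by auto
      have "create x (hop e f) S = jw S x * (\<Sum>z\<in>?B. f (insert (z + e) (S - {x} - {z})))"
        using xS m by (simp add: create_def hop_def)
      also have "\<dots> = (\<Sum>z\<in>?B. jw S x * f (insert (z + e) (S - {x} - {z})))"
        by (simp add: sum_distrib_left)
      also have "\<dots> = (\<Sum>z\<in>?A - {x}. jw S x * f (insert (z + e) (S - {x} - {z}))) +
          (if x - e \<in> S then jw S x * f (S - {x - e}) else 0)"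
      proof -
        have "insert (x - e + e) (S - {x} - {x - e}) = S - {x - e}" using xS e by auto
        then show ?thesis using fin xS e unfolding B by (subst sum.union_disjoint) auto
      qed
      finally have 2: "create x (hop e f) S = \<dots>" .
      have "jw S x = - jw S (x - e)" if "x - e \<in> S"
        using jw_pm(1)[OF m e that] xS by auto
      then show ?thesis using 1 2 m by (auto simp: create_def)
    next
      case xS: False
      have "hop e (create x f) S = (\<Sum>z\<in>?A \<inter> {x - e}. create x f (insert (z + e) (S - {z})))"
        unfolding L using e m fin xS by (intro sum.mono_neutral_right) (auto simp: create_def)
      also have "\<dots> = create (x - e) f S"
      proof (cases "x - e \<in> S")
        case True
        have i: "?A \<inter> {x - e} = {x - e}" using True xS by auto
        have "jw (insert x (S - {x - e})) x = jw S (x - e)"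
        proof -
          have "jw (insert x (S - {x - e})) x = jw (S - {x - e}) x"
            using jw_insert[of "S - {x - e}" x x] m xS by auto
          also have "\<dots> = jw (S - {x - e}) (x - e)"
            using jw_pm(2)[of "S - {x - e}" e "x - e"] m e xS by auto
          also have "\<dots> = jw S (x - e)"
            using jw_Diff[OF m True, of "x - e"] by simp
          finally show ?thesis .
        qed
        moreover have "insert x (S - {x - e}) - {x} = S - {x - e}" using xS by auto
        ultimately show ?thesis using True m by (simp add: i create_def)
      next
        case False
        then have i: "?A \<inter> {x - e} = {}" by auto
        show ?thesis using False by (simp add: i create_def)
      qed
      finally show ?thesis using xS by (simp add: create_def)
    qed
  qed
qed

text \<open>The mirror image of \<open>hop_create\<close>: here the surplus on the right is the hop
  of the inserted particle y itself onto y + e.\<close>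

lemma hop_annih:
  assumes e: "e = 1 \<or> e = -1"
  shows "hop e (annih y f) = (\<lambda>S. annih y (hop e f) S - annih (y + e) f S)"
proof
  fix S
  show "hop e (annih y f) S = annih y (hop e f) S - annih (y + e) f S"
  proof (cases "maya S")
    case False
    then show ?thesis by (simp add: hop_def annih_def)
  next
    case m: True
    let ?A = "{z. z \<in> S \<and> z + e \<notin> S}"
    have fin: "finite ?A" by (rule maya_corners[OF m e])
    have L: "hop e (annih y f) S = (\<Sum>z\<in>?A. annih y f (insert (z + e) (S - {z})))"
      using m by (simp add: hop_def)
    show ?thesis
    proof (cases "y \<in> S")
      case yS: False
      have "hop e (annih y f) S = (\<Sum>z\<in>?A - {y - e}. annih y f (insert (z + e) (S - {z})))"
        unfolding L using e m fin by (intro sum.mono_neutral_right) (auto simp: annih_def)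
      also have "\<dots> = (\<Sum>z\<in>?A - {y - e}. jw S y * f (insert (z + e) (insert y S - {z})))"
      proof (rule sum.cong)
        fix z assume z: "z \<in> ?A - {y - e}"
        then have ne: "z + e \<noteq> y" "z \<noteq> y" using yS by auto
        then have s: "insert y (insert (z + e) (S - {z})) = insert (z + e) (insert y S - {z})" by auto
        show "annih y f (insert (z + e) (S - {z})) = jw S y * f (insert (z + e) (insert y S - {z}))"
          using z yS m jw_hop[of z S e y] e ne unfolding annih_def s by auto
      qed simp
      finally have 1: "hop e (annih y f) S = \<dots>" .
      let ?B = "{z. z \<in> insert y S \<and> z + e \<notin> insert y S}"
      have B: "?B = (?A - {y - e}) \<union> (if y + e \<notin> S then {y} else {})"
        using e yS by auto
      have "annih y (hop e f) S = jw S y * (\<Sum>z\<in>?B. f (insert (z + e) (insert y S - {z})))"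
        using yS m by (simp add: annih_def hop_def)
      also have "\<dots> = (\<Sum>z\<in>?B. jw S y * f (insert (z + e) (insert y S - {z})))"
        by (simp add: sum_distrib_left)
      also have "\<dots> = (\<Sum>z\<in>?A - {y - e}. jw S y * f (insert (z + e) (insert y S - {z}))) +
          (if y + e \<notin> S then jw S y * f (insert (y + e) S) else 0)"
      proof -
        have "insert (y + e) (insert y S - {y}) = insert (y + e) S" using yS by auto
        then show ?thesis using fin yS e unfolding B by (subst sum.union_disjoint) auto
      qed
      finally have 2: "annih y (hop e f) S = \<dots>" .
      have "jw S (y + e) = jw S y" if "y + e \<notin> S"
        using jw_pm(2)[OF m e yS that] .
      then show ?thesis using 1 2 m by (auto simp: annih_def)
    next
      case yS: True
      have "hop e (annih y f) S = (\<Sum>z\<in>?A \<inter> {y}. annih y f (insert (z + e) (S - {z})))"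
        unfolding L using e m fin yS by (intro sum.mono_neutral_right) (auto simp: annih_def)
      also have "\<dots> = - annih (y + e) f S"
      proof (cases "y + e \<in> S")
        case False
        have i: "?A \<inter> {y} = {y}" using False yS by auto
        have "jw (insert (y + e) (S - {y})) y = - jw S (y + e)"
        proof -
          let ?T = "insert (y + e) S"
          have T: "insert (y + e) (S - {y}) = ?T - {y}" using e by auto
          have "jw (?T - {y}) y = jw ?T y"
            using jw_Diff[of ?T y y] m yS by auto
          also have "\<dots> = - jw ?T (y + e)"
            using jw_pm(1)[of ?T e y] m e yS by auto
          also have "jw ?T (y + e) = jw S (y + e)"
            using jw_insert[OF m False, of "y + e"] by simp
          finally show ?thesis unfolding T .
        qed
        moreover have "insert y (insert (y + e) (S - {y})) = insert (y + e) S" using yS by auto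
        moreover have "y \<noteq> y + e" using e by auto
        ultimately show ?thesis using False m by (simp add: i annih_def)
      next
        case True
        then have i: "?A \<inter> {y} = {}" by auto
        show ?thesis using True by (simp add: i annih_def)
      qed
      finally show ?thesis using yS by (simp add: annih_def)
    qed
  qed
qed

lemma maya_bounds:
  assumes "maya S"
  obtains N where "N > 0" "\<And>z. z < -N \<Longrightarrow> z \<in> S" "\<And>z. z \<ge> N \<Longrightarrow> z \<notin> S"
proof -
  have f1: "finite (S \<inter> {0..})" and f2: "finite ({..<0} - S)" using assms by (auto simp: maya_def)
  obtain a where a: "\<And>z. z \<in> S \<inter> {0..} \<Longrightarrow> z \<le> a"
    using f1 by (metis bdd_above_finite bdd_above.unfold)
  obtain b where b: "\<And>z. z \<in> {..<0} - S \<Longrightarrow> b \<le> z"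
    using f2 by (metis bdd_below_finite bdd_below.unfold)
  show thesis
  proof (rule that[of "\<bar>a\<bar> + \<bar>b\<bar> + 1"])
    show "z \<in> S" if "z < - (\<bar>a\<bar> + \<bar>b\<bar> + 1)" for z
      using b[of z] that by fastforce
    show "z \<notin> S" if "z \<ge> \<bar>a\<bar> + \<bar>b\<bar> + 1" for z
      using a[of z] that by fastforce
  qed simp
qed

text \<open>Going from far left to far right, the indicator of a Maya set drops once more than it rises.\<close>
lemma card_corners:
  assumes m: "maya S"
  shows "real (card {z. z \<in> S \<and> z + 1 \<notin> S}) = real (card {z. z \<in> S \<and> z + (-1) \<notin> S}) + 1"
proof -
  obtain N where N: "N > 0" "\<And>z. z < -N \<Longrightarrow> z \<in> S" "\<And>z. z \<ge> N \<Longrightarrow> z \<notin> S"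
    using maya_bounds[OF m] by metis
  let ?i = "\<lambda>z. of_bool (z \<in> S) :: real"
  \<comment> \<open>The window from -N - 1 to N starts inside S and ends outside it, so the drops of
    the indicator telescope to 1.\<close>
  let ?n = "nat (2 * N + 1)"
  have "(\<Sum>k<?n. ?i (int k - N - 1) - ?i (int (Suc k) - N - 1)) = ?i (int 0 - N - 1) - ?i (int ?n - N - 1)"
    by (rule sum_lessThan_telescope')
  also have "\<dots> = 1" using N(2)[of "-N - 1"] N(3)[of N] N(1) by simp
  finally have tel: "(\<Sum>k<?n. ?i (int k - N - 1) - ?i (int k - N)) = 1" by simp
  have bij: "bij_betw (\<lambda>k. int k - N - 1) {..<?n} {-N - 1..<N}"
    by (rule bij_betwI[of _ _ _ "\<lambda>z. nat (z + N + 1)"]) (use N(1) in auto)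
  have "(\<Sum>k<?n. ?i (int k - N - 1) - ?i (int k - N)) = (\<Sum>z\<in>{-N - 1..<N}. ?i z - ?i (z + 1))"
    by (subst sum.reindex_bij_betw[OF bij, symmetric]) simp
  with tel have "1 = (\<Sum>z\<in>{-N - 1..<N}. ?i z - ?i (z + 1))" by simp
  also have "\<dots> = (\<Sum>z\<in>{-N - 1..<N}. of_bool (z \<in> S \<and> z + 1 \<notin> S) - of_bool (z \<notin> S \<and> z + 1 \<in> S))"
    by (rule sum.cong) auto
  also have "\<dots> = real (card {z \<in> {-N - 1..<N}. z \<in> S \<and> z + 1 \<notin> S}) -
      real (card {z \<in> {-N - 1..<N}. z \<notin> S \<and> z + 1 \<in> S})"
  proof -
    have "(\<Sum>z\<in>{-N - 1..<N}. of_bool (P z)) = real (card {z \<in> {-N - 1..<N}. P z})" for P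
      by (subst sum_of_bool_eq) (auto intro!: arg_cong[of _ _ card])
    then show ?thesis by (simp add: sum_subtractf)
  qed
  also have "{z \<in> {-N - 1..<N}. z \<in> S \<and> z + 1 \<notin> S} = {z. z \<in> S \<and> z + 1 \<notin> S}"
  proof -
    have "z < N \<and> - N - 1 \<le> z" if "z \<in> S" "z + 1 \<notin> S" for z
      using N(2)[of "z + 1"] N(3)[of z] that by linarith
    then show ?thesis by auto
  qed
  also have "card {z \<in> {-N - 1..<N}. z \<notin> S \<and> z + 1 \<in> S} = card {z. z \<in> S \<and> z + (-1) \<notin> S}"
  proof (rule bij_betw_same_card[of "\<lambda>z. z + 1"], rule bij_betwI[of _ _ _ "\<lambda>z. z - 1"])
    show "(\<lambda>z. z - 1) \<in> {z. z \<in> S \<and> z + (-1) \<notin> S} \<rightarrow> {z \<in> {-N - 1..<N}. z \<notin> S \<and> z + 1 \<in> S}"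
    proof (rule Pi_I)
      fix z assume z: "z \<in> {z. z \<in> S \<and> z + (-1) \<notin> S}"
      then have "z < N" using N(3)[of z] by (simp add: linorder_not_le[symmetric]) blast
      moreover have "- N \<le> z - 1"
      proof (rule ccontr)
        assume "\<not> - N \<le> z - 1"
        then have "z - 1 \<in> S" by (intro N(2)) simp
        then show False using z by simp
      qed
      ultimately show "z - 1 \<in> {z \<in> {-N - 1..<N}. z \<notin> S \<and> z + 1 \<in> S}" using z by auto
    qed
  qed auto
  finally show ?thesis by simp
qed

text \<open>Moves of two different particles commute and are matched through F. A move followed by
  its reverse gives back f S, once per particle free to move right in one order and once per
  particle free to move left in the other; by \<open>card_corners\<close> these numbers differ by
  1.\<close>

lemma hop_commutator:
  assumes m: "maya S"
  shows "hop 1 (hop (-1) f) S = hop (-1) (hop 1 f) S + f S"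
proof -
  let ?A = "{z. z \<in> S \<and> z + 1 \<notin> S}" and ?B = "{w. w \<in> S \<and> w + (-1) \<notin> S}"
  have fA: "finite ?A" and fB: "finite ?B" using maya_corners[OF m, of 1] maya_corners[OF m, of "-1"] by simp_all
  \<comment> \<open>The joint move of z to z + 1 and w to w - 1: w = z would be one particle moved
    twice, and w = z + 2 would put both on z + 1.\<close>
  define F where "F z w = (if w \<noteq> z \<and> w \<noteq> z + 2
    then f (insert (z + 1) (insert (w - 1) (S - {z, w}))) else 0)" for z w
  have 1: "hop (-1) f (insert (z + 1) (S - {z})) = f S + (\<Sum>w\<in>?B. F z w)" if z: "z \<in> ?A" for z
  proof -
    let ?T = "insert (z + 1) (S - {z})"
    have "{w. w \<in> ?T \<and> w + (-1) \<notin> ?T} = insert (z + 1) (?B - {z, z + 2})"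
      using z by auto
    then have "hop (-1) f ?T = (\<Sum>w\<in>insert (z + 1) (?B - {z, z + 2}). f (insert (w + (-1)) (?T - {w})))"
      using m by (simp add: hop_def)
    also have "\<dots> = f (insert z (?T - {z + 1})) + (\<Sum>w\<in>?B - {z, z + 2}. f (insert (w + (-1)) (?T - {w})))"
      using fB z by (subst sum.insert) auto
    also have "insert z (?T - {z + 1}) = S" using z by auto
    also have "(\<Sum>w\<in>?B - {z, z + 2}. f (insert (w + (-1)) (?T - {w}))) = (\<Sum>w\<in>?B - {z, z + 2}. F z w)"
    proof (rule sum.cong)
      fix w assume w: "w \<in> ?B - {z, z + 2}"
      then have "w \<noteq> z + 1" using z by auto
      then have "insert (w + (-1)) (?T - {w}) = insert (z + 1) (insert (w - 1) (S - {z, w}))"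
        by auto
      then show "f (insert (w + (-1)) (?T - {w})) = F z w" using w by (simp add: F_def)
    qed simp
    also have "\<dots> = (\<Sum>w\<in>?B. F z w)"
      using fB by (intro sum.mono_neutral_left) (auto simp: F_def)
    finally show ?thesis .
  qed
  have 2: "hop 1 f (insert (w + (-1)) (S - {w})) = f S + (\<Sum>z\<in>?A. F z w)" if w: "w \<in> ?B" for w
  proof -
    let ?T = "insert (w + (-1)) (S - {w})"
    have "{z. z \<in> ?T \<and> z + 1 \<notin> ?T} = insert (w - 1) (?A - {w, w - 2})"
      using w by auto
    then have "hop 1 f ?T = (\<Sum>z\<in>insert (w - 1) (?A - {w, w - 2}). f (insert (z + 1) (?T - {z})))"
      using m by (simp add: hop_def)
    also have "\<dots> = f (insert w (?T - {w - 1})) + (\<Sum>z\<in>?A - {w, w - 2}. f (insert (z + 1) (?T - {z})))"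
      using fA w by (subst sum.insert) auto
    also have "insert w (?T - {w - 1}) = S" using w by auto
    also have "(\<Sum>z\<in>?A - {w, w - 2}. f (insert (z + 1) (?T - {z}))) = (\<Sum>z\<in>?A - {w, w - 2}. F z w)"
    proof (rule sum.cong)
      fix z assume z: "z \<in> ?A - {w, w - 2}"
      then have "z \<noteq> w - 1" using w by auto
      then have "insert (z + 1) (?T - {z}) = insert (z + 1) (insert (w - 1) (S - {z, w}))"
        by auto
      moreover have "w \<noteq> z + 2" using z by auto
      ultimately show "f (insert (z + 1) (?T - {z})) = F z w" using z by (simp add: F_def)
    qed simp
    also have "\<dots> = (\<Sum>z\<in>?A. F z w)"
      using fA by (intro sum.mono_neutral_left) (auto simp: F_def)
    finally show ?thesis .
  qed
  have "hop 1 (hop (-1) f) S = (\<Sum>z\<in>?A. hop (-1) f (insert (z + 1) (S - {z})))"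
    using m by (simp add: hop_def)
  also have "\<dots> = (\<Sum>z\<in>?A. f S + (\<Sum>w\<in>?B. F z w))"
    by (rule sum.cong[OF refl 1])
  also have "\<dots> = card ?A * f S + (\<Sum>w\<in>?B. \<Sum>z\<in>?A. F z w)"
    by (simp add: sum.distrib) (rule sum.swap)
  also have "\<dots> = f S + (\<Sum>w\<in>?B. f S + (\<Sum>z\<in>?A. F z w))"
    using card_corners[OF m] by (simp add: sum.distrib algebra_simps)
  also have "(\<Sum>w\<in>?B. f S + (\<Sum>z\<in>?A. F z w)) = (\<Sum>w\<in>?B. hop 1 f (insert (w + (-1)) (S - {w})))"
    by (rule sum.cong[OF refl 2[symmetric]])
  also have "\<dots> = hop (-1) (hop 1 f) S" using m by (simp add: hop_def)
  finally show ?thesis by simp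
qed

section \<open>Fermionic correlation series\<close>

definition linop :: "((int set \<Rightarrow> real) \<Rightarrow> int set \<Rightarrow> real) \<Rightarrow> bool" where
  "linop T \<longleftrightarrow> (\<forall>f g. T (\<lambda>S. f S + g S) = (\<lambda>S. T f S + T g S)) \<and>
     (\<forall>c f. T (\<lambda>S. c * f S) = (\<lambda>S. c * T f S))"

lemma linop_add: "linop T \<Longrightarrow> T (\<lambda>S. f S + g S) = (\<lambda>S. T f S + T g S)"
  and linop_scale: "linop T \<Longrightarrow> T (\<lambda>S. c * f S) = (\<lambda>S. c * T f S)"
  by (auto simp: linop_def)

lemma linop_diff: "linop T \<Longrightarrow> T (\<lambda>S. f S - g S) = (\<lambda>S. T f S - T g S)"
  using linop_add[of T f "\<lambda>S. (-1) * g S"] linop_scale[of T "-1" g] by simp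

lemma linop_zero: "linop T \<Longrightarrow> T (\<lambda>S. 0) = (\<lambda>S. 0)"
  using linop_scale[of T 0 "\<lambda>S. 0"] by simp

lemma linop_sum: "linop T \<Longrightarrow> T (\<lambda>S. \<Sum>k\<in>A. F k S) = (\<lambda>S. \<Sum>k\<in>A. T (F k) S)"
  by (induction A rule: infinite_finite_induct) (simp_all add: linop_zero linop_add[of T])

lemma linop_hop: "linop (hop e)"
  unfolding linop_def hop_def by (auto simp: sum.distrib sum_distrib_left)

lemma linop_create: "linop (create x)"
  unfolding linop_def create_def by (auto simp: algebra_simps)

lemma linop_annih: "linop (annih x)"
  unfolding linop_def annih_def by (auto simp: algebra_simps)

lemma linop_foldr_create: "linop (foldr create xs)"
  by (induction xs) (use linop_create in \<open>auto simp: linop_def\<close>)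

lemma linop_fold_annih: "linop (fold annih ys)"
  by (induction ys) (use linop_annih in \<open>auto simp: linop_def\<close>)

lemma linop_funpow: "linop T \<Longrightarrow> linop (T ^^ n)"
  by (induction n) (auto simp: linop_def)

text \<open>The operators vanish off Maya sets by definition, so a commutation relation with an
  identity term can hold only for such f.\<close>

definition supp_maya :: "(int set \<Rightarrow> real) \<Rightarrow> bool" where
  "supp_maya f \<longleftrightarrow> (\<forall>S. \<not> maya S \<longrightarrow> f S = 0)"

lemma supp_maya_hop [simp]: "supp_maya (hop e f)"
  and supp_maya_create [simp]: "supp_maya (create x f)"
  and supp_maya_annih [simp]: "supp_maya (annih x f)"
  by (auto simp: supp_maya_def hop_def create_def annih_def)

lemma supp_maya_funpow: "supp_maya f \<Longrightarrow> supp_maya ((hop e ^^ n) f)"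
  by (cases n) auto

lemma supp_maya_foldr_create: "supp_maya f \<Longrightarrow> supp_maya (foldr create xs f)"
  by (cases xs) auto

lemma supp_maya_fold_annih: "supp_maya f \<Longrightarrow> supp_maya (fold annih ys f)"
  by (induction ys arbitrary: f) auto

lemma hop_commutator': "supp_maya f \<Longrightarrow> hop 1 (hop (-1) f) = (\<lambda>S. hop (-1) (hop 1 f) S + f S)"
  using hop_commutator by (auto simp: supp_maya_def fun_eq_iff hop_def)

section \<open>The vacuum and the ladder relations\<close>

definition vac :: "int set" where "vac = {..<0}"

definition vac_state :: "int set \<Rightarrow> real" where "vac_state S = of_bool (S = vac)"

lemma maya_vac [simp]: "maya vac"
proof -
  have "{..<0} \<inter> {0..} = ({} :: int set)" by auto
  then show ?thesis by (simp add: maya_def vac_def)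
qed

lemma supp_maya_vac_state [simp]: "supp_maya vac_state"
  by (auto simp: supp_maya_def vac_state_def)

lemma hop_vac_state: "hop 1 vac_state = (\<lambda>S. 0)"
proof
  fix S
  have "insert (z + 1) (S - {z}) \<noteq> vac" if "z \<in> S" "z + 1 \<notin> S" for z
  proof
    assume eq: "insert (z + 1) (S - {z}) = vac"
    have "z + 1 \<in> vac" "z \<notin> vac" unfolding eq[symmetric] by simp_all
    then show False by (simp add: vac_def)
  qed
  then show "hop 1 vac_state S = 0"
    by (auto simp: hop_def vac_state_def intro!: sum.neutral)
qed

text \<open>In the filled half-line every particle has an occupied left neighbour; dually, no box
  can be removed from the empty diagram.\<close>

lemma hop_at_vac: "hop (-1) f vac = 0"
proof -
  have "{z. z \<in> vac \<and> z + (-1) \<notin> vac} = {}" by (auto simp: vac_def)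
  then show ?thesis unfolding hop_def by (simp only: sum.empty if_cancel)
qed

lemma hop_funpow_vac_state:
  "hop 1 ((hop (-1) ^^ n) vac_state) = (\<lambda>S. real n * (hop (-1) ^^ (n - 1)) vac_state S)"
proof (induction n)
  case 0
  then show ?case by (simp add: hop_vac_state)
next
  case (Suc n)
  have "hop 1 ((hop (-1) ^^ Suc n) vac_state) =
      (\<lambda>S. hop (-1) (hop 1 ((hop (-1) ^^ n) vac_state)) S + (hop (-1) ^^ n) vac_state S)"
    using hop_commutator'[OF supp_maya_funpow[OF supp_maya_vac_state]] by simp
  also have "\<dots> = (\<lambda>S. real n * (hop (-1)) ((hop (-1) ^^ (n - 1)) vac_state) S + (hop (-1) ^^ n) vac_state S)"
    unfolding Suc.IH by (simp add: linop_scale[OF linop_hop])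
  also have "\<dots> = (\<lambda>S. real (Suc n) * (hop (-1) ^^ (Suc n - 1)) vac_state S)"
    by (cases n) (auto simp: algebra_simps)
  finally show ?case .
qed

lemma funpow_hop_raise:
  assumes "supp_maya h"
  shows "(hop 1 ^^ m) (hop (-1) h) = (\<lambda>S. hop (-1) ((hop 1 ^^ m) h) S + real m * (hop 1 ^^ (m - 1)) h S)"
proof (induction m)
  case 0
  then show ?case by simp
next
  case (Suc m)
  have "(hop 1 ^^ Suc m) (hop (-1) h) =
      (\<lambda>S. hop 1 (hop (-1) ((hop 1 ^^ m) h)) S + real m * hop 1 ((hop 1 ^^ (m - 1)) h) S)"
    by (simp add: Suc.IH linop_add[OF linop_hop] linop_scale[OF linop_hop])
  also have "\<dots> = (\<lambda>S. hop (-1) (hop 1 ((hop 1 ^^ m) h)) S + (hop 1 ^^ m) h S + real m * (hop 1 ^^ m) h S)"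
    using hop_commutator'[OF supp_maya_funpow[OF assms, where e = 1 and n = m]] by (cases m) auto
  finally show ?case by (simp add: algebra_simps)
qed

lemma funpow_hop_raise_vac:
  "supp_maya h \<Longrightarrow> (hop 1 ^^ m) (hop (-1) h) vac = real m * (hop 1 ^^ (m - 1)) h vac"
  by (simp add: funpow_hop_raise hop_at_vac)

section \<open>Matrix elements of products of fermions\<close>

text \<open>The annihilators are applied in the order of ys, so the operator word lists them
  backwards. The pairs are then nested, and neither the occupation indicator for xs = ys nor the
  determinant at the vacuum carries a sign.\<close>

definition fermion :: "int list \<Rightarrow> int list \<Rightarrow> (int set \<Rightarrow> real) \<Rightarrow> int set \<Rightarrow> real" where
  "fermion xs ys f = foldr create xs (fold annih ys f)"

lemma linop_fermion: "linop (fermion xs ys)"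
  using linop_foldr_create[of xs] linop_fold_annih[of ys] by (simp add: linop_def fermion_def)

lemma supp_maya_fermion: "supp_maya f \<Longrightarrow> supp_maya (fermion xs ys f)"
  by (simp add: fermion_def supp_maya_foldr_create supp_maya_fold_annih)

lemma hop_foldr_create:
  assumes e: "e = 1 \<or> e = -1"
  shows "hop e (foldr create xs f) =
    (\<lambda>S. foldr create xs (hop e f) S + (\<Sum>k<length xs. foldr create (xs[k := xs ! k - e]) f S))"
proof (induction xs)
  case (Cons x xs)
  have "hop e (foldr create (x # xs) f) =
      (\<lambda>S. create x (hop e (foldr create xs f)) S + create (x - e) (foldr create xs f) S)"
    by (simp add: hop_create[OF e])
  then show ?case
    by (simp add: Cons linop_add[OF linop_create] linop_sum[OF linop_create] sum.lessThan_Suc_shift algebra_simps del: sum.lessThan_Suc)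
qed simp

lemma hop_fold_annih:
  assumes e: "e = 1 \<or> e = -1"
  shows "hop e (fold annih ys f) =
    (\<lambda>S. fold annih ys (hop e f) S - (\<Sum>k<length ys. fold annih (ys[k := ys ! k + e]) f S))"
proof (induction ys arbitrary: f)
  case (Cons y ys)
  show ?case
    by (simp add: Cons hop_annih[OF e] linop_diff[OF linop_fold_annih] sum.lessThan_Suc_shift algebra_simps del: sum.lessThan_Suc)
qed simp

lemma hop_fermion:
  assumes e: "e = 1 \<or> e = -1"
  shows "hop e (fermion xs ys f) = (\<lambda>S. fermion xs ys (hop e f) S
    + (\<Sum>k<length xs. fermion (xs[k := xs ! k - e]) ys f S)
    - (\<Sum>k<length ys. fermion xs (ys[k := ys ! k + e]) f S))"
  by (simp add: fermion_def hop_foldr_create[OF e] hop_fold_annih[OF e]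
      linop_diff[OF linop_foldr_create] linop_sum[OF linop_foldr_create] algebra_simps)

definition corr :: "nat \<Rightarrow> nat \<Rightarrow> int list \<Rightarrow> int list \<Rightarrow> real" where
  "corr m n xs ys = (hop 1 ^^ m) (fermion xs ys ((hop (-1) ^^ n) vac_state)) vac"

text \<open>The innermost \<open>hop 1\<close> is moved right through the fermions onto the raised
  vacuum, where it acts like a derivative on the power of \<open>hop (-1)\<close>.\<close>

lemma corr_Suc_left:
  "corr (Suc m) n xs ys = real n * corr m (n - 1) xs ys
    + (\<Sum>k<length xs. corr m n (xs[k := xs ! k - 1]) ys)
    - (\<Sum>k<length ys. corr m n xs (ys[k := ys ! k + 1]))"
proof -
  note lin = linop_funpow[OF linop_hop[of 1], where n = m]
  show ?thesis
    by (simp add: corr_def funpow_Suc_right hop_fermion hop_funpow_vac_state linop_diff[OF lin] linop_add[OF lin]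
        linop_sum[OF lin] linop_scale[OF linop_fermion] linop_scale[OF lin] del: funpow.simps)
qed

text \<open>The outermost \<open>hop (-1)\<close> is moved left through the fermions and the powers
  of \<open>hop 1\<close>, until evaluation at \<open>vac\<close> kills it.\<close>

lemma corr_Suc_right:
  "corr m (Suc n) xs ys = real m * corr (m - 1) n xs ys
    - (\<Sum>k<length xs. corr m n (xs[k := xs ! k + 1]) ys)
    + (\<Sum>k<length ys. corr m n xs (ys[k := ys ! k - 1]))"
proof -
  let ?v = "(hop (-1) ^^ n) vac_state"
  note lin = linop_funpow[OF linop_hop[of 1], where n = m]
  have v: "supp_maya ?v" by (simp add: supp_maya_funpow)
  have "fermion xs ys (hop (-1) ?v) = (\<lambda>S. hop (-1) (fermion xs ys ?v) S
    - (\<Sum>k<length xs. fermion (xs[k := xs ! k + 1]) ys ?v S)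
    + (\<Sum>k<length ys. fermion xs (ys[k := ys ! k - 1]) ?v S))"
    by (simp add: hop_fermion[of "-1"])
  then have "corr m (Suc n) xs ys = (hop 1 ^^ m) (\<lambda>S. hop (-1) (fermion xs ys ?v) S
    - (\<Sum>k<length xs. fermion (xs[k := xs ! k + 1]) ys ?v S)
    + (\<Sum>k<length ys. fermion xs (ys[k := ys ! k - 1]) ?v S)) vac"
    by (simp add: corr_def)
  then show ?thesis
    unfolding linop_add[OF lin] linop_diff[OF lin] linop_sum[OF lin] funpow_hop_raise_vac[OF supp_maya_fermion[OF v]]
    by (simp add: corr_def)
qed

text \<open>The series in \<open>r\<close> of the matrix element of \<open>fermion xs ys\<close> between the exponentials of \<open>r\<close> times
  \<open>hop 1\<close> and \<open>hop (-1)\<close>.\<close>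
definition corr_fps :: "int list \<Rightarrow> int list \<Rightarrow> real fps" where
  "corr_fps xs ys = Abs_fps (\<lambda>j. \<Sum>i\<le>j. corr i (j - i) xs ys / (fact i * fact (j - i)))"

lemma sum_fact_shift_left:
  fixes a :: "nat \<Rightarrow> nat \<Rightarrow> real"
  shows "(\<Sum>i\<le>Suc j. real i * (a i (Suc j - i) / (fact i * fact (Suc j - i)))) =
    (\<Sum>i\<le>j. a (Suc i) (j - i) / (fact i * fact (j - i)))"
proof -
  have "(\<Sum>i\<le>Suc j. real i * (a i (Suc j - i) / (fact i * fact (Suc j - i)))) =
    (\<Sum>i\<le>j. real (Suc i) * (a (Suc i) (j - i) / (fact (Suc i) * fact (j - i))))"
    by (subst sum.atMost_Suc_shift) simp
  also have "\<dots> = (\<Sum>i\<le>j. a (Suc i) (j - i) / (fact i * fact (j - i)))"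
    by (intro sum.cong refl) (simp add: field_simps del: of_nat_Suc)
  finally show ?thesis .
qed

lemma sum_fact_shift_right:
  fixes a :: "nat \<Rightarrow> nat \<Rightarrow> real"
  shows "(\<Sum>i\<le>Suc j. real (Suc j - i) * (a i (Suc j - i) / (fact i * fact (Suc j - i)))) =
    (\<Sum>i\<le>j. a i (Suc (j - i)) / (fact i * fact (j - i)))"
proof -
  have "(\<Sum>i\<le>Suc j. real (Suc j - i) * (a i (Suc j - i) / (fact i * fact (Suc j - i)))) =
     (\<Sum>i\<le>j. real (Suc j - i) * (a i (Suc j - i) / (fact i * fact (Suc j - i))))"
    by simp
  also have "\<dots> = (\<Sum>i\<le>j. a i (Suc (j - i)) / (fact i * fact (j - i)))"
  proof (intro sum.cong refl)
    fix i assume "i \<in> {..j}"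
    then have "Suc j - i = Suc (j - i)" by auto
    then show "real (Suc j - i) * (a i (Suc j - i) / (fact i * fact (Suc j - i))) = a i (Suc (j - i)) / (fact i * fact (j - i))"
      by (simp add: field_simps del: of_nat_Suc)
  qed
  finally show ?thesis .
qed

text \<open>Differentiating the two exponentials inserts one more \<open>hop 1\<close> on the left
  or one more \<open>hop (-1)\<close> on the right, and the recursions of \<open>corr\<close>
  resolve both. Each insertion yields \<open>fps_X\<close> times the series through the commutator
  of the hops, whence the factor 2.\<close>

lemma corr_fps_deriv:
  "fps_deriv (corr_fps xs ys) = 2 * fps_X * corr_fps xs ys
    + (\<Sum>k<length xs. corr_fps (xs[k := xs ! k - 1]) ys - corr_fps (xs[k := xs ! k + 1]) ys)
    + (\<Sum>k<length ys. corr_fps xs (ys[k := ys ! k - 1]) - corr_fps xs (ys[k := ys ! k + 1]))"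
  (is "_ = ?R")
proof (rule fps_ext)
  fix j
  let ?c = "\<lambda>xs ys. (\<Sum>i\<le>j. corr i (j - i) xs ys / (fact i * fact (j - i)))"
  let ?F = "\<lambda>i. fact i * fact (j - i) :: real"
  have 1: "fps_nth (fps_deriv (corr_fps xs ys)) j =
     (\<Sum>i\<le>Suc j. real i * (corr i (Suc j - i) xs ys / (fact i * fact (Suc j - i)))) +
     (\<Sum>i\<le>Suc j. real (Suc j - i) * (corr i (Suc j - i) xs ys / (fact i * fact (Suc j - i))))"
    unfolding corr_fps_def fps_deriv_nth fps_nth_Abs_fps Suc_eq_plus1[symmetric] sum_distrib_left sum.distrib[symmetric]
    by (intro sum.cong refl) (auto simp: of_nat_diff algebra_simps simp flip: add_divide_distrib)
  have 2: "(\<Sum>i\<le>j. corr (Suc i) (j - i) xs ys / ?F i) =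
      (\<Sum>i\<le>j. real (j - i) * (corr i (j - i - 1) xs ys / ?F i))
      + (\<Sum>k<length xs. ?c (xs[k := xs ! k - 1]) ys) - (\<Sum>k<length ys. ?c xs (ys[k := ys ! k + 1]))"
    by (simp add: corr_Suc_left add_divide_distrib diff_divide_distrib sum.distrib sum_subtractf sum_divide_distrib)
       (simp add: sum.swap[of _ "{..j}"])
  have 3: "(\<Sum>i\<le>j. corr i (Suc (j - i)) xs ys / ?F i) =
      (\<Sum>i\<le>j. real i * (corr (i - 1) (j - i) xs ys / ?F i))
      - (\<Sum>k<length xs. ?c (xs[k := xs ! k + 1]) ys) + (\<Sum>k<length ys. ?c xs (ys[k := ys ! k - 1]))"
    by (simp add: corr_Suc_right add_divide_distrib diff_divide_distrib sum.distrib sum_subtractf sum_divide_distrib)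
       (simp add: sum.swap[of _ "{..j}"])
  \<comment> \<open>The truncated index at i = j is harmless, since its factor
    \<open>real (j - i)\<close> is 0 there.\<close>
  have 4: "(\<Sum>i\<le>j. real (j - i) * (corr i (j - i - 1) xs ys / ?F i)) = fps_nth (fps_X * corr_fps xs ys) j"
  proof (cases j)
    case (Suc l)
    then show ?thesis using sum_fact_shift_right[where j = l and a = "\<lambda>a b. corr a (b - 1) xs ys"]
      by (simp add: corr_fps_def)
  qed simp
  have 5: "(\<Sum>i\<le>j. real i * (corr (i - 1) (j - i) xs ys / ?F i)) = fps_nth (fps_X * corr_fps xs ys) j"
  proof (cases j)
    case (Suc l)
    then show ?thesis using sum_fact_shift_left[where j = l and a = "\<lambda>a b. corr (a - 1) b xs ys"]
      by (simp add: corr_fps_def)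
  qed simp
  have 6: "fps_nth ?R j = 2 * fps_nth (fps_X * corr_fps xs ys) j
    + (\<Sum>k<length xs. ?c (xs[k := xs ! k - 1]) ys - ?c (xs[k := xs ! k + 1]) ys)
    + (\<Sum>k<length ys. ?c xs (ys[k := ys ! k - 1]) - ?c xs (ys[k := ys ! k + 1]))"
    by (simp add: fps_sum_nth corr_fps_def mult.assoc numeral_fps_const)
  show "fps_nth (fps_deriv (corr_fps xs ys)) j = fps_nth ?R j"
    unfolding 1 sum_fact_shift_left[where a = "\<lambda>m n. corr m n xs ys"]
      sum_fact_shift_right[where a = "\<lambda>m n. corr m n xs ys"] 2 3 4 5 6
    by (simp add: sum_subtractf)
qed

section \<open>Anticommutation and Wick's rule at the vacuum\<close>

lemma create_create: "create x (create y f) = (\<lambda>S. - create y (create x f) S)"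
proof
  fix S
  have "S - {x} - {y} = S - {y} - {x}" by auto
  then show "create x (create y f) S = - create y (create x f) S"
    using jw_Diff[of S x y] jw_Diff[of S y x] by (auto simp: create_def)
qed

lemma create_annih:
  assumes "supp_maya f"
  shows "create x (annih y f) = (\<lambda>S. of_bool (x = y) * f S - annih y (create x f) S)"
proof
  fix S
  show "create x (annih y f) S = of_bool (x = y) * f S - annih y (create x f) S"
  proof (cases "maya S")
    case m: True
    show ?thesis
    proof (cases "x = y")
      case True
      then show ?thesis
        using m jw_Diff[of S x x] jw_insert[of S x x]
        by (auto simp: create_def annih_def insert_absorb simp flip: mult.assoc)
    next
      case False
      then have "insert y (S - {x}) = insert y S - {x}" by auto
      then show ?thesis using False m jw_Diff[of S x y] jw_insert[of S y x]
        by (auto simp: create_def annih_def)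
    qed
  next
    case False
    then show ?thesis using assms by (auto simp: supp_maya_def create_def annih_def)
  qed
qed

lemma create_foldr_create:
  "create x (foldr create xs f) = (\<lambda>S. (-1) ^ length xs * foldr create xs (create x f) S)"
  by (induction xs) (auto simp: create_create[of x] linop_scale[OF linop_create])

definition del_nth :: "nat \<Rightarrow> 'a list \<Rightarrow> 'a list" where
  "del_nth j ys = take j ys @ drop (Suc j) ys"

text \<open>Coming from outside, x passes the \<open>length ys - 1 - j\<close> annihilators applied
  after the j-th one before meeting it; this is the sign of the contraction.\<close>

lemma create_fold_annih:
  assumes "supp_maya f"
  shows "create x (fold annih ys f) = (\<lambda>S. (-1) ^ length ys * fold annih ys (create x f) S
    + (\<Sum>j<length ys. of_bool (x = ys ! j) * ((-1) ^ (length ys - 1 - j) * fold annih (del_nth j ys) f S)))"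
  using assms
proof (induction ys arbitrary: f)
  case (Cons y ys)
  have IH: "create x (fold annih ys (annih y f)) =
     (\<lambda>S. (-1) ^ length ys * fold annih ys (create x (annih y f)) S
    + (\<Sum>j<length ys. of_bool (x = ys ! j) * ((-1) ^ (length ys - 1 - j) * fold annih (del_nth j ys) (annih y f) S)))"
    by (rule Cons.IH) simp
  show ?case
    by (simp add: IH create_annih[OF Cons.prems] linop_diff[OF linop_fold_annih] linop_scale[OF linop_fold_annih]
        linop_zero[OF linop_fold_annih] sum.lessThan_Suc_shift del_nth_def algebra_simps del: sum.lessThan_Suc)
qed simp

lemma create_vac_state: "x < 0 \<Longrightarrow> create x vac_state = (\<lambda>S. 0)"
  by (auto simp: create_def vac_state_def fun_eq_iff vac_def)

definition vac_kernel :: "int \<Rightarrow> int \<Rightarrow> real" where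
  "vac_kernel x y = of_bool (x = y \<and> x < 0)"

text \<open>For x >= 0 both sides vanish because x is not in \<open>vac\<close>. For x < 0,
  \<open>create x\<close> pushed to the innermost place kills the vacuum vector, so only the
  contractions remain.\<close>

lemma fermion_vac_Cons:
  assumes "length ys = Suc (length xs)"
  shows "fermion (x # xs) ys vac_state vac =
    (\<Sum>j<length ys. (-1) ^ j * vac_kernel x (ys ! j) * fermion xs (del_nth j ys) vac_state vac)"
proof (cases "x < 0")
  case False
  then show ?thesis by (auto simp: fermion_def create_def vac_kernel_def vac_def)
next
  case True
  let ?s = "length xs"
  have "fermion (x # xs) ys vac_state vac = (-1) ^ ?s * foldr create xs (create x (fold annih ys vac_state)) vac"
    by (simp add: fermion_def create_foldr_create)
  also have "create x (fold annih ys vac_state) = (\<lambda>S. \<Sum>j<length ys. (of_bool (x = ys ! j) * (-1) ^ (?s - j)) * fold annih (del_nth j ys) vac_state S)"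
    using assms by (simp add: create_fold_annih create_vac_state[OF True] linop_zero[OF linop_fold_annih] mult.assoc)
  also have "(-1) ^ ?s * foldr create xs \<dots> vac =
    (\<Sum>j<length ys. (-1) ^ ?s * (of_bool (x = ys ! j) * (-1) ^ (?s - j) * fermion xs (del_nth j ys) vac_state vac))"
    by (simp add: linop_sum[OF linop_foldr_create] linop_scale[OF linop_foldr_create] fermion_def sum_distrib_left)
  also have "\<dots> = (\<Sum>j<length ys. (-1) ^ j * vac_kernel x (ys ! j) * fermion xs (del_nth j ys) vac_state vac)"
  proof (rule sum.cong)
    fix j assume "j \<in> {..<length ys}"
    then have "j \<le> ?s" using assms by auto
    then have "(-1) ^ ?s * (-1) ^ (?s - j) = ((-1) ^ j :: real)"
      by (metis (no_types) le_add_diff_inverse left_minus_one_mult_self mult.commute power_add)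
    then show "(-1) ^ ?s * (of_bool (x = ys ! j) * (-1) ^ (?s - j) * fermion xs (del_nth j ys) vac_state vac) =
      (-1) ^ j * vac_kernel x (ys ! j) * fermion xs (del_nth j ys) vac_state vac"
      using True by (auto simp: vac_kernel_def)
  qed simp
  finally show ?thesis .
qed

text \<open>The sum over contractions is the Laplace expansion along the first row, deleting entry j
  of ys being the deletion of column j.\<close>

lemma fermion_vac_det:
  assumes "length xs = s" "length ys = s"
  shows "fermion xs ys vac_state vac = det (mat s s (\<lambda>(i, j). vac_kernel (xs ! i) (ys ! j)))"
  using assms
proof (induction xs arbitrary: s ys)
  case Nil
  then show ?case by (simp add: fermion_def vac_state_def)
next
  case (Cons x xs)
  then obtain t where s: "s = Suc t" and t: "length xs = t" by auto
  let ?A = "mat s s (\<lambda>(i, j). vac_kernel ((x # xs) ! i) (ys ! j))"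
  have len: "length (del_nth j ys) = t" if "j < s" for j
    using that Cons.prems s by (auto simp: del_nth_def)
  have del: "mat_delete ?A 0 j = mat t t (\<lambda>(i, k). vac_kernel (xs ! i) (del_nth j ys ! k))" if "j < s" for j
  proof (rule eq_matI)
    fix i k assume "i < dim_row (mat t t (\<lambda>(i, k). vac_kernel (xs ! i) (del_nth j ys ! k)))"
      and "k < dim_col (mat t t (\<lambda>(i, k). vac_kernel (xs ! i) (del_nth j ys ! k)))"
    then show "mat_delete ?A 0 j $$ (i, k) = mat t t (\<lambda>(i, k). vac_kernel (xs ! i) (del_nth j ys ! k)) $$ (i, k)"
      using that Cons.prems s by (auto simp: mat_delete_def del_nth_def nth_append)
  qed (auto simp: s)
  have "fermion (x # xs) ys vac_state vac =
    (\<Sum>j<s. (-1) ^ j * vac_kernel x (ys ! j) * fermion xs (del_nth j ys) vac_state vac)"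
    using fermion_vac_Cons[of ys xs x] Cons.prems s by simp
  also have "\<dots> = (\<Sum>j<s. ?A $$ (0, j) * cofactor ?A 0 j)"
    by (intro sum.cong) (auto simp: cofactor_def del[unfolded s] Cons.IH[OF t len[unfolded s]] s)
  also have "\<dots> = det ?A"
    by (rule laplace_expansion_row[symmetric]) (auto simp: s)
  finally show ?case .
qed

section \<open>The determinantal formula\<close>

text \<open>The Taylor coefficients in r of the discrete Bessel kernel, as
  \<open>bkernel_sums_right\<close> confirms. The recursion is what the equation for s = 1 becomes
  after division by the vacuum series.\<close>

primrec kernel_coeff :: "nat \<Rightarrow> int \<Rightarrow> int \<Rightarrow> real" where
  "kernel_coeff 0 x y = vac_kernel x y"
| "kernel_coeff (Suc j) x y =
    (kernel_coeff j (x - 1) y - kernel_coeff j (x + 1) y + kernel_coeff j x (y - 1) - kernel_coeff j x (y + 1)) / real (Suc j)"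

definition kernel_fps :: "int \<Rightarrow> int \<Rightarrow> real fps" where
  "kernel_fps x y = Abs_fps (\<lambda>j. kernel_coeff j x y)"

lemma kernel_fps_deriv:
  "fps_deriv (kernel_fps x y) =
    (kernel_fps (x - 1) y - kernel_fps (x + 1) y) + (kernel_fps x (y - 1) - kernel_fps x (y + 1))"
  by (rule fps_ext) (simp add: kernel_fps_def del: of_nat_Suc)

text \<open>The determinant over an unordered index set and any commutative ring, which admits power
  series as entries and the two halves of a splitting as index sets.\<close>

definition leibniz :: "'i set \<Rightarrow> ('i \<Rightarrow> 'i \<Rightarrow> 'a :: comm_ring_1) \<Rightarrow> 'a" where
  "leibniz I A = (\<Sum>p | p permutes I. of_int (sign p) * (\<Prod>i\<in>I. A i (p i)))"

lemma det_eq_leibniz: "det (mat s s (\<lambda>(i, j). A i j)) = leibniz {..<s} A"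
proof -
  have "p i < s" if "p permutes {0..<s}" "i < s" for p i
    using that permutes_in_image[of p "{0..<s}" i] by simp
  then show ?thesis
    unfolding leibniz_def lessThan_atLeast0
    by (subst det_def') (auto intro!: sum.cong prod.cong)
qed

lemma fps_deriv_prod:
  fixes f :: "'i \<Rightarrow> 'a :: comm_ring_1 fps"
  shows "finite A \<Longrightarrow> fps_deriv (\<Prod>i\<in>A. f i) = (\<Sum>k\<in>A. fps_deriv (f k) * (\<Prod>i\<in>A - {k}. f i))"
proof (induction A rule: finite_induct)
  case (insert a A)
  have "(\<Sum>k\<in>A. fps_deriv (f k) * (\<Prod>i\<in>insert a A - {k}. f i)) =
      (\<Sum>k\<in>A. f a * (fps_deriv (f k) * (\<Prod>i\<in>A - {k}. f i)))"
  proof (rule sum.cong)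
    fix k assume "k \<in> A"
    then have "insert a A - {k} = insert a (A - {k})" using insert by auto
    then show "fps_deriv (f k) * (\<Prod>i\<in>insert a A - {k}. f i) = f a * (fps_deriv (f k) * (\<Prod>i\<in>A - {k}. f i))"
      using insert by (simp add: ac_simps)
  qed simp
  then show ?case using insert by (simp add: sum_distrib_left algebra_simps)
qed simp

lemma fps_deriv_signof: "fps_deriv (of_int (sign p) * (f :: 'a :: comm_ring_1 fps)) = of_int (sign p) * fps_deriv f"
  by (simp add: sign_def)

definition det_fps :: "nat \<Rightarrow> (nat \<Rightarrow> int) \<Rightarrow> (nat \<Rightarrow> int) \<Rightarrow> real fps" where
  "det_fps s x y = leibniz {..<s} (\<lambda>i j. kernel_fps (x i) (y j))"

lemma det_fps_row:
  assumes "k < s"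
  shows "det_fps s (x(k := v)) y =
    (\<Sum>p | p permutes {..<s}. of_int (sign p) * (kernel_fps v (y (p k)) * (\<Prod>i\<in>{..<s} - {k}. kernel_fps (x i) (y (p i)))))"
  unfolding det_fps_def leibniz_def
proof (intro sum.cong refl arg_cong2[where f = "(*)"])
  fix p
  have "(\<Prod>i\<in>{..<s}. kernel_fps ((x(k := v)) i) (y (p i))) =
      kernel_fps v (y (p k)) * (\<Prod>i\<in>{..<s} - {k}. kernel_fps ((x(k := v)) i) (y (p i)))"
    using assms by (subst prod.remove[of _ k]) auto
  also have "(\<Prod>i\<in>{..<s} - {k}. kernel_fps ((x(k := v)) i) (y (p i))) = (\<Prod>i\<in>{..<s} - {k}. kernel_fps (x i) (y (p i)))"
    by (rule prod.cong) auto
  finally show "(\<Prod>i<s. kernel_fps ((x(k := v)) i) (y (p i))) =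
    kernel_fps v (y (p k)) * (\<Prod>i\<in>{..<s} - {k}. kernel_fps (x i) (y (p i)))" .
qed

lemma det_fps_column_term:
  fixes s :: nat
  assumes "k < s" "p permutes {..<s}"
  shows "(\<Prod>i<s. kernel_fps (x i) ((y(p k := v)) (p i))) =
    kernel_fps (x k) v * (\<Prod>i\<in>{..<s} - {k}. kernel_fps (x i) (y (p i)))"
proof -
  have "(\<Prod>i<s. kernel_fps (x i) ((y(p k := v)) (p i))) =
      kernel_fps (x k) v * (\<Prod>i\<in>{..<s} - {k}. kernel_fps (x i) ((y(p k := v)) (p i)))"
    using assms by (subst prod.remove[of _ k]) auto
  also have "(\<Prod>i\<in>{..<s} - {k}. kernel_fps (x i) ((y(p k := v)) (p i))) = (\<Prod>i\<in>{..<s} - {k}. kernel_fps (x i) (y (p i)))"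
    using permutes_inj[OF assms(2)] by (intro prod.cong) (auto dest: injD)
  finally show ?thesis .
qed

text \<open>Column k meets p in the row that p sends to k. Writing the column as p k turns the
  change into one of the factor in row k, which is possible only after summing over all
  columns.\<close>

lemma det_fps_columns:
  "(\<Sum>k<s. det_fps s x (y(k := v k))) =
    (\<Sum>p | p permutes {..<s}. of_int (sign p) * (\<Sum>k<s. kernel_fps (x k) (v (p k)) * (\<Prod>i\<in>{..<s} - {k}. kernel_fps (x i) (y (p i)))))"
proof -
  have "(\<Sum>k<s. det_fps s x (y(k := v k))) =
    (\<Sum>p | p permutes {..<s}. of_int (sign p) * (\<Sum>k<s. \<Prod>i<s. kernel_fps (x i) ((y(k := v k)) (p i))))"
    unfolding det_fps_def leibniz_def by (subst sum.swap) (simp add: sum_distrib_left)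
  also have "\<dots> = (\<Sum>p | p permutes {..<s}. of_int (sign p) * (\<Sum>k<s. \<Prod>i<s. kernel_fps (x i) ((y(p k := v (p k))) (p i))))"
  proof (rule sum.cong[OF refl])
    fix p assume "p \<in> {p. p permutes {..<s}}"
    then have "bij_betw p {..<s} {..<s}" by (auto intro: permutes_imp_bij)
    from sum.reindex_bij_betw[OF this, of "\<lambda>k. \<Prod>i<s. kernel_fps (x i) ((y(k := v k)) (p i))"]
    show "of_int (sign p) * (\<Sum>k<s. \<Prod>i<s. kernel_fps (x i) ((y(k := v k)) (p i))) =
      of_int (sign p) * (\<Sum>k<s. \<Prod>i<s. kernel_fps (x i) ((y(p k := v (p k))) (p i)))"
      by (simp only:)
  qed
  also have "\<dots> = (\<Sum>p | p permutes {..<s}. of_int (sign p) * (\<Sum>k<s. kernel_fps (x k) (v (p k)) * (\<Prod>i\<in>{..<s} - {k}. kernel_fps (x i) (y (p i)))))"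
    by (intro sum.cong refl arg_cong2[where f = "(*)"] det_fps_column_term) auto
  finally show ?thesis .
qed

text \<open>Differentiating a kernel factor shifts its row index or its column index; collected by
  rows and columns this is the equation of \<open>corr_fps\<close> without the \<open>fps_X\<close>
  term, which is left to \<open>Z_fps\<close>.\<close>

lemma det_fps_deriv:
  "fps_deriv (det_fps s x y) =
    (\<Sum>k<s. det_fps s (x(k := x k - 1)) y - det_fps s (x(k := x k + 1)) y) +
    (\<Sum>k<s. det_fps s x (y(k := y k - 1)) - det_fps s x (y(k := y k + 1)))"
proof -
  let ?P = "\<lambda>p k. \<Prod>i\<in>{..<s} - {k}. kernel_fps (x i) (y (p i))"
  have "fps_deriv (det_fps s x y) = (\<Sum>p | p permutes {..<s}. of_int (sign p) *
     (\<Sum>k<s. fps_deriv (kernel_fps (x k) (y (p k))) * ?P p k))"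
    unfolding det_fps_def leibniz_def by (simp add: fps_deriv_sum fps_deriv_signof fps_deriv_prod)
  also have "\<dots> =
    ((\<Sum>k<s. \<Sum>p | p permutes {..<s}. of_int (sign p) * (kernel_fps (x k - 1) (y (p k)) * ?P p k)) -
     (\<Sum>k<s. \<Sum>p | p permutes {..<s}. of_int (sign p) * (kernel_fps (x k + 1) (y (p k)) * ?P p k))) +
    ((\<Sum>p | p permutes {..<s}. of_int (sign p) * (\<Sum>k<s. kernel_fps (x k) (y (p k) - 1) * ?P p k)) -
     (\<Sum>p | p permutes {..<s}. of_int (sign p) * (\<Sum>k<s. kernel_fps (x k) (y (p k) + 1) * ?P p k)))"
    unfolding kernel_fps_deriv sum.swap[of _ _ "{..<s}"]
    by (simp add: sum_distrib_left algebra_simps sum.distrib sum_subtractf)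
  also have "\<dots> =
    (\<Sum>k<s. det_fps s (x(k := x k - 1)) y - det_fps s (x(k := x k + 1)) y) +
    (\<Sum>k<s. det_fps s x (y(k := y k - 1)) - det_fps s x (y(k := y k + 1)))"
    unfolding sum_subtractf det_fps_columns[of s x y "\<lambda>k. y k - 1", symmetric] det_fps_columns[of s x y "\<lambda>k. y k + 1", symmetric]
    by (simp add: det_fps_row)
  finally show ?thesis .
qed

lemma fps_nth_0_signof: "fps_nth (of_int (sign p) * (f :: 'a :: comm_ring_1 fps)) 0 = of_int (sign p) * fps_nth f 0"
  by (simp add: sign_def)

lemma fps_nth_0_prod: "finite A \<Longrightarrow> fps_nth (\<Prod>i\<in>A. f i) 0 = (\<Prod>i\<in>A. fps_nth (f i) 0 :: 'a :: comm_ring_1)"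
  by (induction A rule: finite_induct) auto

lemma det_fps_nth_0: "fps_nth (det_fps s x y) 0 = corr 0 0 (map x [0..<s]) (map y [0..<s])"
proof -
  have "fps_nth (det_fps s x y) 0 = leibniz {..<s} (\<lambda>i j. vac_kernel (x i) (y j))"
    by (simp add: det_fps_def leibniz_def fps_sum_nth fps_nth_0_signof fps_nth_0_prod kernel_fps_def)
  also have "\<dots> = det (mat s s (\<lambda>(i, j). vac_kernel (map x [0..<s] ! i) (map y [0..<s] ! j)))"
    unfolding det_eq_leibniz[symmetric] by (intro arg_cong[of _ _ det] eq_matI) auto
  also have "\<dots> = corr 0 0 (map x [0..<s]) (map y [0..<s])"
    using fermion_vac_det[of "map x [0..<s]" s "map y [0..<s]"] by (simp add: corr_def)
  finally show ?thesis .
qed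

text \<open>The normalisation exp (r^2), the series without fermions; dividing by it gives Poisson
  averages.\<close>

definition Z_fps :: "real fps" where "Z_fps = corr_fps [] []"

lemma map_fun_upd_upt: "k < s \<Longrightarrow> map (x(k := v)) [0..<s] = (map x [0..<s])[k := v]"
  by (rule nth_equalityI) (auto simp: nth_list_update)

theorem corr_fps_eq_det: "corr_fps (map x [0..<s]) (map y [0..<s]) = Z_fps * det_fps s x y"
proof -
  let ?m = "\<lambda>x. map x [0..<s]"
  define F where "F x y = corr_fps (?m x) (?m y) - Z_fps * det_fps s x y" for x y :: "nat \<Rightarrow> int"
  have Z': "fps_deriv Z_fps = 2 * fps_X * Z_fps" "fps_nth Z_fps 0 = 1"
    by (simp_all add: Z_fps_def corr_fps_deriv) (simp add: corr_fps_def corr_def fermion_def vac_state_def)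
  have F': "fps_deriv (F x y) = 2 * fps_X * F x y +
    (\<Sum>k<s. F (x(k := x k - 1)) y - F (x(k := x k + 1)) y) +
    (\<Sum>k<s. F x (y(k := y k - 1)) - F x (y(k := y k + 1)))" for x y
  proof -
    have c: "fps_deriv (corr_fps (?m x) (?m y)) = 2 * fps_X * corr_fps (?m x) (?m y) +
      (\<Sum>k<s. corr_fps (?m (x(k := x k - 1))) (?m y) - corr_fps (?m (x(k := x k + 1))) (?m y)) +
      (\<Sum>k<s. corr_fps (?m x) (?m (y(k := y k - 1))) - corr_fps (?m x) (?m (y(k := y k + 1))))"
      by (simp add: corr_fps_deriv map_fun_upd_upt)
    show ?thesis
      unfolding F_def fps_deriv_sub fps_deriv_mult c Z' det_fps_deriv
      by (simp add: algebra_simps sum.distrib sum_subtractf sum_distrib_left)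
  qed
  have "fps_nth (F x y) j = 0" for x y j
  proof (induction j arbitrary: x y rule: less_induct)
    case (less j)
    show ?case
    proof (cases j)
      case 0
      then show ?thesis using Z'(2) by (simp add: F_def det_fps_nth_0) (simp add: corr_fps_def)
    next
      case (Suc i)
      \<comment> \<open>Coefficient i of the right-hand side needs coefficient i of the shifted F
        and, through \<open>fps_X\<close>, coefficient i - 1.\<close>
      have "fps_nth (fps_deriv (F x y)) i = 0"
        unfolding F' using less.IH Suc
        by (cases i) (simp_all add: fps_sum_nth mult.assoc numeral_fps_const)
      then show ?thesis using Suc by simp
    qed
  qed
  then have "F x y = 0" by (intro fps_ext) simp
  then show ?thesis by (simp add: F_def)
qed

lemma corr_Nil: "corr m n [] [] = (if m = n then fact n else 0)"
proof (induction m arbitrary: n)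
  case 0
  show ?case
  proof (cases n)
    case (Suc k)
    then show ?thesis using corr_Suc_right[of 0 k "[]" "[]"] by simp
  qed (simp add: corr_def fermion_def vac_state_def)
next
  case (Suc m)
  then show ?case by (cases n) (auto simp: corr_Suc_left)
qed

section \<open>Partitions and the Plancherel measure\<close>

definition edge :: "(nat \<Rightarrow> nat) \<Rightarrow> nat \<Rightarrow> int" where
  "edge lam i = int (lam i) - int (i + 1)"

definition addable :: "(nat \<Rightarrow> nat) \<Rightarrow> nat set" where
  "addable lam = {i. i = 0 \<or> lam i < lam (i - 1)}"

definition removable :: "(nat \<Rightarrow> nat) \<Rightarrow> nat set" where
  "removable lam = {i. lam (Suc i) < lam i}"

definition add_box :: "(nat \<Rightarrow> nat) \<Rightarrow> nat \<Rightarrow> nat \<Rightarrow> nat" where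
  "add_box lam i = lam(i := lam i + 1)"

definition remove_box :: "(nat \<Rightarrow> nat) \<Rightarrow> nat \<Rightarrow> nat \<Rightarrow> nat" where
  "remove_box lam i = lam(i := lam i - 1)"

lemma descents_edge: "descents lam = range (edge lam)"
  by (simp add: descents_def edge_def[abs_def])

lemma edge_less: "antimono lam \<Longrightarrow> i < j \<Longrightarrow> edge lam j < edge lam i"
  using antimonoD[of lam i j] by (simp add: edge_def)

lemma edge_in_descents [simp]: "edge lam i \<in> descents lam"
  by (simp add: descents_edge)

lemma inj_edge: "antimono lam \<Longrightarrow> inj (edge lam)"
  by (rule injI) (metis edge_less less_irrefl nat_neq_iff)

text \<open>The edges strictly decrease, so the only row that can occupy the place next to edge i is
  row i - 1, and it does so exactly when the two rows have equal length.\<close>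

lemma edge_Suc_notin:
  assumes "antimono lam"
  shows "edge lam i + 1 \<notin> descents lam \<longleftrightarrow> i \<in> addable lam"
proof
  assume "edge lam i + 1 \<notin> descents lam"
  then have "edge lam (i - 1) \<noteq> edge lam i + 1" using edge_in_descents by metis
  moreover have "lam i \<le> lam (i - 1)" by (rule antimonoD[OF assms]) simp
  ultimately show "i \<in> addable lam" by (cases i) (auto simp: addable_def edge_def)
next
  assume add: "i \<in> addable lam"
  show "edge lam i + 1 \<notin> descents lam"
  proof
    assume "edge lam i + 1 \<in> descents lam"
    then obtain j where j: "edge lam j = edge lam i + 1" by (auto simp: descents_edge)
    then have "j < i" using edge_less[OF assms, of i j] by (cases i j rule: linorder_cases) auto
    then have "lam i < lam (i - 1)" "lam (i - 1) \<le> lam j"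
      using add antimonoD[OF assms, of j "i - 1"] by (auto simp: addable_def)
    then show False using j \<open>j < i\<close> by (simp add: edge_def)
  qed
qed

lemma edge_minus_notin:
  assumes "antimono lam"
  shows "edge lam i + (-1) \<notin> descents lam \<longleftrightarrow> i \<in> removable lam"
proof
  assume "edge lam i + (-1) \<notin> descents lam"
  then have "edge lam (Suc i) \<noteq> edge lam i + (-1)" using edge_in_descents by metis
  moreover have "lam (Suc i) \<le> lam i" by (rule antimonoD[OF assms]) simp
  ultimately show "i \<in> removable lam" by (auto simp: removable_def edge_def)
next
  assume rem: "i \<in> removable lam"
  show "edge lam i + (-1) \<notin> descents lam"
  proof
    assume "edge lam i + (-1) \<in> descents lam"
    then obtain j where j: "edge lam j = edge lam i - 1" by (auto simp: descents_edge)
    then have "i < j" using edge_less[OF assms, of j i] by (cases i j rule: linorder_cases) auto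
    then have "lam (Suc i) < lam i" "lam j \<le> lam (Suc i)"
      using rem antimonoD[OF assms, of "Suc i" j] by (auto simp: removable_def)
    then show False using j \<open>i < j\<close> by (simp add: edge_def)
  qed
qed

lemma descents_update:
  assumes "antimono lam"
  shows "descents (lam(i := v)) = insert (int v - int (i + 1)) (descents lam - {edge lam i})"
proof -
  let ?e = "edge (lam(i := v))"
  have "range ?e = insert (?e i) (?e ` (- {i}))" by auto
  also have "?e ` (- {i}) = edge lam ` (- {i})" by (intro image_cong) (auto simp: edge_def)
  finally have "descents (lam(i := v)) = insert (int v - int (i + 1)) (edge lam ` (- {i}))"
    by (simp add: descents_edge) (simp add: edge_def)
  also have "edge lam ` (- {i}) = descents lam - {edge lam i}"
    using inj_edge[OF assms] by (auto simp: descents_edge dest: injD)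
  finally show ?thesis .
qed

lemma descents_add_box:
  "antimono lam \<Longrightarrow> descents (add_box lam i) = insert (edge lam i + 1) (descents lam - {edge lam i})"
  by (simp add: add_box_def descents_update) (simp add: edge_def algebra_simps)

lemma descents_remove_box:
  assumes "antimono lam" "i \<in> removable lam"
  shows "descents (remove_box lam i) = insert (edge lam i + (-1)) (descents lam - {edge lam i})"
proof -
  have "int (lam i - 1) - int (i + 1) = edge lam i + (-1)"
    using assms(2) by (auto simp: edge_def removable_def of_nat_diff)
  then show ?thesis
    using descents_update[OF assms(1), of i "lam i - 1"] unfolding remove_box_def by (simp only:)
qed

text \<open>Any bound N beyond the support may be used, so a diagram and its modification by a box
  can be summed over the same interval.\<close>

lemma is_partition_iff:
  "is_partition n lam \<longleftrightarrow> antimono lam \<and> (\<exists>N. (\<forall>i\<ge>N. lam i = 0) \<and> (\<Sum>i<N. lam i) = n)"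
proof -
  have lt: "i < N" if "\<forall>i\<ge>N. lam i = 0" "lam i \<noteq> 0" for N i
    using that by (metis linorder_not_le)
  have sum: "(\<Sum>i | lam i \<noteq> 0. lam i) = (\<Sum>i<N. lam i)" if "\<forall>i\<ge>N. lam i = 0" for N
    by (rule sum.mono_neutral_left) (use lt[OF that] in auto)
  have "(\<forall>i\<in>{i. lam i \<noteq> 0}. i < N) \<longleftrightarrow> (\<forall>i\<ge>N. lam i = 0)" for N
    using lt[of N] by fastforce
  then have fin: "finite {i. lam i \<noteq> 0} \<longleftrightarrow> (\<exists>N. \<forall>i\<ge>N. lam i = 0)"
    unfolding finite_nat_set_iff_bounded by simp
  show ?thesis unfolding is_partition_def fin using sum by metis
qed

lemma is_partition_antimono: "is_partition n lam \<Longrightarrow> antimono lam"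
  by (simp add: is_partition_def)

lemma antimono_add_box:
  assumes "antimono lam" "i \<in> addable lam"
  shows "antimono (add_box lam i)"
proof (rule antimonoI)
  fix j k :: nat assume "j \<le> k"
  have "lam i < lam j" if "j < i"
  proof -
    have "j \<le> i - 1" using that by simp
    from antimonoD[OF assms(1) this] show ?thesis using that assms(2) by (auto simp: addable_def)
  qed
  then show "add_box lam i k \<le> add_box lam i j"
    using antimonoD[OF assms(1) \<open>j \<le> k\<close>] \<open>j \<le> k\<close> by (auto simp: add_box_def Suc_le_eq)
qed

lemma antimono_remove_box:
  assumes "antimono lam" "i \<in> removable lam"
  shows "antimono (remove_box lam i)"
proof (rule antimonoI)
  fix j k :: nat assume "j \<le> k"
  have "lam k < lam i" if "i < k"
    using that assms(2) antimonoD[OF assms(1), of "Suc i" k] by (auto simp: removable_def)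
  then show "remove_box lam i k \<le> remove_box lam i j"
    using antimonoD[OF assms(1) \<open>j \<le> k\<close>] \<open>j \<le> k\<close> by (auto simp: remove_box_def)
qed

lemma is_partition_add_box:
  assumes "is_partition n lam" "i \<in> addable lam"
  shows "is_partition (Suc n) (add_box lam i)"
proof -
  obtain N where N: "\<forall>i\<ge>N. lam i = 0" "(\<Sum>i<N. lam i) = n"
    using assms(1) by (auto simp: is_partition_iff)
  let ?M = "max N (Suc i)"
  have "(\<Sum>j<?M. add_box lam i j) = (\<Sum>j<?M. lam j + (if j = i then 1 else 0))"
    by (intro sum.cong) (auto simp: add_box_def)
  also have "\<dots> = (\<Sum>j<?M. lam j) + 1"
    by (simp add: sum.distrib)
  also have "(\<Sum>j<?M. lam j) = (\<Sum>j<N. lam j)"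
    by (rule sum.mono_neutral_right) (use N in auto)
  finally have "(\<Sum>j<?M. add_box lam i j) = Suc n" using N by simp
  moreover have "\<forall>j\<ge>?M. add_box lam i j = 0" using N by (auto simp: add_box_def)
  ultimately show ?thesis
    using antimono_add_box[OF is_partition_antimono[OF assms(1)] assms(2)]
    unfolding is_partition_iff by (intro conjI exI[of _ ?M])
qed

lemma add_remove_box: "i \<in> removable lam \<Longrightarrow> add_box (remove_box lam i) i = lam"
  by (auto simp: add_box_def remove_box_def removable_def fun_eq_iff)

lemma remove_add_box: "remove_box (add_box lam i) i = lam"
  by (auto simp: add_box_def remove_box_def)

lemma removable_add_box: "antimono lam \<Longrightarrow> i \<in> removable (add_box lam i)"
  using antimonoD[of lam i "Suc i"] by (simp add: removable_def add_box_def)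

lemma addable_remove_box: "antimono lam \<Longrightarrow> i \<in> removable lam \<Longrightarrow> i \<in> addable (remove_box lam i)"
  using antimonoD[of lam "i - 1" i] by (cases i) (auto simp: addable_def remove_box_def removable_def)

lemma is_partition_remove_box:
  assumes "is_partition (Suc n) lam" "i \<in> removable lam"
  shows "is_partition n (remove_box lam i)"
proof -
  obtain N where N: "\<forall>i\<ge>N. lam i = 0" "(\<Sum>i<N. lam i) = Suc n"
    using assms(1) by (auto simp: is_partition_iff)
  have rem: "lam i > 0" using assms(2) by (auto simp: removable_def)
  then have "i < N" using N(1) by (metis linorder_not_le less_irrefl)
  have "(\<Sum>j<N. lam j) = (\<Sum>j<N. remove_box lam i j + (if j = i then 1 else 0))"
    using rem by (intro sum.cong) (auto simp: remove_box_def)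
  also have "\<dots> = (\<Sum>j<N. remove_box lam i j) + 1"
    using \<open>i < N\<close> by (simp add: sum.distrib)
  finally have "(\<Sum>j<N. remove_box lam i j) = n" using N by simp
  moreover have "\<forall>j\<ge>N. remove_box lam i j = 0" using N by (auto simp: remove_box_def)
  ultimately show ?thesis
    using antimono_remove_box[OF is_partition_antimono[OF assms(1)] assms(2)] by (auto simp: is_partition_iff)
qed

lemma partition_0: "is_partition 0 lam \<longleftrightarrow> lam = (\<lambda>i. 0)"
proof
  assume "is_partition 0 lam"
  then obtain N where "\<forall>i\<ge>N. lam i = 0" "(\<Sum>i<N. lam i) = 0" by (auto simp: is_partition_iff)
  then have "lam i = 0" for i by (cases "i < N") auto
  then show "lam = (\<lambda>i. 0)" by auto
next
  assume "lam = (\<lambda>i. 0)"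
  then show "is_partition 0 lam" by (simp add: is_partition_def antimono_def)
qed

lemma finite_removable: "is_partition n lam \<Longrightarrow> finite (removable lam)"
  by (rule finite_subset[of _ "{i. lam i \<noteq> 0}"]) (auto simp: removable_def is_partition_def)

lemma finite_addable:
  assumes "is_partition n lam"
  shows "finite (addable lam)"
proof (rule finite_subset)
  show "addable lam \<subseteq> insert 0 (Suc ` {i. lam i \<noteq> 0})"
  proof
    fix i assume "i \<in> addable lam"
    then show "i \<in> insert 0 (Suc ` {i. lam i \<noteq> 0})" by (cases i) (auto simp: addable_def)
  qed
  show "finite (insert 0 (Suc ` {i. lam i \<noteq> 0}))" using assms by (simp add: is_partition_def)
qed

lemma maya_descents: "is_partition n lam \<Longrightarrow> maya (descents lam)"
proof -
  assume p: "is_partition n lam"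
  then obtain N where N: "\<forall>i\<ge>N. lam i = 0" by (auto simp: is_partition_iff)
  have "descents lam \<inter> {0..} \<subseteq> edge lam ` {..<N}"
  proof
    fix z assume "z \<in> descents lam \<inter> {0..}"
    then obtain i where i: "z = edge lam i" "z \<ge> 0" by (auto simp: descents_edge)
    then have "lam i \<noteq> 0" by (auto simp: edge_def)
    then have "i < N" using N by (metis linorder_not_le)
    then show "z \<in> edge lam ` {..<N}" using i by auto
  qed
  moreover have "{..<0} - descents lam \<subseteq> {- int N..<0}"
  proof
    fix z assume z: "z \<in> {..<0} - descents lam"
    show "z \<in> {- int N..<0}"
    proof (rule ccontr)
      assume "z \<notin> {- int N..<0}"
      then have "z < - int N" using z by auto
      then have "edge lam (nat (- z - 1)) = z" using N by (auto simp: edge_def nat_le_eq_zle)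
      then show False using z edge_in_descents[of lam "nat (- z - 1)"] by simp
    qed
  qed
  ultimately show ?thesis unfolding maya_def by (meson finite_imageI finite_lessThan finite_subset finite_atLeastLessThan_int)
qed

lemma hop_descents_add:
  assumes "is_partition n lam"
  shows "hop 1 g (descents lam) = (\<Sum>i\<in>addable lam. g (descents (add_box lam i)))"
proof -
  note am = is_partition_antimono[OF assms]
  have img: "{z. z \<in> descents lam \<and> z + 1 \<notin> descents lam} = edge lam ` addable lam"
    using edge_Suc_notin[OF am] by (auto simp: descents_edge)
  have "hop 1 g (descents lam) = (\<Sum>z\<in>edge lam ` addable lam. g (insert (z + 1) (descents lam - {z})))"
    using maya_descents[OF assms] by (simp add: hop_def img)
  also have "\<dots> = (\<Sum>i\<in>addable lam. g (descents (add_box lam i)))"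
    by (subst sum.reindex) (auto simp: descents_add_box[OF am] intro: inj_on_subset[OF inj_edge[OF am]])
  finally show ?thesis .
qed

lemma hop_descents_remove:
  assumes "is_partition n lam"
  shows "hop (-1) g (descents lam) = (\<Sum>i\<in>removable lam. g (descents (remove_box lam i)))"
proof -
  note am = is_partition_antimono[OF assms]
  have img: "{z. z \<in> descents lam \<and> z + (-1) \<notin> descents lam} = edge lam ` removable lam"
    using edge_minus_notin[OF am] by (auto simp: descents_edge)
  have "hop (-1) g (descents lam) = (\<Sum>z\<in>edge lam ` removable lam. g (insert (z + (-1)) (descents lam - {z})))"
    using maya_descents[OF assms] unfolding hop_def img by (simp only: if_True)
  also have "\<dots> = (\<Sum>i\<in>removable lam. g (descents (remove_box lam i)))"
    by (subst sum.reindex) (auto simp: descents_remove_box[OF am] intro: inj_on_subset[OF inj_edge[OF am]])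
  finally show ?thesis .
qed

section \<open>Standard tableaux and the branching rule\<close>

lemma finite_diagram: "is_partition n lam \<Longrightarrow> finite (diagram lam)"
  and card_diagram: "is_partition n lam \<Longrightarrow> card (diagram lam) = n"
proof -
  assume p: "is_partition n lam"
  have "diagram lam = (SIGMA i:{i. lam i \<noteq> 0}. {..<lam i})" by (auto simp: diagram_def)
  then show "finite (diagram lam)" "card (diagram lam) = n"
    using p by (auto simp: is_partition_def)
qed

lemma finite_standard_tableaux:
  assumes "finite (diagram lam)"
  shows "finite (standard_tableaux lam)"
proof (rule finite_subset)
  show "standard_tableaux lam \<subseteq> diagram lam \<rightarrow>\<^sub>E {1..card (diagram lam)}"
  proof
    fix T assume "T \<in> standard_tableaux lam"
    then have "T \<in> extensional (diagram lam)" "bij_betw T (diagram lam) {1..card (diagram lam)}"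
      by (simp_all add: standard_tableaux_def)
    then show "T \<in> diagram lam \<rightarrow>\<^sub>E {1..card (diagram lam)}"
      by (auto simp: PiE_def dest: bij_betwE)
  qed
  show "finite (diagram lam \<rightarrow>\<^sub>E {1..card (diagram lam)})"
    using assms by (intro finite_PiE) auto
qed

lemma diagram_remove_box:
  assumes "i \<in> removable lam"
  shows "diagram lam = insert (i, lam i - 1) (diagram (remove_box lam i))"
    and "(i, lam i - 1) \<notin> diagram (remove_box lam i)"
proof -
  have "(k, j) \<in> diagram lam \<longleftrightarrow> (k, j) \<in> insert (i, lam i - 1) (diagram (remove_box lam i))" for k j
    using assms by (cases "k = i") (auto simp: diagram_def remove_box_def removable_def)
  then show "diagram lam = insert (i, lam i - 1) (diagram (remove_box lam i))" by auto
  show "(i, lam i - 1) \<notin> diagram (remove_box lam i)"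
    by (simp add: diagram_def remove_box_def)
qed

text \<open>Restricting to the smaller diagram forgets the box with entry \<open>Suc n\<close>.
  Conversely that box is the last of its row and of its column, so putting the largest entry there
  respects every inequality.\<close>

lemma tableaux_with_largest_at:
  assumes p: "is_partition (Suc n) lam" and i: "i \<in> removable lam"
  shows "card {T \<in> standard_tableaux lam. T (i, lam i - 1) = Suc n} = dim_partition (remove_box lam i)"
proof -
  let ?c = "(i, lam i - 1)" and ?mu = "remove_box lam i"
  note D = diagram_remove_box(1)[OF i] and cnot = diagram_remove_box(2)[OF i]
  have c1: "card (diagram lam) = Suc n" and c2: "card (diagram ?mu) = n"
    using card_diagram[OF p] card_diagram[OF is_partition_remove_box[OF p i]] by auto
  have row: "(i, j) \<notin> diagram lam" if "lam i - 1 < j" for j using that by (auto simp: diagram_def)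
  have col: "(k, lam i - 1) \<notin> diagram lam" if "i < k" for k
    using that i antimonoD[OF is_partition_antimono[OF p], of "Suc i" k] by (auto simp: diagram_def removable_def)
  have "bij_betw (\<lambda>T. restrict T (diagram ?mu)) {T \<in> standard_tableaux lam. T ?c = Suc n} (standard_tableaux ?mu)"
  proof (rule bij_betwI[where g = "\<lambda>T. T(?c := Suc n)"])
    show "(\<lambda>T. restrict T (diagram ?mu)) \<in> {T \<in> standard_tableaux lam. T ?c = Suc n} \<rightarrow> standard_tableaux ?mu"
    proof (rule Pi_I)
      fix T assume T: "T \<in> {T \<in> standard_tableaux lam. T ?c = Suc n}"
      then have "bij_betw T (diagram ?mu \<union> {?c}) ({1..n} \<union> {T ?c})"
        using c1 D by (simp add: standard_tableaux_def atLeastAtMostSuc_conv)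
      then have "bij_betw T (diagram ?mu) {1..n}"
        using T cnot by (subst (asm) notIn_Un_bij_betw3[symmetric]) auto
      then have "bij_betw (restrict T (diagram ?mu)) (diagram ?mu) {1..card (diagram ?mu)}"
        unfolding c2 by (subst bij_betw_cong[of _ _ T]) auto
      then show "restrict T (diagram ?mu) \<in> standard_tableaux ?mu"
        using T D by (auto simp: standard_tableaux_def)
    qed
  next
    show "(\<lambda>T. T(?c := Suc n)) \<in> standard_tableaux ?mu \<rightarrow> {T \<in> standard_tableaux lam. T ?c = Suc n}"
    proof (rule Pi_I)
      fix T assume T: "T \<in> standard_tableaux ?mu"
      let ?T = "T(?c := Suc n)"
      have bT: "bij_betw T (diagram ?mu) {1..n}" using T c2 by (simp add: standard_tableaux_def)
      then have "bij_betw ?T (diagram ?mu) {1..n}"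
        using cnot by (subst bij_betw_cong[of _ _ T]) auto
      then have "bij_betw ?T (diagram ?mu \<union> {?c}) ({1..n} \<union> {?T ?c})"
        using cnot by (subst notIn_Un_bij_betw3[symmetric]) auto
      then have "bij_betw ?T (diagram lam) {1..card (diagram lam)}"
        using c1 D by (simp add: atLeastAtMostSuc_conv)
      moreover have small: "T z < Suc n" if "z \<in> diagram ?mu" for z
        using bij_betwE[OF bT] that by fastforce
      moreover have "?T \<in> extensional (diagram lam)"
      proof -
        have "T \<in> extensional (diagram ?mu)" using T by (simp add: standard_tableaux_def)
        then show ?thesis unfolding D extensional_def by simp
      qed
      moreover have "?T (k, j) < ?T (k, j')" if h: "j < j'" "(k, j) \<in> diagram lam" "(k, j') \<in> diagram lam" for k j j'
      proof -
        have "(k, j) \<noteq> ?c" using row[of j'] h by auto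
        then have 1: "(k, j) \<in> diagram ?mu" "?T (k, j) = T (k, j)" using h(2) D by auto
        show ?thesis
        proof (cases "(k, j') = ?c")
          case True
          then show ?thesis using 1 small by simp
        next
          case False
          then have "(k, j') \<in> diagram ?mu" using h(3) D by auto
          then have "T (k, j) < T (k, j')" using T 1(1) h(1) unfolding standard_tableaux_def by blast
          then show ?thesis unfolding 1(2) fun_upd_other[OF False] .
        qed
      qed
      moreover have "?T (k, j) < ?T (k', j)" if h: "k < k'" "(k, j) \<in> diagram lam" "(k', j) \<in> diagram lam" for k k' j
      proof -
        have "(k, j) \<noteq> ?c" using col[of k'] h by auto
        then have 1: "(k, j) \<in> diagram ?mu" "?T (k, j) = T (k, j)" using h(2) D by auto
        show ?thesis
        proof (cases "(k', j) = ?c")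
          case True
          then show ?thesis using 1 small by simp
        next
          case False
          then have "(k', j) \<in> diagram ?mu" using h(3) D by auto
          then have "T (k, j) < T (k', j)" using T 1(1) h(1) unfolding standard_tableaux_def by blast
          then show ?thesis unfolding 1(2) fun_upd_other[OF False] .
        qed
      qed
      ultimately have "?T \<in> standard_tableaux lam"
        unfolding standard_tableaux_def by blast
      then show "?T \<in> {T \<in> standard_tableaux lam. T ?c = Suc n}" by simp
    qed
  next
    fix T assume T: "T \<in> {T \<in> standard_tableaux lam. T ?c = Suc n}"
    then have "T \<in> extensional (diagram lam)" by (simp add: standard_tableaux_def)
    then have "T z = undefined" if "z \<notin> diagram lam" for z
      using that by (rule extensional_arb)
    then show "(restrict T (diagram ?mu))(?c := Suc n) = T"
      using T D by (auto simp: fun_eq_iff restrict_def)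
  next
    fix T assume T: "T \<in> standard_tableaux ?mu"
    then have "T \<in> extensional (diagram ?mu)" by (simp add: standard_tableaux_def)
    then have "T z = undefined" if "z \<notin> diagram ?mu" for z
      using that by (rule extensional_arb)
    then show "restrict (T(?c := Suc n)) (diagram ?mu) = T"
      using cnot by (auto simp: fun_eq_iff restrict_def)
  qed
  then show ?thesis by (simp add: dim_partition_def bij_betw_same_card)
qed

text \<open>A box to the right of the largest entry, or below it, would have to carry a still larger
  one.\<close>

lemma largest_entry_removable:
  assumes p: "is_partition (Suc n) lam" and T: "T \<in> standard_tableaux lam"
  shows "\<exists>i\<in>removable lam. T (i, lam i - 1) = Suc n"
proof -
  have bT: "bij_betw T (diagram lam) {1..Suc n}"
    using T card_diagram[OF p] by (simp add: standard_tableaux_def)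
  then have "Suc n \<in> T ` diagram lam" by (simp add: bij_betw_def)
  then obtain i j where c: "(i, j) \<in> diagram lam" "T (i, j) = Suc n" by (metis imageE surj_pair)
  have max: "T z \<le> Suc n" if "z \<in> diagram lam" for z
    using bij_betwE[OF bT] that by fastforce
  have "(i, Suc j) \<notin> diagram lam"
  proof
    assume d: "(i, Suc j) \<in> diagram lam"
    then have "T (i, j) < T (i, Suc j)" using c(1) T unfolding standard_tableaux_def by blast
    then show False using max[OF d] c(2) by simp
  qed
  moreover have "(Suc i, j) \<notin> diagram lam"
  proof
    assume d: "(Suc i, j) \<in> diagram lam"
    then have "T (i, j) < T (Suc i, j)" using c(1) T unfolding standard_tableaux_def by blast
    then show False using max[OF d] c(2) by simp
  qed
  ultimately have "j = lam i - 1" "i \<in> removable lam"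
    using c(1) by (auto simp: diagram_def removable_def)
  then show ?thesis using c(2) by blast
qed

lemma dim_partition_rec:
  assumes p: "is_partition (Suc n) lam"
  shows "dim_partition lam = (\<Sum>i\<in>removable lam. dim_partition (remove_box lam i))"
proof -
  let ?S = "\<lambda>i. {T \<in> standard_tableaux lam. T (i, lam i - 1) = Suc n}"
  note fin = finite_standard_tableaux[OF finite_diagram[OF p]]
  have U: "standard_tableaux lam = (\<Union>i\<in>removable lam. ?S i)"
    using largest_entry_removable[OF p] by auto
  have "?S i \<inter> ?S k = {}" if "i \<in> removable lam" "k \<in> removable lam" "i \<noteq> k" for i k
  proof (rule ccontr)
    assume "?S i \<inter> ?S k \<noteq> {}"
    then obtain T where "T \<in> ?S i" "T \<in> ?S k" by blast
    then have T: "T \<in> standard_tableaux lam" "T (i, lam i - 1) = T (k, lam k - 1)" by simp_all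
    moreover have "(i, lam i - 1) \<in> diagram lam" "(k, lam k - 1) \<in> diagram lam"
      using that by (auto simp: diagram_def removable_def)
    ultimately have "(i, lam i - 1) = (k, lam k - 1)"
      unfolding standard_tableaux_def bij_betw_def by (auto dest: inj_onD)
    then show False using that by simp
  qed
  then have "card (standard_tableaux lam) = (\<Sum>i\<in>removable lam. card (?S i))"
    using fin by (subst U, subst card_UN_disjoint) (auto simp: finite_removable[OF p])
  also have "\<dots> = (\<Sum>i\<in>removable lam. dim_partition (remove_box lam i))"
    by (intro sum.cong refl tableaux_with_largest_at[OF p])
  finally show ?thesis by (simp add: dim_partition_def[of lam])
qed

lemma dim_partition_empty: "dim_partition (\<lambda>i. 0) = 1"
proof -
  have "diagram (\<lambda>i. 0) = {}" by (auto simp: diagram_def)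
  then have "standard_tableaux (\<lambda>i. 0) = {\<lambda>c. undefined}"
    by (auto simp: standard_tableaux_def bij_betw_def)
  then show ?thesis by (simp add: dim_partition_def)
qed

lemma descents_empty: "descents (\<lambda>i. 0) = vac"
proof -
  have "z \<in> range (\<lambda>i. - 1 - int i)" if "z < 0" for z
    by (rule image_eqI[of _ _ "nat (- z - 1)"]) (use that in auto)
  then show ?thesis by (auto simp: descents_def vac_def)
qed

section \<open>Paths in Young's graph\<close>

text \<open>Both sides run over the edges of Young's graph between levels n and n + 1, grouped by
  the lower end and by the upper end.\<close>

lemma sum_add_remove:
  "(\<Sum>lam | is_partition n lam. \<Sum>i\<in>addable lam. F lam i) =
   (\<Sum>lam | is_partition (Suc n) lam. \<Sum>i\<in>removable lam. F (remove_box lam i) i)"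
proof -
  have "(\<Sum>lam | is_partition n lam. \<Sum>i\<in>addable lam. F lam i) =
      (\<Sum>(lam, i)\<in>(SIGMA lam:{lam. is_partition n lam}. addable lam). F lam i)"
    by (rule sum.Sigma) (auto simp: finite_partitions finite_addable)
  also have "\<dots> = (\<Sum>(lam, i)\<in>(SIGMA lam:{lam. is_partition (Suc n) lam}. removable lam). F (remove_box lam i) i)"
    by (rule sum.reindex_bij_witness[where i = "\<lambda>(lam, i). (remove_box lam i, i)" and j = "\<lambda>(lam, i). (add_box lam i, i)"])
       (auto simp: add_remove_box remove_add_box is_partition_add_box is_partition_remove_box
          removable_add_box addable_remove_box is_partition_antimono)
  also have "\<dots> = (\<Sum>lam | is_partition (Suc n) lam. \<Sum>i\<in>removable lam. F (remove_box lam i) i)"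
    by (rule sum.Sigma[symmetric]) (auto simp: finite_partitions finite_removable)
  finally show ?thesis .
qed

text \<open>The power sums g over the end points of all growth paths of length n from the empty
  diagram, and by the branching rule the dimension counts the paths to a given end.\<close>

lemma hop_funpow_vac:
  "(hop 1 ^^ n) g vac = (\<Sum>lam | is_partition n lam. real (dim_partition lam) * g (descents lam))"
proof (induction n arbitrary: g)
  case 0
  show ?case by (simp add: partition_0 dim_partition_empty descents_empty)
next
  case (Suc n)
  have "(hop 1 ^^ Suc n) g vac = (hop 1 ^^ n) (hop 1 g) vac" by (simp add: funpow_swap1)
  also have "\<dots> = (\<Sum>lam | is_partition n lam. \<Sum>i\<in>addable lam. real (dim_partition lam) * g (descents (add_box lam i)))"
    unfolding Suc.IH by (intro sum.cong refl) (simp add: hop_descents_add sum_distrib_left)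
  also have "\<dots> = (\<Sum>lam | is_partition (Suc n) lam. \<Sum>i\<in>removable lam. real (dim_partition (remove_box lam i)) * g (descents lam))"
    unfolding sum_add_remove by (intro sum.cong refl) (simp add: add_remove_box)
  also have "\<dots> = (\<Sum>lam | is_partition (Suc n) lam. real (dim_partition lam) * g (descents lam))"
    by (intro sum.cong refl) (simp add: dim_partition_rec sum_distrib_right)
  finally show ?case .
qed

text \<open>The same count read downwards: stripping n boxes in all possible ways, only paths that
  end in the empty diagram contribute.\<close>

lemma raise_funpow_vac_state:
  "is_partition m lam \<Longrightarrow> (hop (-1) ^^ n) vac_state (descents lam) = (if m = n then real (dim_partition lam) else 0)"
proof (induction n arbitrary: m lam)
  case 0
  show ?case
  proof (cases m)
    case 0
    then show ?thesis using 0 \<open>is_partition m lam\<close> by (simp add: partition_0 descents_empty dim_partition_empty vac_state_def)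
  next
    case (Suc k)
    have "lam 0 \<noteq> 0"
    proof
      assume "lam 0 = 0"
      then have "lam i = 0" for i using antimonoD[OF is_partition_antimono[OF 0], of 0 i] by simp
      then have "is_partition 0 lam" using partition_0 by auto
      then show False using 0 Suc by (auto simp: is_partition_def)
    qed
    then have "edge lam 0 \<notin> vac" by (auto simp: edge_def vac_def)
    then have "descents lam \<noteq> vac" using edge_in_descents by metis
    then show ?thesis using Suc by (simp add: vac_state_def)
  qed
next
  case (Suc n)
  have "(hop (-1) ^^ Suc n) vac_state (descents lam) = (\<Sum>i\<in>removable lam. (hop (-1) ^^ n) vac_state (descents (remove_box lam i)))"
    using hop_descents_remove[OF Suc.prems] by simp
  also have "\<dots> = (if m = Suc n then real (dim_partition lam) else 0)"
  proof (cases m)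
    case 0
    then have "removable lam = {}" using Suc.prems by (auto simp: partition_0 removable_def)
    then show ?thesis using 0 by simp
  next
    case (Suc k)
    then show ?thesis
      using Suc.IH[OF is_partition_remove_box] Suc.prems by (auto simp: dim_partition_rec)
  qed
  finally show ?case .
qed

text \<open>\<open>create x\<close> after \<open>annih x\<close> is the projection onto sets
  containing x: the two signs are taken at S and S - {x}, which agree above x, so they
  cancel.\<close>

lemma fermion_same:
  assumes "distinct xs" "supp_maya f"
  shows "fermion xs xs f = (\<lambda>S. of_bool (set xs \<subseteq> S) * f S)"
  using assms
proof (induction xs arbitrary: f)
  case (Cons x xs)
  have "fermion (x # xs) (x # xs) f = create x (fermion xs xs (annih x f))"
    by (simp add: fermion_def)
  also have "\<dots> = create x (\<lambda>S. of_bool (set xs \<subseteq> S) * annih x f S)"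
    using Cons by simp
  also have "\<dots> = (\<lambda>S. of_bool (set (x # xs) \<subseteq> S) * f S)"
  proof
    fix S
    show "create x (\<lambda>S. of_bool (set xs \<subseteq> S) * annih x f S) S = of_bool (set (x # xs) \<subseteq> S) * f S"
    proof (cases "maya S \<and> x \<in> S")
      case True
      then have "set xs \<subseteq> S - {x} \<longleftrightarrow> set (x # xs) \<subseteq> S" using Cons.prems by auto
      then show ?thesis using True jw_Diff[of S x x]
        by (auto simp: create_def annih_def insert_absorb simp flip: mult.assoc)
    next
      case False
      then show ?thesis using Cons.prems by (auto simp: create_def supp_maya_def)
    qed
  qed
  finally show ?case .
qed (simp add: fermion_def)

lemma corr_same:
  assumes "distinct xs"
  shows "corr m n xs xs = (if m = n then fact n * rho n (set xs) else 0)"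
proof -
  have "corr m n xs xs = (\<Sum>lam | is_partition m lam. real (dim_partition lam) *
     (of_bool (set xs \<subseteq> descents lam) * (if m = n then real (dim_partition lam) else 0)))"
    unfolding corr_def fermion_same[OF assms supp_maya_funpow[OF supp_maya_vac_state]] hop_funpow_vac
    by (intro sum.cong refl) (simp add: raise_funpow_vac_state)
  also have "\<dots> = (if m = n then fact n * rho n (set xs) else 0)"
  proof (cases "m = n")
    case True
    have "fact n * rho n (set xs) = (\<Sum>lam | is_partition n lam \<and> set xs \<subseteq> descents lam. (real (dim_partition lam))\<^sup>2)"
      by (simp add: rho_def plancherel_def sum_distrib_left)
    also have "\<dots> = (\<Sum>lam | is_partition n lam. real (dim_partition lam) *
     (of_bool (set xs \<subseteq> descents lam) * real (dim_partition lam)))"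
      by (intro sum.mono_neutral_cong_left) (auto simp: finite_partitions power2_eq_square)
    finally show ?thesis using True by simp
  qed simp
  finally show ?thesis .
qed

text \<open>The vacuum value of n lowerings after n raisings is computed twice, by counting paths
  and by the commutation relation behind \<open>corr_Nil\<close>.\<close>

lemma sum_dim_squared: "(\<Sum>lam | is_partition n lam. (real (dim_partition lam))\<^sup>2) = fact n"
proof -
  have "fact n * rho n {} = fact n" using corr_same[of "[]" n n] by (simp add: corr_Nil)
  then show ?thesis by (simp add: rho_def plancherel_def flip: sum_divide_distrib)
qed

lemma rho_nonneg: "0 \<le> rho n X"
  by (simp add: rho_def plancherel_def sum_nonneg)

lemma rho_le_1: "rho n X \<le> 1"
proof -
  have "rho n X \<le> (\<Sum>lam | is_partition n lam. (real (dim_partition lam))\<^sup>2 / fact n)"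
    unfolding rho_def plancherel_def by (rule sum_mono2) (auto simp: finite_partitions)
  also have "\<dots> = 1" by (simp add: sum_dim_squared flip: sum_divide_distrib)
  finally show ?thesis .
qed

section \<open>Comparing consecutive Plancherel measures\<close>

text \<open>The weights dim lam * dim mu / (n + 1)! on the edges of Young's graph couple the two
  measures (Plancherel growth). In operators: one \<open>hop 1\<close> stands outside the indicator
  for the size n + 1 and inside it for the size n.\<close>

lemma rho_Suc_diff:
  assumes "distinct xs"
  shows "fact (Suc n) * (rho (Suc n) (set xs) - rho n (set xs)) =
    (\<Sum>lam | is_partition n lam. \<Sum>i\<in>addable lam. real (dim_partition lam) * real (dim_partition (add_box lam i)) *
      (of_bool (set xs \<subseteq> descents (add_box lam i)) - of_bool (set xs \<subseteq> descents lam)))"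
proof -
  let ?v = "\<lambda>n. (hop (-1) ^^ n) vac_state" and ?P = "\<lambda>f S. of_bool (set xs \<subseteq> S) * f S :: real"
  note fs = fermion_same[OF assms supp_maya_funpow[OF supp_maya_vac_state]]
  have 1: "fact (Suc n) * rho (Suc n) (set xs) = (hop 1 ^^ n) (hop 1 (?P (?v (Suc n)))) vac"
  proof -
    have "(hop 1 ^^ Suc n) g vac = (hop 1 ^^ n) (hop 1 g) vac" for g by (simp add: funpow_swap1)
    then show ?thesis
      using corr_same[OF assms, of "Suc n" "Suc n"] unfolding corr_def fs by (simp del: funpow.simps fact_Suc)
  qed
  have 2: "fact (Suc n) * rho n (set xs) = (hop 1 ^^ n) (?P (hop 1 (?v (Suc n)))) vac"
  proof -
    have "?P (hop 1 (?v (Suc n))) = (\<lambda>S. real (Suc n) * ?P (?v n) S)"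
      by (simp add: hop_funpow_vac_state del: funpow.simps) (auto simp: fun_eq_iff)
    then have "(hop 1 ^^ n) (?P (hop 1 (?v (Suc n)))) vac = real (Suc n) * corr n n xs xs"
      by (simp add: linop_scale[OF linop_funpow[OF linop_hop]] corr_def fs del: of_nat_Suc)
    then show ?thesis using corr_same[OF assms, of n n] by simp
  qed
  have "fact (Suc n) * (rho (Suc n) (set xs) - rho n (set xs)) =
    (\<Sum>lam | is_partition n lam. real (dim_partition lam) *
      (hop 1 (?P (?v (Suc n))) (descents lam) - ?P (hop 1 (?v (Suc n))) (descents lam)))"
    unfolding right_diff_distrib 1 2 hop_funpow_vac by (simp only: right_diff_distrib sum_subtractf)
  also have "\<dots> = (\<Sum>lam | is_partition n lam. \<Sum>i\<in>addable lam. real (dim_partition lam) * real (dim_partition (add_box lam i)) *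
      (of_bool (set xs \<subseteq> descents (add_box lam i)) - of_bool (set xs \<subseteq> descents lam)))"
  proof (intro sum.cong refl)
    fix lam assume "lam \<in> {lam. is_partition n lam}"
    then have p: "is_partition n lam" by simp
    have v: "?v (Suc n) (descents (add_box lam i)) = real (dim_partition (add_box lam i))" if "i \<in> addable lam" for i
      using raise_funpow_vac_state[OF is_partition_add_box[OF p that], of "Suc n"] by simp
    have "hop 1 (?P (?v (Suc n))) (descents lam) - ?P (hop 1 (?v (Suc n))) (descents lam) =
      (\<Sum>i\<in>addable lam. ?v (Suc n) (descents (add_box lam i)) *
        (of_bool (set xs \<subseteq> descents (add_box lam i)) - of_bool (set xs \<subseteq> descents lam)))"
      unfolding hop_descents_add[OF p] sum_distrib_left sum_subtractf[symmetric]
      by (intro sum.cong refl) (simp add: algebra_simps)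
    also have "\<dots> = (\<Sum>i\<in>addable lam. real (dim_partition (add_box lam i)) *
        (of_bool (set xs \<subseteq> descents (add_box lam i)) - of_bool (set xs \<subseteq> descents lam)))"
      by (intro sum.cong refl) (simp only: v)
    finally show "real (dim_partition lam) * (hop 1 (?P (?v (Suc n))) (descents lam) - ?P (hop 1 (?v (Suc n))) (descents lam)) =
       (\<Sum>i\<in>addable lam. real (dim_partition lam) * real (dim_partition (add_box lam i)) *
      (of_bool (set xs \<subseteq> descents (add_box lam i)) - of_bool (set xs \<subseteq> descents lam)))"
      by (simp only: sum_distrib_left mult.assoc)
  qed
  finally show ?thesis .
qed

text \<open>At a given place a diagram has at most one addable box, and a diagram arises in at most
  one way by adding a box there, so both projections of the index set are injective and each sum of
  squares is at most a full one. The weight \<open>?c\<close> in the arithmetic-geometric inequality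
  balances n! against (n + 1)!.\<close>

lemma sum_dim_prod_at:
  "(\<Sum>lam | is_partition n lam. \<Sum>i | i \<in> addable lam \<and> edge lam i = z.
      real (dim_partition lam) * real (dim_partition (add_box lam i))) \<le> sqrt (real (Suc n)) * fact n"
proof -
  let ?c = "sqrt (real (Suc n))"
  let ?P = "SIGMA lam:{lam. is_partition n lam}. {i. i \<in> addable lam \<and> edge lam i = z}"
  let ?d = "\<lambda>lam. real (dim_partition lam)"
  have c: "?c > 0" "?c * ?c = real (Suc n)" by (simp_all del: of_nat_Suc)
  have amgm: "u * v \<le> (?c * u\<^sup>2 + v\<^sup>2 / ?c) / 2" for u v :: real
  proof -
    have "0 \<le> (?c * u - v)\<^sup>2 / ?c" using c(1) by simp
    also have "\<dots> = ?c * u\<^sup>2 + v\<^sup>2 / ?c - 2 * (u * v)"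
      using c(1) by (simp add: field_simps power2_eq_square)
    finally show ?thesis by simp
  qed
  have finP: "finite ?P" by (intro finite_SigmaI) (auto simp: finite_partitions finite_addable)
  have inj1: "inj_on fst ?P"
  proof (rule inj_onI)
    fix u v assume "u \<in> ?P" "v \<in> ?P" "fst u = fst v"
    then show "u = v" using inj_edge[OF is_partition_antimono] by (cases u, cases v) (auto dest: injD)
  qed
  have inj2: "inj_on (\<lambda>(lam, i). add_box lam i) ?P"
  proof (rule inj_onI)
    fix u v assume u: "u \<in> ?P" and v: "v \<in> ?P" and eq: "(\<lambda>(lam, i). add_box lam i) u = (\<lambda>(lam, i). add_box lam i) v"
    obtain l i l' i' where uv: "u = (l, i)" "v = (l', i')" by (metis surj_pair)
    have e: "edge (add_box l i) i = z + 1" "edge (add_box l' i') i' = z + 1"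
      using u v uv by (auto simp: edge_def add_box_def)
    have "antimono (add_box l i)" using u uv by (auto intro: antimono_add_box is_partition_antimono)
    then have "i = i'" by (rule injD[OF inj_edge]) (use e eq uv in simp)
    then have "l = l'" using eq uv remove_add_box by (metis case_prod_conv)
    then show "u = v" using uv \<open>i = i'\<close> by simp
  qed
  have 1: "(\<Sum>(lam, i)\<in>?P. (?d lam)\<^sup>2) \<le> fact n"
  proof -
    have "(\<Sum>(lam, i)\<in>?P. (?d lam)\<^sup>2) = (\<Sum>lam\<in>fst ` ?P. (?d lam)\<^sup>2)"
      by (subst sum.reindex[OF inj1]) (auto intro: sum.cong)
    also have "\<dots> \<le> (\<Sum>lam | is_partition n lam. (?d lam)\<^sup>2)"
      by (rule sum_mono2) (auto simp: finite_partitions)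
    finally show ?thesis by (simp add: sum_dim_squared)
  qed
  have 2: "(\<Sum>(lam, i)\<in>?P. (?d (add_box lam i))\<^sup>2) \<le> fact (Suc n)"
  proof -
    have "(\<Sum>(lam, i)\<in>?P. (?d (add_box lam i))\<^sup>2) = (\<Sum>lam\<in>(\<lambda>(lam, i). add_box lam i) ` ?P. (?d lam)\<^sup>2)"
      by (subst sum.reindex[OF inj2]) (auto intro: sum.cong)
    also have "\<dots> \<le> (\<Sum>lam | is_partition (Suc n) lam. (?d lam)\<^sup>2)"
      by (rule sum_mono2) (auto simp: finite_partitions is_partition_add_box)
    finally show ?thesis by (simp only: sum_dim_squared)
  qed
  have "(\<Sum>lam | is_partition n lam. \<Sum>i | i \<in> addable lam \<and> edge lam i = z. ?d lam * ?d (add_box lam i)) =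
     (\<Sum>(lam, i)\<in>?P. ?d lam * ?d (add_box lam i))"
    by (rule sum.Sigma) (auto simp: finite_partitions finite_addable)
  also have "\<dots> \<le> (\<Sum>(lam, i)\<in>?P. (?c * (?d lam)\<^sup>2 + (?d (add_box lam i))\<^sup>2 / ?c) / 2)"
    using amgm by (intro sum_mono) (simp add: case_prod_beta)
  also have "\<dots> = (?c * (\<Sum>(lam, i)\<in>?P. (?d lam)\<^sup>2) + (\<Sum>(lam, i)\<in>?P. (?d (add_box lam i))\<^sup>2) / ?c) / 2"
    by (simp add: case_prod_beta sum_distrib_left sum_divide_distrib sum.distrib add_divide_distrib del: of_nat_Suc)
  also have "\<dots> \<le> (?c * fact n + fact (Suc n) / ?c) / 2"
    using 1 2 c(1) by (intro divide_right_mono add_mono mult_left_mono) auto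
  also have "fact (Suc n) / ?c = ?c * fact n"
  proof -
    have "fact (Suc n) = (?c * ?c) * fact n" unfolding c(2) by simp
    then show ?thesis using c(1) by (simp only: mult.assoc) simp
  qed
  finally show ?thesis by (simp add: mult.commute)
qed

text \<open>Growing the diagram by one box moves one descent, and by Cauchy-Schwarz it moves a descent at a given
  place with probability at most \<open>1 / sqrt (n + 1)\<close>.\<close>
lemma rho_Suc_Lipschitz:
  assumes "finite X"
  shows "\<bar>rho (Suc n) X - rho n X\<bar> \<le> 2 * card X / sqrt (real (Suc n))"
proof -
  obtain xs where xs: "distinct xs" "set xs = X" using finite_distinct_list[OF assms] by auto
  \<comment> \<open>A descent going from z to z + 1 can affect the covering of X only by leaving a
    point of X or by landing on one.\<close>
  let ?Z = "X \<union> (\<lambda>x. x - 1) ` X" and ?c = "sqrt (real (Suc n))"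
  let ?w = "\<lambda>lam i. real (dim_partition lam) * real (dim_partition (add_box lam i))"
  have c: "?c > 0" "?c * ?c = real (Suc n)" by (simp_all del: of_nat_Suc)
  have finZ: "finite ?Z" using assms by simp
  have "card ?Z \<le> card X + card ((\<lambda>x. x - 1) ` X)" by (rule card_Un_le)
  also have "\<dots> \<le> 2 * card X" using card_image_le[OF assms, of "\<lambda>x. x - 1"] by simp
  finally have cardZ: "card ?Z \<le> 2 * card X" .
  have "fact (Suc n) * \<bar>rho (Suc n) X - rho n X\<bar> =
    \<bar>\<Sum>lam | is_partition n lam. \<Sum>i\<in>addable lam. ?w lam i *
      (of_bool (X \<subseteq> descents (add_box lam i)) - of_bool (X \<subseteq> descents lam))\<bar>"
  proof -
    have "fact (Suc n) * \<bar>r\<bar> = \<bar>fact (Suc n) * r\<bar>" for r :: real by (simp add: abs_mult del: fact_Suc)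
    then show ?thesis using rho_Suc_diff[OF xs(1), of n] xs(2) by (simp only:)
  qed
  also have "\<dots> \<le> (\<Sum>lam | is_partition n lam. \<Sum>i\<in>addable lam. ?w lam i * of_bool (edge lam i \<in> ?Z))"
  proof (intro order_trans[OF sum_abs] sum_mono)
    fix lam i assume "lam \<in> {lam. is_partition n lam}" "i \<in> addable lam"
    then have d: "descents (add_box lam i) = insert (edge lam i + 1) (descents lam - {edge lam i})"
      by (simp add: descents_add_box is_partition_antimono)
    have "X \<subseteq> descents (add_box lam i) \<longleftrightarrow> X \<subseteq> descents lam" if nz: "edge lam i \<notin> ?Z"
    proof -
      have "edge lam i \<notin> X" using nz by blast
      moreover have "edge lam i + 1 \<notin> X" using nz by force
      ultimately show ?thesis unfolding d by (auto simp: subset_iff)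
    qed
    then show "\<bar>?w lam i * (of_bool (X \<subseteq> descents (add_box lam i)) - of_bool (X \<subseteq> descents lam))\<bar>
        \<le> ?w lam i * of_bool (edge lam i \<in> ?Z)"
      by (cases "edge lam i \<in> ?Z") (auto simp: abs_mult)
  qed
  also have "\<dots> = (\<Sum>lam | is_partition n lam. \<Sum>z\<in>?Z. \<Sum>i | i \<in> addable lam \<and> edge lam i = z. ?w lam i)"
  proof (intro sum.cong refl)
    fix lam assume "lam \<in> {lam. is_partition n lam}"
    then have f: "finite (addable lam)" using finite_addable by auto
    have "(\<Sum>z\<in>?Z. \<Sum>i | i \<in> addable lam \<and> edge lam i = z. ?w lam i) = (\<Sum>z\<in>?Z. \<Sum>i | i \<in> {i \<in> addable lam. edge lam i \<in> ?Z} \<and> edge lam i = z. ?w lam i)"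
      by (intro sum.cong refl) auto
    also have "\<dots> = (\<Sum>i | i \<in> addable lam \<and> edge lam i \<in> ?Z. ?w lam i)"
      using f finZ by (subst sum.group) auto
    also have "\<dots> = (\<Sum>i\<in>addable lam. ?w lam i * of_bool (edge lam i \<in> ?Z))"
      using f by (intro sum.mono_neutral_cong_left) auto
    finally show "(\<Sum>i\<in>addable lam. ?w lam i * of_bool (edge lam i \<in> ?Z)) =
      (\<Sum>z\<in>?Z. \<Sum>i | i \<in> addable lam \<and> edge lam i = z. ?w lam i)" by (rule sym)
  qed
  also have "\<dots> = (\<Sum>z\<in>?Z. \<Sum>lam | is_partition n lam. \<Sum>i | i \<in> addable lam \<and> edge lam i = z. ?w lam i)"
    by (rule sum.swap)
  also have "\<dots> \<le> (\<Sum>z\<in>?Z. ?c * fact n)"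
    by (intro sum_mono sum_dim_prod_at)
  also have "\<dots> \<le> (2 * card X) * (?c * fact n)"
    using cardZ c(1) by (simp only: sum_constant) (intro mult_right_mono, auto)
  finally have "fact (Suc n) * \<bar>rho (Suc n) X - rho n X\<bar> \<le> (2 * card X) * (?c * fact n)" .
  moreover have "fact (Suc n) = ?c * ?c * fact n" unfolding c(2) by simp
  ultimately have "(?c * fact n) * (?c * \<bar>rho (Suc n) X - rho n X\<bar>) \<le> (?c * fact n) * (2 * card X)"
    by (simp only: mult_ac)
  then have "?c * \<bar>rho (Suc n) X - rho n X\<bar> \<le> 2 * card X"
    using c(1) by (subst (asm) mult_le_cancel_left_pos) auto
  then show ?thesis using c(1) by (simp add: pos_le_divide_eq mult.commute)
qed

section \<open>The discrete Bessel kernel\<close>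

lemma summable_exp_bound:
  fixes c :: "nat \<Rightarrow> real"
  assumes "\<And>j. \<bar>c j\<bar> \<le> M ^ j / fact j"
  shows "summable (\<lambda>j. c j * z ^ j)" "summable (\<lambda>j. \<bar>c j * z ^ j\<bar>)"
proof -
  have s: "summable (\<lambda>j. (M * \<bar>z\<bar>) ^ j / fact j)"
    using summable_exp[of "M * \<bar>z\<bar>"] by (simp add: field_simps)
  have "\<bar>c j * z ^ j\<bar> \<le> (M * \<bar>z\<bar>) ^ j / fact j" for j
  proof -
    have "\<bar>c j * z ^ j\<bar> = \<bar>c j\<bar> * \<bar>z\<bar> ^ j" by (simp add: abs_mult power_abs)
    also have "\<dots> \<le> M ^ j / fact j * \<bar>z\<bar> ^ j" by (intro mult_right_mono assms) auto
    finally show ?thesis by (simp add: power_mult_distrib)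
  qed
  then show "summable (\<lambda>j. \<bar>c j * z ^ j\<bar>)"
    by (intro summable_comparison_test'[OF s]) auto
  then show "summable (\<lambda>j. c j * z ^ j)" by (rule summable_rabs_cancel)
qed

lemma entire_fps:
  fixes f :: "real fps"
  assumes "\<And>j. \<bar>fps_nth f j\<bar> \<le> M ^ j / fact j"
  shows "fps_conv_radius f = \<infinity>"
  unfolding fps_conv_radius_def by (intro conv_radius_inftyI'' summable_exp_bound(1)[OF assms])

text \<open>For j >= N a factor exp (j - N) >= 1 may be inserted: its part exp j enlarges M to
  \<open>M * exp 1\<close>, and exp (- N) is the gain.\<close>

lemma entire_fps_tail:
  fixes f :: "real fps"
  assumes bd: "\<And>j. \<bar>fps_nth f j\<bar> \<le> M ^ j / fact j" and "M \<ge> 0" "r \<ge> 0"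
    and zero: "\<And>j. j < N \<Longrightarrow> fps_nth f j = 0"
  shows "\<bar>eval_fps f r\<bar> \<le> exp (- real N) * exp (M * exp 1 * r)"
proof -
  have le: "\<bar>fps_nth f j * r ^ j\<bar> \<le> exp (- real N) * ((M * exp 1 * r) ^ j / fact j)" for j
  proof (cases "j < N")
    case False
    have "1 \<le> exp (real j - real N)" using False by simp
    then have "M ^ j / fact j * r ^ j * 1 \<le> M ^ j / fact j * r ^ j * exp (real j - real N)"
      using assms by (intro mult_left_mono) auto
    moreover have "\<bar>fps_nth f j * r ^ j\<bar> \<le> M ^ j / fact j * r ^ j"
    proof -
      have "\<bar>fps_nth f j * r ^ j\<bar> = \<bar>fps_nth f j\<bar> * r ^ j" using \<open>r \<ge> 0\<close> by (simp add: abs_mult)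
      also have "\<dots> \<le> M ^ j / fact j * r ^ j" using \<open>r \<ge> 0\<close> by (intro mult_right_mono bd) auto
      finally show ?thesis .
    qed
    moreover have "exp (real j - real N) = exp (- real N) * exp 1 ^ j"
      by (simp add: exp_diff exp_minus divide_inverse flip: exp_of_nat_mult)
    ultimately show ?thesis by (simp add: power_mult_distrib mult_ac)
  qed (use assms in auto)
  have s: "(\<lambda>j. exp (- real N) * ((M * exp 1 * r) ^ j / fact j)) sums (exp (- real N) * exp (M * exp 1 * r))"
    using exp_converges[of "M * exp 1 * r"] by (intro sums_mult) (simp add: field_simps)
  have "\<bar>eval_fps f r\<bar> \<le> (\<Sum>j. \<bar>fps_nth f j * r ^ j\<bar>)"
    unfolding eval_fps_def by (rule summable_rabs[OF summable_exp_bound(2)[OF bd]])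
  also have "\<dots> \<le> (\<Sum>j. exp (- real N) * ((M * exp 1 * r) ^ j / fact j))"
    by (intro suminf_le le summable_exp_bound(2)[OF bd] sums_summable[OF s])
  also have "\<dots> = exp (- real N) * exp (M * exp 1 * r)" using s by (rule sums_unique[symmetric])
  finally show ?thesis .
qed

text \<open>Coefficient form of d/dr J_n(2r) = J_(n-1)(2r) - J_(n+1)(2r), with J_n(0) equal to 1 for
  n = 0 and to 0 otherwise.\<close>

primrec bessel_coeff :: "nat \<Rightarrow> int \<Rightarrow> real" where
  "bessel_coeff 0 n = of_bool (n = 0)"
| "bessel_coeff (Suc j) n = (bessel_coeff j (n - 1) - bessel_coeff j (n + 1)) / real (Suc j)"

definition bessel_fps :: "int \<Rightarrow> real fps" where
  "bessel_fps n = Abs_fps (\<lambda>j. bessel_coeff j n)"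

lemma bessel_fps_deriv: "fps_deriv (bessel_fps n) = bessel_fps (n - 1) - bessel_fps (n + 1)"
  by (rule fps_ext) (simp add: bessel_fps_def del: of_nat_Suc)

text \<open>Both sides solve the same first-order system in (x, y). At r = 0 the difference of the
  two half-line kernels is the single point x = y = -1, precisely where both Bessel factors are
  1.\<close>

lemma kernel_fps_diff:
  "kernel_fps x y - kernel_fps (x + 1) (y + 1) = bessel_fps (x + 1) * bessel_fps (y + 1)"
proof -
  define F where "F = (\<lambda>(x, y). kernel_fps x y - kernel_fps (x + 1) (y + 1) - bessel_fps (x + 1) * bessel_fps (y + 1))"
  have D: "fps_deriv (F (x, y)) = F (x - 1, y) - F (x + 1, y) + F (x, y - 1) - F (x, y + 1)" for x y
    by (simp add: F_def kernel_fps_deriv bessel_fps_deriv algebra_simps)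
  have "fps_nth (F (x, y)) j = 0" for x y j
  proof (induction j arbitrary: x y)
    case 0
    then show ?case by (auto simp: F_def kernel_fps_def bessel_fps_def vac_kernel_def)
  next
    case (Suc j)
    have "fps_nth (fps_deriv (F (x, y))) j = 0"
      unfolding D using Suc by simp
    then show ?case by simp
  qed
  then have "F (x, y) = 0" by (intro fps_ext) simp
  then show ?thesis by (simp add: F_def)
qed

text \<open>The defect of the recurrence again satisfies the system of the Bessel series, and it
  vanishes at r = 0.\<close>

lemma bessel_fps_recurrence:
  "of_int n * bessel_fps n = fps_X * (bessel_fps (n - 1) + bessel_fps (n + 1))"
proof -
  define F where "F n = of_int n * bessel_fps n - fps_X * (bessel_fps (n - 1) + bessel_fps (n + 1))" for n
  have "fps_deriv (of_int n) = (0 :: real fps)" for n by (simp flip: fps_of_int)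
  then have D: "fps_deriv (F n) = F (n - 1) - F (n + 1)" for n
    by (simp add: F_def bessel_fps_deriv algebra_simps)
  have "fps_nth (F n) j = 0" for n j
  proof (induction j arbitrary: n)
    case 0
    then show ?case by (auto simp: F_def bessel_fps_def simp flip: fps_of_int)
  next
    case (Suc j)
    have "fps_nth (fps_deriv (F n)) j = 0"
      unfolding D using Suc by simp
    then show ?case by simp
  qed
  then have "F n = 0" by (intro fps_ext) simp
  then show ?thesis by (simp add: F_def)
qed

lemma bessel_coeff_bound: "\<bar>bessel_coeff j n\<bar> \<le> 2 ^ j / fact j"
proof (induction j arbitrary: n)
  case (Suc j)
  have "\<bar>bessel_coeff j (n - 1) - bessel_coeff j (n + 1)\<bar> \<le> 2 ^ j / fact j + 2 ^ j / fact j"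
    using Suc[of "n - 1"] Suc[of "n + 1"] by linarith
  from divide_right_mono[OF this, of "real (Suc j)"]
  have "\<bar>bessel_coeff (Suc j) n\<bar> \<le> (2 ^ j / fact j + 2 ^ j / fact j) / real (Suc j)"
    by (simp add: abs_divide del: of_nat_Suc)
  also have "\<dots> = 2 ^ Suc j / fact (Suc j)" by (simp add: field_simps)
  finally show ?case .
qed simp

lemma bessel_coeff_zero: "int j < \<bar>n\<bar> \<Longrightarrow> bessel_coeff j n = 0"
proof (induction j arbitrary: n)
  case (Suc j)
  then have "bessel_coeff j (n - 1) = 0" "bessel_coeff j (n + 1) = 0" by (auto intro!: Suc.IH)
  then show ?case by simp
qed auto

lemma kernel_coeff_bound: "\<bar>kernel_coeff j x y\<bar> \<le> 4 ^ j / fact j"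
proof (induction j arbitrary: x y)
  case (Suc j)
  have "\<bar>kernel_coeff j (x - 1) y - kernel_coeff j (x + 1) y + kernel_coeff j x (y - 1) - kernel_coeff j x (y + 1)\<bar> \<le> 4 * (4 ^ j / fact j)"
    using Suc[of "x - 1" y] Suc[of "x + 1" y] Suc[of x "y - 1"] Suc[of x "y + 1"] by linarith
  from divide_right_mono[OF this, of "real (Suc j)"]
  have "\<bar>kernel_coeff (Suc j) x y\<bar> \<le> (4 * (4 ^ j / fact j)) / real (Suc j)"
    by (simp add: abs_divide del: of_nat_Suc)
  also have "\<dots> = 4 ^ Suc j / fact (Suc j)" by (simp add: field_simps)
  finally show ?case .
qed (simp add: vac_kernel_def)

text \<open>Each order in r moves an index by one step, so order j <= x does not get from x to the
  filled half-line.\<close>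

lemma kernel_coeff_right: "int j \<le> x \<Longrightarrow> kernel_coeff j x y = 0"
proof (induction j arbitrary: x y)
  case (Suc j)
  then have "kernel_coeff j (x - 1) y = 0" "kernel_coeff j (x + 1) y = 0" "kernel_coeff j x (y - 1) = 0" "kernel_coeff j x (y + 1) = 0"
    by (auto intro!: Suc.IH)
  then show ?case by simp
qed (simp add: vac_kernel_def)

text \<open>Within j steps of x the initial kernel is the identity, on which the four shifts cancel
  in pairs.\<close>

lemma kernel_coeff_left: "x < - int j \<Longrightarrow> kernel_coeff j x y = of_bool (x = y \<and> j = 0)"
proof (induction j arbitrary: x y)
  case (Suc j)
  then have "kernel_coeff j (x - 1) y = of_bool (x - 1 = y \<and> j = 0)" "kernel_coeff j (x + 1) y = of_bool (x + 1 = y \<and> j = 0)"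
    "kernel_coeff j x (y - 1) = of_bool (x = y - 1 \<and> j = 0)" "kernel_coeff j x (y + 1) = of_bool (x = y + 1 \<and> j = 0)"
    by (auto intro!: Suc.IH)
  then show ?case by (auto simp: of_bool_def)
qed (simp add: vac_kernel_def)

text \<open>\<open>bessel n r\<close> is the Bessel function \<open>J\<^sub>n (2 r)\<close>.\<close>
definition bessel :: "int \<Rightarrow> real \<Rightarrow> real" where
  "bessel n r = eval_fps (bessel_fps n) r"

definition bkernel :: "int \<Rightarrow> int \<Rightarrow> real \<Rightarrow> real" where
  "bkernel x y r = eval_fps (kernel_fps x y) r"

lemma conv_radius_bessel [simp]: "fps_conv_radius (bessel_fps n) = \<infinity>"
  by (rule entire_fps[of _ 2]) (simp add: bessel_fps_def bessel_coeff_bound)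

lemma conv_radius_kernel [simp]: "fps_conv_radius (kernel_fps x y) = \<infinity>"
  by (rule entire_fps[of _ 4]) (simp add: kernel_fps_def kernel_coeff_bound)

lemma bkernel_diff: "bkernel x y r - bkernel (x + 1) (y + 1) r = bessel (x + 1) r * bessel (y + 1) r"
  using arg_cong[OF kernel_fps_diff[of x y], of "\<lambda>f. eval_fps f r"]
  by (simp add: bkernel_def bessel_def eval_fps_diff eval_fps_mult)

lemma bessel_recurrence: "of_int n * bessel n r = r * (bessel (n - 1) r + bessel (n + 1) r)"
proof -
  have "fps_conv_radius (bessel_fps (n - 1) + bessel_fps (n + 1)) = \<infinity>"
    using fps_conv_radius_add[of "bessel_fps (n - 1)" "bessel_fps (n + 1)"] by (simp add: top_ereal_def[symmetric] top_unique)
  then show ?thesis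
    using arg_cong[OF bessel_fps_recurrence[of n], of "\<lambda>f. eval_fps f r"]
    by (simp add: bessel_def eval_fps_add eval_fps_mult flip: fps_of_int)
qed

lemma bessel_decay:
  assumes "r \<ge> 0"
  shows "\<bar>bessel n r\<bar> \<le> exp (2 * exp 1 * r) * exp (- \<bar>real_of_int n\<bar>)"
  using entire_fps_tail[of "bessel_fps n" 2 r "nat \<bar>n\<bar>"] assms
  by (simp add: bessel_def bessel_fps_def bessel_coeff_bound bessel_coeff_zero mult.commute)

lemma bkernel_decay_right:
  assumes "r \<ge> 0" "x \<ge> 0"
  shows "\<bar>bkernel x y r\<bar> \<le> exp (4 * exp 1 * r) * exp (- real_of_int x)"
  using entire_fps_tail[of "kernel_fps x y" 4 r "nat x"] assms
  by (simp add: bkernel_def kernel_fps_def kernel_coeff_bound kernel_coeff_right mult.commute)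

lemma bkernel_decay_left:
  assumes "r \<ge> 0" "x < 0"
  shows "\<bar>of_bool (x = y) - bkernel x y r\<bar> \<le> exp (4 * exp 1 * r) * exp (real_of_int x)"
proof -
  let ?f = "of_bool (x = y) - kernel_fps x y"
  have nth: "fps_nth ?f j = (if j = 0 then of_bool (x = y) - kernel_coeff 0 x y else - kernel_coeff j x y)" for j
    by (cases "x = y") (auto simp: kernel_fps_def)
  have "\<bar>fps_nth ?f j\<bar> \<le> 4 ^ j / fact j" for j
    unfolding nth using kernel_coeff_bound[of j x y] assms by (auto simp: vac_kernel_def)
  moreover have "fps_nth ?f j = 0" if "j < nat (- x)" for j
    unfolding nth using that kernel_coeff_left[of x j y] assms by (auto simp: vac_kernel_def)
  ultimately have "\<bar>eval_fps ?f r\<bar> \<le> exp (- real (nat (- x))) * exp (4 * exp 1 * r)"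
    using assms by (intro entire_fps_tail) auto
  moreover have "eval_fps ?f r = of_bool (x = y) - bkernel x y r"
    by (cases "x = y") (simp_all add: bkernel_def eval_fps_diff eval_fps_minus)
  ultimately show ?thesis using assms by (simp add: mult.commute)
qed

lemma bkernel_at_infinity:
  assumes "r \<ge> 0"
  shows "(\<lambda>k. bkernel (x + int k) (y + int k) r) \<longlonglongrightarrow> 0"
    and "(\<lambda>k. bkernel (x - int k) (y - int k) r) \<longlonglongrightarrow> of_bool (x = y)"
proof -
  have l: "(\<lambda>k. exp (4 * exp 1 * r) * exp (- real k + c)) \<longlonglongrightarrow> 0" for c
    by real_asymp
  have "eventually (\<lambda>k. norm (bkernel (x + int k) (y + int k) r) \<le> exp (4 * exp 1 * r) * exp (- real k + - x)) sequentially"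
    using eventually_ge_at_top[of "nat (- x)"]
  proof eventually_elim
    case (elim k)
    then have "0 \<le> x + int k" by simp
    from bkernel_decay_right[OF assms this, of "y + int k"] show ?case by (simp add: algebra_simps)
  qed
  from Lim_null_comparison[OF this l] show "(\<lambda>k. bkernel (x + int k) (y + int k) r) \<longlonglongrightarrow> 0" .
  have "eventually (\<lambda>k. norm (of_bool (x = y) - bkernel (x - int k) (y - int k) r) \<le> exp (4 * exp 1 * r) * exp (- real k + x)) sequentially"
    using eventually_gt_at_top[of "nat x"]
  proof eventually_elim
    case (elim k)
    then have "x - int k < 0" by simp
    from bkernel_decay_left[OF assms this, of "y - int k"] show ?case by (simp add: algebra_simps)
  qed
  from Lim_null_comparison[OF this l]
  have "(\<lambda>k. of_bool (x = y) - (of_bool (x = y) - bkernel (x - int k) (y - int k) r)) \<longlonglongrightarrow> of_bool (x = y) - 0"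
    by (intro tendsto_diff tendsto_const)
  then show "(\<lambda>k. bkernel (x - int k) (y - int k) r) \<longlonglongrightarrow> of_bool (x = y)" by simp
qed

section \<open>Series for the kernel and positivity\<close>

text \<open>Along a diagonal the increments of the kernel are Bessel products; the series telescopes
  since the kernel tends to 0 on the right. On the left it tends to the identity, whence the
  complementary series in \<open>bkernel_sums_left\<close>.\<close>

lemma bkernel_sums_right:
  assumes "r \<ge> 0"
  shows "(\<lambda>k. bessel (x + 1 + int k) r * bessel (y + 1 + int k) r) sums bkernel x y r"
proof -
  have "(\<lambda>k. bkernel (x + int k) (y + int k) r - bkernel (x + int (Suc k)) (y + int (Suc k)) r) sums
      (bkernel (x + int 0) (y + int 0) r - 0)"
    by (rule telescope_sums'[OF bkernel_at_infinity(1)[OF assms]])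
  moreover have "bkernel (x + int k) (y + int k) r - bkernel (x + int (Suc k)) (y + int (Suc k)) r =
      bessel (x + 1 + int k) r * bessel (y + 1 + int k) r" for k
    using bkernel_diff[of "x + int k" "y + int k" r] by (simp add: ac_simps)
  ultimately show ?thesis by simp
qed

lemma bkernel_sums_left:
  assumes "r \<ge> 0"
  shows "(\<lambda>k. bessel (x - int k) r * bessel (y - int k) r) sums (of_bool (x = y) - bkernel x y r)"
proof -
  have "(\<lambda>k. bkernel (x - int (Suc k)) (y - int (Suc k)) r - bkernel (x - int k) (y - int k) r) sums
      (of_bool (x = y) - bkernel (x - int 0) (y - int 0) r)"
    by (rule telescope_sums[OF bkernel_at_infinity(2)[OF assms]])
  moreover have "bkernel (x - int (Suc k)) (y - int (Suc k)) r - bkernel (x - int k) (y - int k) r =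
      bessel (x - int k) r * bessel (y - int k) r" for k
    using bkernel_diff[of "x - int (Suc k)" "y - int (Suc k)" r] by simp
  ultimately show ?thesis by simp
qed

text \<open>Cauchy-Schwarz for a second factor of norm at most 1, from the sum of the squares of f -
  B * g.\<close>

lemma sums_square_combination:
  fixes f g :: "nat \<Rightarrow> real"
  assumes "(\<lambda>k. f k * f k) sums A" "(\<lambda>k. f k * g k) sums B" "(\<lambda>k. g k * g k) sums C" "C \<le> 1"
  shows "B\<^sup>2 \<le> A"
proof -
  have "(\<lambda>k. f k * f k + 2 * (- B) * (f k * g k) + B\<^sup>2 * (g k * g k)) sums (A + 2 * (- B) * B + B\<^sup>2 * C)"
    by (intro sums_add sums_mult assms)
  also have "(\<lambda>k. f k * f k + 2 * (- B) * (f k * g k) + B\<^sup>2 * (g k * g k)) = (\<lambda>k. (f k - B * g k)\<^sup>2)"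
    by (simp add: power2_eq_square algebra_simps)
  finally have "0 \<le> A + 2 * (- B) * B + B\<^sup>2 * C"
    by (rule sums_le[OF _ sums_zero, rotated]) simp
  moreover have "B\<^sup>2 * C \<le> B\<^sup>2 * 1" using assms(4) by (intro mult_left_mono) auto
  moreover have "2 * (- B) * B = - 2 * B\<^sup>2" by (simp add: power2_eq_square)
  ultimately show ?thesis by linarith
qed

lemma bkernel_diag_bounds:
  assumes "r \<ge> 0"
  shows "0 \<le> bkernel x x r" "bkernel x x r \<le> 1"
  using sums_le[OF _ sums_zero bkernel_sums_right[OF assms, of x x]]
    sums_le[OF _ sums_zero bkernel_sums_left[OF assms, of x x]] by auto

text \<open>The right tails of the Bessel vectors give the first bound and the left tails the
  second, because off the diagonal the left series sums to minus the kernel.\<close>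

lemma bkernel_sq_le:
  assumes "r \<ge> 0"
  shows "(bkernel x y r)\<^sup>2 \<le> bkernel x x r"
    and "x \<noteq> y \<Longrightarrow> (bkernel x y r)\<^sup>2 \<le> 1 - bkernel x x r"
proof -
  show "(bkernel x y r)\<^sup>2 \<le> bkernel x x r"
    by (rule sums_square_combination[OF bkernel_sums_right bkernel_sums_right bkernel_sums_right])
       (use assms bkernel_diag_bounds in auto)
  assume "x \<noteq> y"
  have "(of_bool (x = y) - bkernel x y r)\<^sup>2 \<le> of_bool (x = x) - bkernel x x r"
    by (rule sums_square_combination[OF bkernel_sums_left bkernel_sums_left bkernel_sums_left])
       (use assms bkernel_diag_bounds in auto)
  then show "(bkernel x y r)\<^sup>2 \<le> 1 - bkernel x x r" using \<open>x \<noteq> y\<close> by simp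
qed

lemma bkernel_diag_antimono:
  assumes "x \<le> y"
  shows "bkernel y y r \<le> bkernel x x r"
proof -
  have "bkernel (x + int k) (x + int k) r \<le> bkernel x x r" for k
  proof (induction k)
    case (Suc k)
    have "bkernel (x + int k + 1) (x + int k + 1) r \<le> bkernel (x + int k) (x + int k) r"
      using bkernel_diff[of "x + int k" "x + int k" r] zero_le_square[of "bessel (x + int k + 1) r"] by linarith
    then show ?case using Suc by (simp add: ac_simps)
  qed simp
  from this[of "nat (y - x)"] show ?thesis using assms by simp
qed

section \<open>Weighted sums of Bessel products over the integers\<close>

lemma range_int_split: "range (\<lambda>n. 1 + int n) \<union> range (\<lambda>n. - int n) = UNIV"
proof -
  have "k \<in> range (\<lambda>n. 1 + int n) \<union> range (\<lambda>n. - int n)" for k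
  proof (cases "k > 0")
    case True
    then have "k = 1 + int (nat (k - 1))" by simp
    then show ?thesis by blast
  next
    case False
    then have "k = - int (nat (- k))" by simp
    then show ?thesis by blast
  qed
  then show ?thesis by blast
qed

lemma summable_on_exp_abs_int: "(\<lambda>k::int. exp (- \<bar>real_of_int k\<bar> / 2)) summable_on UNIV"
proof -
  have *: "(\<lambda>n::nat. C * exp (- 1 / 2) ^ n :: real) summable_on UNIV" for C
    by (intro summable_on_cmult_right norm_summable_imp_summable_on) (simp add: summable_geometric power_abs)
  have "exp (- \<bar>real_of_int (1 + int n)\<bar> / 2) = exp (- 1 / 2) * exp (- 1 / 2) ^ n" for n
    by (simp only: exp_of_nat_mult[symmetric] exp_add[symmetric]) (simp add: field_simps)
  then have "(\<lambda>n. exp (- \<bar>real_of_int (1 + int n)\<bar> / 2)) summable_on UNIV"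
    using *[of "exp (- 1 / 2)"] by (simp only:)
  then have "(\<lambda>k::int. exp (- \<bar>real_of_int k\<bar> / 2)) summable_on range (\<lambda>n. 1 + int n)"
    by (subst summable_on_reindex, simp add: inj_on_def, simp only: o_def)
  moreover
  have "exp (- \<bar>real_of_int (- int n)\<bar> / 2) = 1 * exp (- 1 / 2) ^ n" for n
    by (simp only: exp_of_nat_mult[symmetric] exp_add[symmetric]) (simp add: field_simps)
  then have "(\<lambda>n. exp (- \<bar>real_of_int (- int n)\<bar> / 2)) summable_on UNIV"
    using *[of 1] by (simp only:)
  then have "(\<lambda>k::int. exp (- \<bar>real_of_int k\<bar> / 2)) summable_on range (\<lambda>n. - int n)"
    by (subst summable_on_reindex, simp add: inj_on_def, simp only: o_def)
  ultimately have "(\<lambda>k::int. exp (- \<bar>real_of_int k\<bar> / 2)) summable_on (range (\<lambda>n. 1 + int n) \<union> range (\<lambda>n. - int n))"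
    by (rule summable_on_Un_disjoint) auto
  also note range_int_split
  finally show ?thesis .
qed

lemma infsum_int_split:
  fixes g :: "int \<Rightarrow> real"
  assumes g: "g summable_on UNIV" and a: "(\<lambda>n. g (1 + int n)) sums a" and b: "(\<lambda>n. g (- int n)) sums b"
  shows "infsum g UNIV = a + b"
proof -
  have sub: "g summable_on A" for A using g by (rule summable_on_subset) simp
  have "infsum g UNIV = infsum g (range (\<lambda>n. 1 + int n)) + infsum g (range (\<lambda>n. - int n))"
    unfolding range_int_split[symmetric] by (rule infsum_Un_disjoint[OF sub sub]) auto
  also have "infsum g (range (\<lambda>n. 1 + int n)) = a"
  proof -
    have "((\<lambda>n. g (1 + int n)) has_sum infsum g (range (\<lambda>n. 1 + int n))) UNIV"
      using has_sum_infsum[OF sub[of "range (\<lambda>n. 1 + int n)"]] by (subst (asm) has_sum_reindex) (auto simp: inj_on_def o_def)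
    then show ?thesis using a by (auto dest!: has_sum_imp_sums intro: sums_unique2)
  qed
  also have "infsum g (range (\<lambda>n. - int n)) = b"
  proof -
    have "((\<lambda>n. g (- int n)) has_sum infsum g (range (\<lambda>n. - int n))) UNIV"
      using has_sum_infsum[OF sub[of "range (\<lambda>n. - int n)"]] by (subst (asm) has_sum_reindex) (auto simp: inj_on_def o_def)
    then show ?thesis using b by (auto dest!: has_sum_imp_sums intro: sums_unique2)
  qed
  finally show ?thesis .
qed

text \<open>A class of weights that contains polynomials and the step function and for which
  \<open>bessel_mean\<close> converges absolutely.\<close>

definition poly_growth :: "(real \<Rightarrow> real) \<Rightarrow> bool" where
  "poly_growth q \<longleftrightarrow> (\<exists>A p. \<forall>u. \<bar>q u\<bar> \<le> A * (1 + \<bar>u\<bar>) ^ p)"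

text \<open>For x = y the products are squares of total mass 1, so this is a genuine mean; the
  weight \<open>step\<close> gives the kernel, while powers obey a recursion.\<close>

definition bessel_mean :: "(real \<Rightarrow> real) \<Rightarrow> int \<Rightarrow> int \<Rightarrow> real \<Rightarrow> real" where
  "bessel_mean q x y r = (\<Sum>\<^sub>\<infinity>k. q (of_int k / r) * (bessel (x + k) r * bessel (y + k) r))"

lemma power_le_exp:
  fixes u :: real
  assumes "u \<ge> 0"
  shows "u ^ p \<le> fact p * exp u"
proof -
  have "(\<Sum>n\<in>{p}. u ^ n /\<^sub>R fact n) \<le> (\<Sum>n. u ^ n /\<^sub>R fact n)"
    by (rule sum_le_suminf[OF summable_exp_generic]) (use assms in auto)
  then have "u ^ p / fact p \<le> exp u" by (simp add: exp_def divide_inverse mult.commute)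
  then show ?thesis by (simp add: pos_divide_le_eq mult.commute)
qed

lemma summable_bessel_mean:
  assumes q: "poly_growth q" and r: "r > 0"
  shows "(\<lambda>k. norm (q (of_int k / r) * (bessel (x + k) r * bessel (y + k) r))) summable_on UNIV"
proof -
  obtain A p where A: "\<And>u. \<bar>q u\<bar> \<le> A * (1 + \<bar>u\<bar>) ^ p" using q by (auto simp: poly_growth_def)
  have "\<bar>q 0\<bar> \<le> A" using A[of 0] by simp
  then have A0: "A \<ge> 0" by linarith
  let ?C = "exp (2 * exp 1 * r)"
  define B where "B = A * ((2 / r) ^ p * (fact p * exp (r / 2))) * (?C * exp \<bar>real_of_int x\<bar> * ?C)"
  have "\<bar>q (of_int k / r) * (bessel (x + k) r * bessel (y + k) r)\<bar> \<le> B * exp (- \<bar>real_of_int k\<bar> / 2)" for k :: int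
  proof -
    let ?k = "\<bar>real_of_int k\<bar>"
    \<comment> \<open>Written with (r + |k|) / 2 so that the polynomial weight costs only exp (|k| /
      2), half of the available decay.\<close>
    have "1 + \<bar>of_int k / r\<bar> = (2 / r) * ((r + ?k) / 2)"
      using r by (simp add: abs_divide field_simps)
    then have "(1 + \<bar>of_int k / r\<bar>) ^ p = (2 / r) ^ p * ((r + ?k) / 2) ^ p"
      by (simp only: power_mult_distrib)
    also have "\<dots> \<le> (2 / r) ^ p * (fact p * exp ((r + ?k) / 2))"
      using r by (intro mult_left_mono power_le_exp) auto
    finally have "A * (1 + \<bar>of_int k / r\<bar>) ^ p \<le> A * ((2 / r) ^ p * (fact p * exp ((r + ?k) / 2)))"
      using A0 by (intro mult_left_mono) auto
    with A[of "of_int k / r"] have 1: "\<bar>q (of_int k / r)\<bar> \<le> A * ((2 / r) ^ p * (fact p * exp ((r + ?k) / 2)))"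
      by linarith
    have "\<bar>bessel (x + k) r\<bar> \<le> ?C * exp (- \<bar>real_of_int (x + k)\<bar>)" using r by (intro bessel_decay) simp
    also have "\<dots> \<le> ?C * (exp \<bar>real_of_int x\<bar> * exp (- ?k))"
      by (intro mult_left_mono) (auto simp flip: exp_add)
    finally have 2: "\<bar>bessel (x + k) r\<bar> \<le> ?C * (exp \<bar>real_of_int x\<bar> * exp (- ?k))" .
    have "\<bar>bessel (y + k) r\<bar> \<le> ?C * exp (- \<bar>real_of_int (y + k)\<bar>)" using r by (intro bessel_decay) simp
    also have "\<dots> \<le> ?C * 1" by (intro mult_left_mono) auto
    finally have 3: "\<bar>bessel (y + k) r\<bar> \<le> ?C" by simp
    have "\<bar>q (of_int k / r) * (bessel (x + k) r * bessel (y + k) r)\<bar> \<le>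
        (A * ((2 / r) ^ p * (fact p * exp ((r + ?k) / 2)))) * ((?C * (exp \<bar>real_of_int x\<bar> * exp (- ?k))) * ?C)"
      unfolding abs_mult using A0 r by (intro mult_mono 1 2 3 mult_nonneg_nonneg) auto
    also have "\<dots> = B * (exp (?k / 2) * exp (- ?k))"
      by (simp add: B_def add_divide_distrib exp_add mult_ac)
    also have "exp (?k / 2) * exp (- ?k) = exp (- ?k / 2)" by (simp flip: exp_add)
    finally show ?thesis .
  qed
  then show ?thesis
    by (intro summable_on_comparison_test[OF summable_on_cmult_right[OF summable_on_exp_abs_int, of B]]) auto
qed

lemmas summable_bessel_mean' = abs_summable_summable[OF summable_bessel_mean]

lemma poly_growth_const: "poly_growth (\<lambda>u. c)"
  unfolding poly_growth_def by (rule exI[of _ "\<bar>c\<bar>"], rule exI[of _ 0]) simp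

lemma poly_growth_power: "poly_growth (\<lambda>u. u ^ p)"
  unfolding poly_growth_def
  by (rule exI[of _ 1], rule exI[of _ p]) (auto simp: power_abs intro!: power_mono)

lemma poly_growth_bounded: "(\<And>u. \<bar>q u\<bar> \<le> 1) \<Longrightarrow> poly_growth q"
  unfolding poly_growth_def by (rule exI[of _ 1], rule exI[of _ 0]) simp

lemma poly_growth_add:
  assumes "poly_growth f" "poly_growth g"
  shows "poly_growth (\<lambda>u. f u + g u)"
proof -
  obtain A p B q where A: "\<And>u. \<bar>f u\<bar> \<le> A * (1 + \<bar>u\<bar>) ^ p" and B: "\<And>u. \<bar>g u\<bar> \<le> B * (1 + \<bar>u\<bar>) ^ q"
    using assms by (auto simp: poly_growth_def)
  have "A \<ge> 0" "B \<ge> 0" using A[of 0] B[of 0] by auto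
  have "\<bar>f u + g u\<bar> \<le> (A + B) * (1 + \<bar>u\<bar>) ^ max p q" for u
  proof -
    have "A * (1 + \<bar>u\<bar>) ^ p \<le> A * (1 + \<bar>u\<bar>) ^ max p q" "B * (1 + \<bar>u\<bar>) ^ q \<le> B * (1 + \<bar>u\<bar>) ^ max p q"
      using \<open>A \<ge> 0\<close> \<open>B \<ge> 0\<close> by (auto intro!: mult_left_mono power_increasing)
    then show ?thesis using A[of u] B[of u] unfolding distrib_right by linarith
  qed
  then show ?thesis unfolding poly_growth_def by blast
qed

lemma poly_growth_cmult:
  assumes "poly_growth f"
  shows "poly_growth (\<lambda>u. c * f u)"
proof -
  obtain A p where A: "\<And>u. \<bar>f u\<bar> \<le> A * (1 + \<bar>u\<bar>) ^ p" using assms by (auto simp: poly_growth_def)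
  have "\<bar>c * f u\<bar> \<le> (\<bar>c\<bar> * A) * (1 + \<bar>u\<bar>) ^ p" for u
    using mult_left_mono[OF A[of u], of "\<bar>c\<bar>"] by (simp add: abs_mult mult.assoc)
  then show ?thesis unfolding poly_growth_def by blast
qed

lemma poly_growth_diff: "poly_growth f \<Longrightarrow> poly_growth g \<Longrightarrow> poly_growth (\<lambda>u. f u - g u)"
  using poly_growth_add[of f "\<lambda>u. (-1) * g u"] poly_growth_cmult[of g "-1"] by simp

lemma poly_growth_sum: "(\<And>i. i \<in> I \<Longrightarrow> poly_growth (f i)) \<Longrightarrow> poly_growth (\<lambda>u. \<Sum>i\<in>I. f i u)"
  by (induction I rule: infinite_finite_induct) (auto intro: poly_growth_const poly_growth_add)

lemma poly_growth_real_polynomial: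
  assumes "real_polynomial_function p"
  shows "poly_growth p"
proof -
  obtain a n where "p = (\<lambda>u. \<Sum>i\<le>n. a i * u ^ i)"
    using real_polynomial_function_imp_sum[OF assms] by blast
  then show ?thesis by (auto intro!: poly_growth_sum poly_growth_cmult poly_growth_power)
qed

lemma bessel_mean_add:
  assumes "poly_growth f" "poly_growth g" "r > 0"
  shows "bessel_mean (\<lambda>u. f u + g u) x y r = bessel_mean f x y r + bessel_mean g x y r"
  unfolding bessel_mean_def distrib_right by (intro infsum_add summable_bessel_mean' assms)

lemma bessel_mean_cmult: "bessel_mean (\<lambda>u. c * f u) x y r = c * bessel_mean f x y r"
  unfolding bessel_mean_def mult.assoc by (rule infsum_cmult_right')

lemma bessel_mean_diff:
  assumes "poly_growth f" "poly_growth g" "r > 0"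
  shows "bessel_mean (\<lambda>u. f u - g u) x y r = bessel_mean f x y r - bessel_mean g x y r"
  using bessel_mean_add[of f "\<lambda>u. (-1) * g u"] poly_growth_cmult[of g "-1"] bessel_mean_cmult[of "-1" g] assms by simp

lemma bessel_mean_sum:
  assumes "r > 0" "\<And>i. i \<in> I \<Longrightarrow> poly_growth (f i)"
  shows "bessel_mean (\<lambda>u. \<Sum>i\<in>I. f i u) x y r = (\<Sum>i\<in>I. bessel_mean (f i) x y r)"
  using assms(2)
proof (induction I rule: infinite_finite_induct)
  case (insert i I)
  then show ?case using assms(1) by (simp add: bessel_mean_add poly_growth_sum)
qed (simp_all add: bessel_mean_def)

text \<open>Orthonormality: the right series and the left series of the kernel add up to the
  identity.\<close>

lemma bessel_mean_1:
  assumes "r > 0"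
  shows "bessel_mean (\<lambda>u. 1) x y r = of_bool (x = y)"
proof -
  have "infsum (\<lambda>k. 1 * (bessel (x + k) r * bessel (y + k) r)) UNIV = bkernel x y r + (of_bool (x = y) - bkernel x y r)"
    using assms summable_bessel_mean'[OF poly_growth_const[of 1] assms, of x y]
      bkernel_sums_right[of r x y] bkernel_sums_left[of r x y]
    by (intro infsum_int_split) (auto simp: ac_simps)
  then show ?thesis by (simp add: bessel_mean_def)
qed

definition step :: "real \<Rightarrow> real" where "step u = of_bool (u > 0)"

lemma poly_growth_step: "poly_growth step"
  by (rule poly_growth_bounded) (simp add: step_def)

lemma bessel_mean_step:
  assumes "r > 0"
  shows "bessel_mean step x y r = bkernel x y r"
proof -
  have "infsum (\<lambda>k. step (of_int k / r) * (bessel (x + k) r * bessel (y + k) r)) UNIV = bkernel x y r + 0"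
  proof (rule infsum_int_split)
    show "(\<lambda>n. step (real_of_int (1 + int n) / r) * (bessel (x + (1 + int n)) r * bessel (y + (1 + int n)) r)) sums bkernel x y r"
      using bkernel_sums_right[of r x y] assms by (simp add: step_def ac_simps)
    have "real_of_int (- int n) / r \<le> 0" for n using assms by (simp add: divide_nonpos_pos)
    then have "step (real_of_int (- int n) / r) = 0" for n unfolding step_def of_bool_eq_0_iff not_less .
    then show "(\<lambda>n. step (real_of_int (- int n) / r) * (bessel (x + - int n) r * bessel (y + - int n) r)) sums 0"
      by simp
  qed (rule summable_bessel_mean'[OF poly_growth_step assms])
  then show ?thesis by (simp add: bessel_mean_def)
qed

text \<open>The recurrence at index x + k replaces (x + k) / r by the two neighbours; subtracting x
  / r leaves the one factor k / r to be removed.\<close>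

lemma bessel_mean_power_Suc:
  assumes "r > 0"
  shows "bessel_mean (\<lambda>u. u ^ Suc p) x y r = bessel_mean (\<lambda>u. u ^ p) (x - 1) y r
    + bessel_mean (\<lambda>u. u ^ p) (x + 1) y r - of_int x / r * bessel_mean (\<lambda>u. u ^ p) x y r"
proof -
  let ?t = "\<lambda>x k. (of_int k / r) ^ p * (bessel (x + k) r * bessel (y + k) r)"
  have s: "?t x summable_on UNIV" for x
    by (rule summable_bessel_mean'[OF poly_growth_power assms])
  have "(of_int k / r) ^ Suc p * (bessel (x + k) r * bessel (y + k) r) =
     (?t (x - 1) k + ?t (x + 1) k) + (- (of_int x / r)) * ?t x k" for k
  proof -
    have "of_int (x + k) / r * bessel (x + k) r = bessel (x - 1 + k) r + bessel (x + 1 + k) r"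
      using bessel_recurrence[of "x + k" r] assms by (simp add: field_simps)
    then have "of_int k / r * bessel (x + k) r = bessel (x - 1 + k) r + bessel (x + 1 + k) r - of_int x / r * bessel (x + k) r"
      by (simp add: add_divide_distrib distrib_right)
    then have "(of_int k / r) ^ p * bessel (y + k) r * (of_int k / r * bessel (x + k) r) =
      (of_int k / r) ^ p * bessel (y + k) r * (bessel (x - 1 + k) r + bessel (x + 1 + k) r - of_int x / r * bessel (x + k) r)"
      by (simp only:)
    then show ?thesis by (simp add: algebra_simps)
  qed
  then have "bessel_mean (\<lambda>u. u ^ Suc p) x y r = infsum (\<lambda>k. (?t (x - 1) k + ?t (x + 1) k) + (- (of_int x / r)) * ?t x k) UNIV"
    by (simp only: bessel_mean_def)
  also have "\<dots> = (infsum (?t (x - 1)) UNIV + infsum (?t (x + 1)) UNIV) + (- (of_int x / r)) * infsum (?t x) UNIV"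
    unfolding infsum_add[OF summable_on_add[OF s s] summable_on_cmult_right[OF s]] infsum_add[OF s s] infsum_cmult_right' ..
  finally show ?thesis by (simp add: bessel_mean_def)
qed

text \<open>Linearised Cauchy-Schwarz: the vector at y contributes only its total mass 1, and the
  one at x is weighted by a majorant q of the square, which may be a polynomial even if f is
  not.\<close>

lemma bessel_mean_cauchy_schwarz:
  assumes f: "poly_growth f" and q: "poly_growth q" and le: "\<And>u. (f u)\<^sup>2 \<le> q u" and "\<eta> > 0" "r > 0"
  shows "\<bar>bessel_mean f x y r\<bar> \<le> bessel_mean q x x r / (2 * \<eta>) + \<eta> / 2"
proof -
  let ?J = "\<lambda>k. bessel (x + k) r" and ?J' = "\<lambda>k. bessel (y + k) r"
  let ?R = "\<lambda>k. 1 / (2 * \<eta>) * (q (of_int k / r) * (?J k * ?J k)) + \<eta> / 2 * (1 * (?J' k * ?J' k))"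
  have s1: "(\<lambda>k. 1 / (2 * \<eta>) * (q (of_int k / r) * (?J k * ?J k))) summable_on UNIV"
    by (rule summable_on_cmult_right[OF summable_bessel_mean'[OF q \<open>r > 0\<close>]])
  have s2: "(\<lambda>k. \<eta> / 2 * (1 * (?J' k * ?J' k))) summable_on UNIV"
    by (rule summable_on_cmult_right[OF summable_bessel_mean'[OF poly_growth_const \<open>r > 0\<close>]])
  have le': "\<bar>f (of_int k / r) * (?J k * ?J' k)\<bar> \<le> ?R k" for k
  proof -
    let ?f = "f (of_int k / r)"
    have "0 \<le> (\<bar>?f * ?J k\<bar> - \<eta> * \<bar>?J' k\<bar>)\<^sup>2 / (2 * \<eta>)" using \<open>\<eta> > 0\<close> by simp
    also have "\<dots> = ?f\<^sup>2 * (?J k)\<^sup>2 / (2 * \<eta>) + \<eta> / 2 * (?J' k)\<^sup>2 - \<bar>?f * (?J k * ?J' k)\<bar>"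
      using \<open>\<eta> > 0\<close> by (simp add: power2_diff power_mult_distrib abs_mult field_simps) (simp add: power2_eq_square)
    also have "?f\<^sup>2 * (?J k)\<^sup>2 / (2 * \<eta>) \<le> q (of_int k / r) * (?J k)\<^sup>2 / (2 * \<eta>)"
      using \<open>\<eta> > 0\<close> le by (intro divide_right_mono mult_right_mono) auto
    finally show ?thesis by (simp add: power2_eq_square)
  qed
  have "\<bar>bessel_mean f x y r\<bar> \<le> infsum (\<lambda>k. \<bar>f (of_int k / r) * (?J k * ?J' k)\<bar>) UNIV"
    using norm_infsum_bound[OF summable_bessel_mean[OF f \<open>r > 0\<close>]] by (simp add: bessel_mean_def)
  also have "\<dots> \<le> infsum ?R UNIV"
    using summable_bessel_mean[OF f \<open>r > 0\<close>, of x y] by (intro infsum_mono summable_on_add s1 s2 le') auto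
  also have "\<dots> = 1 / (2 * \<eta>) * bessel_mean q x x r + \<eta> / 2 * bessel_mean (\<lambda>u. 1) y y r"
    unfolding infsum_add[OF s1 s2] infsum_cmult_right' bessel_mean_def ..
  finally show ?thesis by (simp add: bessel_mean_1[OF \<open>r > 0\<close>])
qed

text \<open>The recursion moves x by at most p places, too few to reach y, and different indices are
  orthogonal.\<close>

lemma bessel_mean_power_far: "r > 0 \<Longrightarrow> int p < \<bar>x - y\<bar> \<Longrightarrow> bessel_mean (\<lambda>u. u ^ p) x y r = 0"
proof (induction p arbitrary: x)
  case 0
  then show ?case by (auto simp: bessel_mean_1)
next
  case (Suc p)
  then have "bessel_mean (\<lambda>u. u ^ p) (x - 1) y r = 0" "bessel_mean (\<lambda>u. u ^ p) (x + 1) y r = 0"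
    "bessel_mean (\<lambda>u. u ^ p) x y r = 0"
    by (auto intro!: Suc.IH)
  then show ?case unfolding bessel_mean_power_Suc[OF \<open>r > 0\<close>] by simp
qed

text \<open>The limit of \<open>bessel_mean q x y r\<close> when \<open>x / r\<close> tends to \<open>a\<close> and \<open>x - y = d\<close>: in the limit the three-term
  recurrence of the Bessel functions is diagonalised by plane waves.\<close>
definition arcsine_mean :: "real \<Rightarrow> (real \<Rightarrow> real) \<Rightarrow> int \<Rightarrow> real" where
  "arcsine_mean a q d = integral {0..pi} (\<lambda>t. q (2 * cos t - a) * cos (of_int d * t)) / pi"

lemma arcsine_integrable:
  assumes "continuous_on UNIV q"
  shows "(\<lambda>t. q (2 * cos t - a) * cos (of_int d * t)) integrable_on {0..pi}"
proof -
  have "continuous_on {0..pi} (\<lambda>t. q (2 * cos t - a))"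
    by (rule continuous_on_compose2[OF assms]) (auto intro!: continuous_intros)
  then show ?thesis
    by (intro integrable_continuous_interval continuous_intros)
qed

lemma arcsine_mean_1: "arcsine_mean a (\<lambda>u. u ^ 0) d = of_bool (d = 0)"
proof (cases "d = 0")
  case True
  then show ?thesis by (simp add: arcsine_mean_def)
next
  case False
  have "((\<lambda>t. cos (of_int d * t)) has_integral (sin (of_int d * pi) / of_int d - sin (of_int d * 0) / of_int d)) {0..pi}"
    using False by (intro fundamental_theorem_of_calculus)
      (auto intro!: derivative_eq_intros simp flip: has_real_derivative_iff_has_vector_derivative)
  moreover have "sin (of_int d * pi) = 0" by (auto simp: sin_zero_iff_int2)
  ultimately show ?thesis using False by (simp add: arcsine_mean_def integral_unique)
qed

text \<open>Since 2 cos t cos (d t) = cos ((d - 1) t) + cos ((d + 1) t), the recursion is that of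
  \<open>bessel_mean_power_Suc\<close> with x / r replaced by its limit a.\<close>

lemma arcsine_mean_power_Suc:
  "arcsine_mean a (\<lambda>u. u ^ Suc p) d = arcsine_mean a (\<lambda>u. u ^ p) (d - 1) + arcsine_mean a (\<lambda>u. u ^ p) (d + 1)
    - a * arcsine_mean a (\<lambda>u. u ^ p) d"
proof -
  let ?t = "\<lambda>d t. (2 * cos t - a) ^ p * cos (of_int d * t)"
  have i: "?t d integrable_on {0..pi}" for d :: int
    using arcsine_integrable[of "\<lambda>u. u ^ p" a d] by (simp add: continuous_intros)
  have "(2 * cos t - a) ^ Suc p * cos (of_int d * t) = (?t (d - 1) t + ?t (d + 1) t) - a * ?t d t" for t
  proof -
    have "2 * cos t * cos (of_int d * t) = cos (of_int (d - 1) * t) + cos (of_int (d + 1) * t)"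
      by (simp add: algebra_simps cos_add cos_diff)
    then have "(2 * cos t - a) ^ p * (2 * cos t * cos (of_int d * t)) = ?t (d - 1) t + ?t (d + 1) t"
      by (simp only: distrib_left)
    moreover have "(2 * cos t - a) ^ Suc p * cos (of_int d * t) = (2 * cos t - a) ^ p * (2 * cos t * cos (of_int d * t)) - a * ?t d t"
      by (simp add: algebra_simps)
    ultimately show ?thesis by (simp only:)
  qed
  then have "integral {0..pi} (\<lambda>t. (2 * cos t - a) ^ Suc p * cos (of_int d * t)) =
     integral {0..pi} (?t (d - 1)) + integral {0..pi} (?t (d + 1)) - a * integral {0..pi} (?t d)"
    using i by (simp only: integral_diff integral_add integrable_add integral_mult_right integrable_on_mult_right)
  then show ?thesis by (simp add: arcsine_mean_def add_divide_distrib diff_divide_distrib)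
qed

lemma arcsine_mean_sum:
  "arcsine_mean a (\<lambda>u. \<Sum>i\<le>n. c i * u ^ i) d = (\<Sum>i\<le>n. c i * arcsine_mean a (\<lambda>u. u ^ i) d)"
proof -
  have i: "(\<lambda>t. (2 * cos t - a) ^ i * cos (of_int d * t)) integrable_on {0..pi}" for i
    using arcsine_integrable[of "\<lambda>u. u ^ i" a d] by (simp add: continuous_intros)
  have "integral {0..pi} (\<lambda>t. (\<Sum>i\<le>n. c i * (2 * cos t - a) ^ i) * cos (of_int d * t)) =
    (\<Sum>i\<le>n. integral {0..pi} (\<lambda>t. c i * ((2 * cos t - a) ^ i * cos (of_int d * t))))"
    unfolding sum_distrib_right mult.assoc
    by (intro integral_sum finite_atMost integrable_on_mult_right i)
  then show ?thesis by (simp add: arcsine_mean_def sum_divide_distrib)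
qed

section \<open>Asymptotics of the Bessel kernel\<close>

text \<open>Both sides obey the same recursion with the same start. The induction shifts x and keeps
  y, which preserves a and the eventual constancy of the difference.\<close>

lemma moment_limit:
  fixes x :: "nat \<Rightarrow> int" and r :: "nat \<Rightarrow> real"
  assumes r: "filterlim r at_top sequentially" and "(\<lambda>n. of_int (x n) / r n) \<longlonglongrightarrow> a"
    and "eventually (\<lambda>n. x n - y n = d) sequentially"
  shows "(\<lambda>n. bessel_mean (\<lambda>u. u ^ p) (x n) (y n) (r n)) \<longlonglongrightarrow> arcsine_mean a (\<lambda>u. u ^ p) d"
  using assms(2,3)
proof (induction p arbitrary: x d)
  case 0
  have pos: "eventually (\<lambda>n. r n > 0) sequentially" using r by (simp add: filterlim_at_top_dense)
  have "eventually (\<lambda>n. of_bool (d = 0) = bessel_mean (\<lambda>u. u ^ 0) (x n) (y n) (r n)) sequentially"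
    using pos 0(2) by eventually_elim (auto simp: bessel_mean_1)
  then show ?case unfolding arcsine_mean_1 by (rule tendsto_eventually[OF eventually_mono]) simp
next
  case (Suc p)
  have pos: "eventually (\<lambda>n. r n > 0) sequentially" using r by (simp add: filterlim_at_top_dense)
  have inv: "(\<lambda>n. 1 / r n) \<longlonglongrightarrow> 0"
    using tendsto_inverse_0_at_top[OF r] by (simp add: divide_inverse)
  have m: "(\<lambda>n. of_int (x n - 1) / r n) \<longlonglongrightarrow> a"
    using tendsto_diff[OF Suc.prems(1) inv] by (simp add: diff_divide_distrib)
  have pl: "(\<lambda>n. of_int (x n + 1) / r n) \<longlonglongrightarrow> a"
    using tendsto_add[OF Suc.prems(1) inv] by (simp add: add_divide_distrib)
  have "(\<lambda>n. bessel_mean (\<lambda>u. u ^ p) (x n - 1) (y n) (r n) + bessel_mean (\<lambda>u. u ^ p) (x n + 1) (y n) (r n)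
      - of_int (x n) / r n * bessel_mean (\<lambda>u. u ^ p) (x n) (y n) (r n)) \<longlonglongrightarrow>
    arcsine_mean a (\<lambda>u. u ^ p) (d - 1) + arcsine_mean a (\<lambda>u. u ^ p) (d + 1) - a * arcsine_mean a (\<lambda>u. u ^ p) d"
    by (intro tendsto_intros Suc.IH Suc.prems m pl) (use Suc.prems(2) in \<open>auto elim: eventually_mono\<close>)
  moreover have "eventually (\<lambda>n. bessel_mean (\<lambda>u. u ^ p) (x n - 1) (y n) (r n) + bessel_mean (\<lambda>u. u ^ p) (x n + 1) (y n) (r n)
      - of_int (x n) / r n * bessel_mean (\<lambda>u. u ^ p) (x n) (y n) (r n) = bessel_mean (\<lambda>u. u ^ Suc p) (x n) (y n) (r n)) sequentially"
    using pos by eventually_elim (rule bessel_mean_power_Suc[symmetric])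
  ultimately show ?case unfolding arcsine_mean_power_Suc by (rule Lim_transform_eventually)
qed

lemma polynomial_limit:
  fixes x :: "nat \<Rightarrow> int"
  assumes p: "real_polynomial_function p"
    and r: "filterlim r at_top sequentially" and x: "(\<lambda>n. of_int (x n) / r n) \<longlonglongrightarrow> a"
    and d: "eventually (\<lambda>n. x n - y n = d) sequentially"
  shows "(\<lambda>n. bessel_mean p (x n) (y n) (r n)) \<longlonglongrightarrow> arcsine_mean a p d"
proof -
  obtain c m where pc: "p = (\<lambda>u. \<Sum>i\<le>m. c i * u ^ i)"
    using real_polynomial_function_imp_sum[OF p] by blast
  have pos: "eventually (\<lambda>n. r n > 0) sequentially" using r by (simp add: filterlim_at_top_dense)
  have "(\<lambda>n. \<Sum>i\<le>m. c i * bessel_mean (\<lambda>u. u ^ i) (x n) (y n) (r n)) \<longlonglongrightarrow> arcsine_mean a p d"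
    unfolding pc arcsine_mean_sum by (intro tendsto_intros moment_limit r x d)
  moreover have "eventually (\<lambda>n. (\<Sum>i\<le>m. c i * bessel_mean (\<lambda>u. u ^ i) (x n) (y n) (r n)) = bessel_mean p (x n) (y n) (r n)) sequentially"
    using pos
  proof eventually_elim
    case (elim n)
    show ?case unfolding pc
      by (subst bessel_mean_sum[OF elim]) (auto intro!: poly_growth_cmult poly_growth_power simp: bessel_mean_cmult)
  qed
  ultimately show ?thesis by (rule Lim_transform_eventually)
qed

lemma polynomial_limit_far:
  fixes x y :: "nat \<Rightarrow> int"
  assumes p: "real_polynomial_function p" and r: "filterlim r at_top sequentially"
    and d: "filterlim (\<lambda>n. \<bar>x n - y n\<bar>) at_top sequentially"
  shows "(\<lambda>n. bessel_mean p (x n) (y n) (r n)) \<longlonglongrightarrow> 0"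
proof -
  obtain c m where pc: "p = (\<lambda>u. \<Sum>i\<le>m. c i * u ^ i)"
    using real_polynomial_function_imp_sum[OF p] by blast
  have "eventually (\<lambda>n. r n > 0) sequentially" using r by (simp add: filterlim_at_top_dense)
  moreover have "eventually (\<lambda>n. int m + 1 \<le> \<bar>x n - y n\<bar>) sequentially"
    using d unfolding filterlim_at_top by blast
  ultimately have "eventually (\<lambda>n. bessel_mean p (x n) (y n) (r n) = 0) sequentially"
  proof eventually_elim
    case (elim n)
    then have "bessel_mean (\<lambda>u. u ^ i) (x n) (y n) (r n) = 0" if "i \<le> m" for i
      using that by (intro bessel_mean_power_far) auto
    then show ?case unfolding pc
      by (subst bessel_mean_sum[OF elim(1)]) (auto intro!: poly_growth_cmult poly_growth_power simp: bessel_mean_cmult)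
  qed
  then show ?thesis by (rule tendsto_eventually)
qed

section \<open>Polynomial approximation of the step function\<close>

lemma step_arcsine:
  assumes "-2 < a" "a < 2"
  shows "((\<lambda>t. step (2 * cos t - a) * cos (of_int d * t)) has_integral
    (if d = 0 then arccos (a / 2) else sin (of_int d * arccos (a / 2)) / of_int d)) {0..pi}"
proof -
  let ?t = "arccos (a / 2)"
  have t: "0 \<le> ?t" "?t \<le> pi" "cos ?t = a / 2"
    using assms by (auto intro: arccos_lbound arccos_ubound)
  have "((\<lambda>t. cos (of_int d * t)) has_integral (if d = 0 then ?t else sin (of_int d * ?t) / of_int d)) {0..?t}"
  proof (cases "d = 0")
    case True
    then show ?thesis using has_integral_const_real[of "1 :: real" 0 ?t] t by simp
  next
    case False
    have "((\<lambda>t. cos (of_int d * t)) has_integral (sin (of_int d * ?t) / of_int d - sin (of_int d * 0) / of_int d)) {0..?t}"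
      using False t by (intro fundamental_theorem_of_calculus)
        (auto intro!: derivative_eq_intros simp flip: has_real_derivative_iff_has_vector_derivative)
    then show ?thesis using False by simp
  qed
  then have "((\<lambda>t. if t \<in> {0..?t} then cos (of_int d * t) else 0) has_integral (if d = 0 then ?t else sin (of_int d * ?t) / of_int d)) {0..pi}"
    using t by (subst has_integral_restrict) auto
  then show ?thesis
  proof (rule has_integral_spike_finite[of "{?t}", rotated 2])
    fix u assume u: "u \<in> {0..pi} - {?t}"
    then have "cos ?t < cos u \<longleftrightarrow> u < ?t" using t by (intro cos_mono_less_eq) auto
    then show "step (2 * cos u - a) * cos (of_int d * u) = (if u \<in> {0..?t} then cos (of_int d * u) else 0)"
      using u t by (auto simp: step_def)
  qed simp
qed

text \<open>Majorises the error of replacing \<open>step\<close> by a ramp of width \<delta>, and is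
  continuous, hence itself open to polynomial approximation.\<close>

definition tent :: "real \<Rightarrow> real \<Rightarrow> real" where "tent \<delta> u = max 0 (2 - \<bar>u\<bar> / \<delta>)"

text \<open>As \<delta> shrinks, the tents tend to 0 except at the single angle with 2 cos t =
  a.\<close>

lemma tent_integral_small:
  assumes a: "-2 < a" "a < 2" and "\<epsilon> > 0"
  obtains \<delta> where "\<delta> > 0" "integral {0..pi} (\<lambda>t. tent \<delta> (2 * cos t - a)) < \<epsilon>"
proof -
  let ?t = "arccos (a / 2)"
  let ?f = "\<lambda>k t. tent (1 / real (Suc k)) (2 * cos t - a)"
  let ?g = "\<lambda>t. if t = ?t then 2 else 0 :: real"
  have int: "?f k integrable_on {0..pi}" for k
    unfolding tent_def by (intro integrable_continuous_interval continuous_intros) auto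
  have lim: "(\<lambda>k. integral {0..pi} (?f k)) \<longlonglongrightarrow> integral {0..pi} ?g"
  proof (rule dominated_convergence(2)[where h = "\<lambda>t. 2"])
    show "norm (?f k t) \<le> 2" for k t by (auto simp: tent_def)
    fix t :: real assume t: "t \<in> {0..pi}"
    show "(\<lambda>k. ?f k t) \<longlonglongrightarrow> ?g t"
    proof (cases "t = ?t")
      case True
      then show ?thesis using a by (simp add: tent_def)
    next
      case False
      then have ne: "2 * cos t - a \<noteq> 0" using arccos_cos[of t] t by auto
      obtain N where N: "real N > 2 / \<bar>2 * cos t - a\<bar>" using reals_Archimedean2 by blast
      have "?f k t = 0" if "k \<ge> N" for k
      proof -
        have "2 / \<bar>2 * cos t - a\<bar> < real (Suc k)" using N that by simp
        then have "2 < real (Suc k) * \<bar>2 * cos t - a\<bar>" using ne by (simp add: pos_divide_less_eq)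
        then show ?thesis by (simp add: tent_def mult.commute)
      qed
      then have "eventually (\<lambda>k. ?f k t = ?g t) sequentially"
        using False by (auto simp: eventually_sequentially)
      then show ?thesis by (rule tendsto_eventually)
    qed
  qed (use int in auto)
  moreover have "integral {0..pi} ?g = 0"
  proof (rule integral_unique, rule has_integral_spike_finite[of "{?t}"])
    show "((\<lambda>t. 0) has_integral 0) {0..pi}" by simp
  qed auto
  ultimately have "eventually (\<lambda>k. integral {0..pi} (?f k) < \<epsilon>) sequentially"
    using \<open>\<epsilon> > 0\<close> by (intro order_tendstoD(2)) auto
  then obtain k where "integral {0..pi} (?f k) < \<epsilon>" by (auto simp: eventually_sequentially)
  then show thesis by (intro that[of "1 / real (Suc k)"]) auto
qed

lemma continuous_on_real_polynomial:
  "real_polynomial_function p \<Longrightarrow> continuous_on S p" for p :: "real \<Rightarrow> real"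
  by (simp add: real_polynomial_function_eq continuous_on_polymonial_function)

text \<open>One constant C serves all large M, so the exponent can still be raised after C is
  known.\<close>

lemma polynomial_dominated:
  assumes "real_polynomial_function R"
  obtains C N where "C \<ge> 0" "\<And>u M. \<bar>u\<bar> \<ge> 8 \<Longrightarrow> M \<ge> N \<Longrightarrow> R u \<le> C * (u / 8) ^ (2 * M)"
proof -
  obtain c m where R: "R = (\<lambda>u. \<Sum>i\<le>m. c i * u ^ i)"
    using real_polynomial_function_imp_sum[OF assms] by blast
  show thesis
  proof (rule that[of "\<Sum>i\<le>m. \<bar>c i\<bar> * 8 ^ i" m])
    show "0 \<le> (\<Sum>i\<le>m. \<bar>c i\<bar> * 8 ^ i)" by (intro sum_nonneg) auto
    fix u :: real and M assume u: "\<bar>u\<bar> \<ge> 8" and M: "m \<le> M"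
    have "R u \<le> (\<Sum>i\<le>m. \<bar>c i * u ^ i\<bar>)" unfolding R by (intro sum_mono) auto
    also have "\<dots> \<le> (\<Sum>i\<le>m. \<bar>c i\<bar> * 8 ^ i * (\<bar>u\<bar> / 8) ^ (2 * M))"
    proof (intro sum_mono)
      fix i assume "i \<in> {..m}"
      then have "(\<bar>u\<bar> / 8) ^ i \<le> (\<bar>u\<bar> / 8) ^ (2 * M)" using u M by (intro power_increasing) auto
      then have "\<bar>c i\<bar> * 8 ^ i * (\<bar>u\<bar> / 8) ^ i \<le> \<bar>c i\<bar> * 8 ^ i * (\<bar>u\<bar> / 8) ^ (2 * M)"
        by (intro mult_left_mono) auto
      then show "\<bar>c i * u ^ i\<bar> \<le> \<bar>c i\<bar> * 8 ^ i * (\<bar>u\<bar> / 8) ^ (2 * M)"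
        by (simp add: abs_mult power_abs power_divide)
    qed
    also have "\<dots> = (\<Sum>i\<le>m. \<bar>c i\<bar> * 8 ^ i) * (u / 8) ^ (2 * M)"
      unfolding sum_distrib_right by (simp add: power_divide power_mult)
    finally show "R u \<le> (\<Sum>i\<le>m. \<bar>c i\<bar> * 8 ^ i) * (u / 8) ^ (2 * M)" .
  qed
qed

text \<open>Approximating the step function in mean square by a polynomial. The error is dominated on the whole line, not
  only on the support of the limit measure, by a polynomial of small integral: beyond \<open>\<bar>u\<bar> = 8\<close> a high even power of
  \<open>u / 8\<close> takes over, which is negligible on the support.\<close>
lemma step_approximation:
  assumes a: "-2 < a" "a < 2" and "\<epsilon> > 0"
  obtains p q where "real_polynomial_function p" "real_polynomial_function q"
    "\<And>u. (step u - p u)\<^sup>2 \<le> q u" "arcsine_mean a q 0 \<le> \<epsilon>"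
proof -
  \<comment> \<open>The integral of q comes out below 7 * e * pi, hence the bound \<epsilon> / 8; e
    <= 1 allows e * e to be absorbed into e.\<close>
  define e where "e = min 1 (\<epsilon> / 8)"
  have e: "0 < e" "e \<le> 1" "8 * e \<le> \<epsilon>" using \<open>\<epsilon> > 0\<close> by (auto simp: e_def)
  obtain \<delta> where \<delta>: "\<delta> > 0" "integral {0..pi} (\<lambda>t. tent \<delta> (2 * cos t - a)) < e * pi"
    using tent_integral_small[OF a, of "e * pi"] e by auto
  let ?h = "\<lambda>u. max 0 (min 1 (u / \<delta>))"
  have "continuous_on {-8..8} ?h" "continuous_on {-8..8} (tent \<delta>)"
    using \<delta>(1) unfolding tent_def[abs_def] by (auto intro!: continuous_intros)
  then obtain p t where p: "real_polynomial_function p" "\<And>u. u \<in> {-8..8} \<Longrightarrow> \<bar>?h u - p u\<bar> < e"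
    and t: "real_polynomial_function t" "\<And>u. u \<in> {-8..8} \<Longrightarrow> \<bar>tent \<delta> u - t u\<bar> < e"
    using Stone_Weierstrass_real_polynomial_function[OF compact_Icc _ e(1), of "-8" "8 :: real"] by metis
  \<comment> \<open>Beyond 8 the high power has to cover (step - p)^2 <= 2 + 2 p^2 and to offset a
    negative t, for which - t <= 1 + t^2.\<close>
  have "real_polynomial_function (\<lambda>u. 2 + 2 * (p u)\<^sup>2 + (1 + (t u)\<^sup>2))"
    by (intro real_polynomial_function.intros(2-4)
        real_polynomial_function_power p(1) t(1))
  then obtain C N where C: "C \<ge> 0" "\<And>u M. \<bar>u\<bar> \<ge> 8 \<Longrightarrow> M \<ge> N \<Longrightarrow> 2 + 2 * (p u)\<^sup>2 + (1 + (t u)\<^sup>2) \<le> C * (u / 8) ^ (2 * M)"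
    using polynomial_dominated by blast
  have "(\<lambda>M. C * (1 / 4) ^ M) \<longlonglongrightarrow> C * 0" by (intro tendsto_intros) auto
  then have "eventually (\<lambda>M. C * (1 / 4) ^ M < e) sequentially" using e(1) by (intro order_tendstoD(2)) auto
  then have "eventually (\<lambda>M. C * (1 / 4) ^ M < e \<and> M \<ge> N) sequentially"
    using eventually_ge_at_top[of N] by eventually_elim auto
  then obtain M where M: "C * (1 / 4) ^ M < e" "M \<ge> N" by (auto simp: eventually_sequentially)
  \<comment> \<open>Here t + e majorises the tent and hence d, and the remaining 3 * e covers the
    other terms of (d + e)^2.\<close>
  define q where "q u = t u + 4 * e + C * (u / 8) ^ (2 * M)" for u
  have q: "real_polynomial_function q"
    unfolding q_def[abs_def]
    by (intro real_polynomial_function.intros(2-4)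
        real_polynomial_function_power real_polynomial_function_divide real_polynomial_function.intros(1) bounded_linear_ident t(1))
  have dom: "(step u - p u)\<^sup>2 \<le> q u" for u
  proof (cases "u \<in> {-8..8}")
    case True
    define d where "d = \<bar>step u - ?h u\<bar>"
    define h where "h = ?h u"
    have d: "0 \<le> d" "d \<le> 1" "d \<le> tent \<delta> u"
      using \<delta>(1) by (auto simp: d_def step_def tent_def max_def min_def divide_simps)
    have "\<bar>h - p u\<bar> < e" "\<bar>step u - h\<bar> = d" using p(2)[OF True] by (simp_all add: h_def d_def)
    then have "\<bar>step u - p u\<bar> \<le> d + e" by linarith
    then have "(step u - p u)\<^sup>2 \<le> (d + e)\<^sup>2" using e(1) by (metis abs_ge_zero power2_abs power_mono)
    also have "\<dots> = d * d + 2 * (d * e) + e * e" by (simp add: power2_eq_square algebra_simps)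
    also have "\<dots> \<le> d + 3 * e"
    proof -
      have "d * d \<le> d * 1" using d(1,2) by (rule mult_left_mono[rotated])
      moreover have "d * e \<le> 1 * e" using d(2) e(1) by (intro mult_right_mono) auto
      moreover have "e * e \<le> 1 * e" using e by (intro mult_right_mono) auto
      ultimately show ?thesis by linarith
    qed
    also have "\<dots> \<le> t u + 4 * e" using d(3) t(2)[OF True] by linarith
    also have "\<dots> \<le> q u" using C(1) by (simp add: q_def)
    finally show ?thesis .
  next
    case False
    then have "2 + 2 * (p u)\<^sup>2 + (1 + (t u)\<^sup>2) \<le> C * (u / 8) ^ (2 * M)" using M(2) by (intro C(2)) auto
    moreover have "(step u - p u)\<^sup>2 \<le> 2 + 2 * (p u)\<^sup>2"
    proof -
      have "(step u - p u)\<^sup>2 \<le> 2 * (step u)\<^sup>2 + 2 * (p u)\<^sup>2"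
        using zero_le_power2[of "step u + p u"] by (simp add: power2_eq_square algebra_simps)
      moreover have "(step u)\<^sup>2 \<le> 1" by (simp add: step_def)
      ultimately show ?thesis by linarith
    qed
    moreover have "- t u \<le> 1 + (t u)\<^sup>2"
    proof -
      have "0 \<le> (t u + 1 / 2)\<^sup>2" by (rule zero_le_power2)
      also have "\<dots> = (t u)\<^sup>2 + t u + 1 / 4" by (simp add: power2_eq_square algebra_simps)
      finally show ?thesis by linarith
    qed
    ultimately show ?thesis using e(1) by (simp add: q_def)
  qed
  have cont: "continuous_on UNIV q" using q by (rule continuous_on_real_polynomial)
  have int_tent: "(\<lambda>t. tent \<delta> (2 * cos t - a)) integrable_on {0..pi}"
    using \<delta>(1) unfolding tent_def by (intro integrable_continuous_interval continuous_intros) auto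
  have "integral {0..pi} (\<lambda>t. q (2 * cos t - a)) \<le> integral {0..pi} (\<lambda>t. tent \<delta> (2 * cos t - a) + 6 * e)"
  proof (rule integral_le)
    show "(\<lambda>t. q (2 * cos t - a)) integrable_on {0..pi}"
      using arcsine_integrable[OF cont, of a 0] by simp
    show "(\<lambda>t. tent \<delta> (2 * cos t - a) + 6 * e) integrable_on {0..pi}"
      by (intro integrable_add int_tent) auto
    fix s :: real
    let ?u = "2 * cos s - a"
    \<comment> \<open>The support of the limit measure fills at most half of the approximation
      range, so each square of u / 8 gains a factor 1 / 4.\<close>
    have u: "\<bar>?u\<bar> \<le> 4" using a cos_ge_minus_one[of s] cos_le_one[of s] by linarith
    have "(?u / 8) ^ (2 * M) = ((?u / 8)\<^sup>2) ^ M" by (simp add: power_mult)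
    also have "(?u / 8)\<^sup>2 \<le> 1 / 4"
      using power_mono[OF u, of 2] by (simp add: power_divide)
    then have "((?u / 8)\<^sup>2) ^ M \<le> (1 / 4) ^ M" by (intro power_mono) auto
    finally have "C * (?u / 8) ^ (2 * M) \<le> C * (1 / 4) ^ M" using C(1) by (intro mult_left_mono)
    then have "C * (?u / 8) ^ (2 * M) \<le> e" using M(1) by linarith
    moreover have "?u \<in> {-8..8}" using u by auto
    ultimately show "q ?u \<le> tent \<delta> ?u + 6 * e" using t(2)[of ?u] by (simp add: q_def)
  qed
  also have "\<dots> = integral {0..pi} (\<lambda>t. tent \<delta> (2 * cos t - a)) + 6 * e * pi"
    by (subst integral_add[OF int_tent]) auto
  also have "\<dots> \<le> \<epsilon> * pi"
  proof -
    have "8 * e * pi \<le> \<epsilon> * pi" using e(3) by (intro mult_right_mono) auto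
    moreover have "0 < e * pi" using e(1) by simp
    ultimately show ?thesis using \<delta>(2) by linarith
  qed
  finally have "arcsine_mean a q 0 \<le> \<epsilon>" by (simp add: arcsine_mean_def pos_divide_le_eq)
  with p(1) q dom show thesis by (intro that)
qed

text \<open>Passing from \<open>step\<close> to p costs an error governed by q on the diagonal at x
  alone; y enters only through the limit c of the means of p, which lets near and far pairs share
  the argument.\<close>

lemma kernel_approx_limit:
  fixes x y :: "nat \<Rightarrow> int"
  assumes a: "-2 < a" "a < 2"
    and r: "filterlim r at_top sequentially" and x: "(\<lambda>n. of_int (x n) / r n) \<longlonglongrightarrow> a"
    and lim: "\<And>\<eta>. \<eta> > 0 \<Longrightarrow> \<exists>p q c. real_polynomial_function p \<and> real_polynomial_function q \<and>
      (\<forall>u. (step u - p u)\<^sup>2 \<le> q u) \<and> arcsine_mean a q 0 < 2 * \<eta>\<^sup>2 \<and>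
      (\<lambda>n. bessel_mean p (x n) (y n) (r n)) \<longlonglongrightarrow> c \<and> \<bar>c - L\<bar> \<le> 2 * \<eta>"
  shows "(\<lambda>n. bkernel (x n) (y n) (r n)) \<longlonglongrightarrow> L"
proof (rule tendstoI)
  fix \<epsilon> :: real assume "\<epsilon> > 0"
  \<comment> \<open>The three errors below are at most 3/2, 1 and 2 times \<eta>.\<close>
  define \<eta> where "\<eta> = \<epsilon> / 5"
  have "\<eta> > 0" using \<open>\<epsilon> > 0\<close> by (simp add: \<eta>_def)
  then obtain p q c where p: "real_polynomial_function p" and q: "real_polynomial_function q"
    and dom: "\<And>u. (step u - p u)\<^sup>2 \<le> q u" and small: "arcsine_mean a q 0 < 2 * \<eta>\<^sup>2"
    and c: "(\<lambda>n. bessel_mean p (x n) (y n) (r n)) \<longlonglongrightarrow> c" "\<bar>c - L\<bar> \<le> 2 * \<eta>"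
    using lim[OF \<open>\<eta> > 0\<close>] by blast
  have "(\<lambda>n. bessel_mean q (x n) (x n) (r n)) \<longlonglongrightarrow> arcsine_mean a q 0"
    by (rule polynomial_limit[OF q r x]) simp
  then have ev1: "eventually (\<lambda>n. bessel_mean q (x n) (x n) (r n) < 2 * \<eta>\<^sup>2) sequentially"
    using small by (rule order_tendstoD(2))
  have ev2: "eventually (\<lambda>n. dist (bessel_mean p (x n) (y n) (r n)) c < \<eta>) sequentially"
    using c(1) \<open>\<eta> > 0\<close> by (rule tendstoD)
  have pos: "eventually (\<lambda>n. r n > 0) sequentially" using r by (simp add: filterlim_at_top_dense)
  show "eventually (\<lambda>n. dist (bkernel (x n) (y n) (r n)) L < \<epsilon>) sequentially"
    using ev1 ev2 pos
  proof eventually_elim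
    case (elim n)
    have gp: "poly_growth p" and gq: "poly_growth q" using p q by (auto intro: poly_growth_real_polynomial)
    have "\<bar>bessel_mean (\<lambda>u. step u - p u) (x n) (y n) (r n)\<bar> \<le> bessel_mean q (x n) (x n) (r n) / (2 * \<eta>) + \<eta> / 2"
      by (intro bessel_mean_cauchy_schwarz poly_growth_diff poly_growth_step gp gq dom \<open>\<eta> > 0\<close> elim(3))
    also have "bessel_mean q (x n) (x n) (r n) / (2 * \<eta>) \<le> \<eta>"
      using elim(1) \<open>\<eta> > 0\<close> by (simp add: pos_divide_le_eq power2_eq_square mult_ac)
    finally have "\<bar>bkernel (x n) (y n) (r n) - bessel_mean p (x n) (y n) (r n)\<bar> \<le> \<eta> + \<eta> / 2"
      using elim(3) by (simp add: bessel_mean_diff[OF poly_growth_step gp] bessel_mean_step)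
    then show ?case using elim(2) c(2) \<open>\<eta> > 0\<close> unfolding dist_real_def \<eta>_def by linarith
  qed
qed

lemma kernel_limit_far:
  fixes x y :: "nat \<Rightarrow> int"
  assumes a: "-2 < a" "a < 2"
    and r: "filterlim r at_top sequentially" and x: "(\<lambda>n. of_int (x n) / r n) \<longlonglongrightarrow> a"
    and d: "filterlim (\<lambda>n. \<bar>x n - y n\<bar>) at_top sequentially"
  shows "(\<lambda>n. bkernel (x n) (y n) (r n)) \<longlonglongrightarrow> 0"
proof (rule kernel_approx_limit[OF a r x])
  fix \<eta> :: real assume \<eta>: "\<eta> > 0"
  then have "\<eta>\<^sup>2 > 0" by simp
  from step_approximation[OF a this] obtain p q where pq: "real_polynomial_function p" "real_polynomial_function q"
    "\<And>u. (step u - p u)\<^sup>2 \<le> q u" "arcsine_mean a q 0 \<le> \<eta>\<^sup>2"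
    by blast
  have "\<eta>\<^sup>2 < 2 * \<eta>\<^sup>2" using \<eta> by simp
  then have small: "arcsine_mean a q 0 < 2 * \<eta>\<^sup>2" using pq(4) by linarith
  have "\<bar>0 - 0 :: real\<bar> \<le> 2 * \<eta>" using \<eta> by simp
  with pq(1-3) small polynomial_limit_far[OF pq(1) r d]
  show "\<exists>p q c. real_polynomial_function p \<and> real_polynomial_function q \<and>
      (\<forall>u. (step u - p u)\<^sup>2 \<le> q u) \<and> arcsine_mean a q 0 < 2 * \<eta>\<^sup>2 \<and>
      (\<lambda>n. bessel_mean p (x n) (y n) (r n)) \<longlonglongrightarrow> c \<and> \<bar>c - 0\<bar> \<le> 2 * \<eta>"
    by blast
qed

text \<open>The majorant q serves a second time, with the same inequality inside the limiting
  integral, to compare the limit of the means of p with the sine kernel.\<close>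

lemma kernel_limit_near:
  fixes x y :: "nat \<Rightarrow> int"
  assumes a: "-2 < a" "a < 2"
    and r: "filterlim r at_top sequentially" and x: "(\<lambda>n. of_int (x n) / r n) \<longlonglongrightarrow> a"
    and d: "eventually (\<lambda>n. x n - y n = d) sequentially"
  shows "(\<lambda>n. bkernel (x n) (y n) (r n)) \<longlonglongrightarrow>
    (if d = 0 then arccos (a / 2) / pi else sin (arccos (a / 2) * of_int d) / (pi * of_int d))"
proof -
  define L where "L = (if d = 0 then arccos (a / 2) / pi else sin (arccos (a / 2) * of_int d) / (pi * of_int d))"
  have "(\<lambda>n. bkernel (x n) (y n) (r n)) \<longlonglongrightarrow> L"
  proof (rule kernel_approx_limit[OF a r x])
    fix \<eta> :: real assume \<eta>: "\<eta> > 0"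
    then have "\<eta>\<^sup>2 > 0" by simp
    from step_approximation[OF a this] obtain p q where pq: "real_polynomial_function p" "real_polynomial_function q"
      "\<And>u. (step u - p u)\<^sup>2 \<le> q u" "arcsine_mean a q 0 \<le> \<eta>\<^sup>2"
      by blast
    have "\<eta>\<^sup>2 < 2 * \<eta>\<^sup>2" using \<eta> by simp
    then have small: "arcsine_mean a q 0 < 2 * \<eta>\<^sup>2" using pq(4) by linarith
    have cont: "continuous_on UNIV p" "continuous_on UNIV q"
      using pq by (auto intro: continuous_on_real_polynomial)
    let ?f = "\<lambda>t. p (2 * cos t - a) * cos (of_int d * t) - step (2 * cos t - a) * cos (of_int d * t)"
    let ?q = "\<lambda>t. q (2 * cos t - a)"
    note S = step_arcsine[OF a, of d]
    have if': "?f integrable_on {0..pi}"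
      by (intro integrable_diff arcsine_integrable cont has_integral_integrable[OF S])
    have iq: "?q integrable_on {0..pi}" using arcsine_integrable[OF cont(2), of a 0] by simp
    have "norm (integral {0..pi} ?f) \<le> integral {0..pi} (\<lambda>t. ?q t / (2 * \<eta>) + \<eta> / 2)"
    proof (rule integral_norm_bound_integral[OF if'])
      show "(\<lambda>t. ?q t / (2 * \<eta>) + \<eta> / 2) integrable_on {0..pi}"
        by (intro integrable_add integrable_on_divide iq) auto
      fix t :: real
      let ?w = "\<bar>step (2 * cos t - a) - p (2 * cos t - a)\<bar>"
      have "norm (?f t) = ?w * \<bar>cos (of_int d * t)\<bar>"
        by (simp add: abs_mult[symmetric] algebra_simps abs_minus_commute)
      also have "\<dots> \<le> ?w * 1" by (intro mult_left_mono) auto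
      also have "\<dots> \<le> ?w\<^sup>2 / (2 * \<eta>) + \<eta> / 2"
      proof -
        have "0 \<le> (?w - \<eta>)\<^sup>2 / (2 * \<eta>)" using \<eta> by simp
        also have "\<dots> = ?w\<^sup>2 / (2 * \<eta>) + \<eta> / 2 - ?w"
          using \<eta> by (simp only: power2_diff) (simp add: field_simps power2_eq_square)
        finally show ?thesis by simp
      qed
      also have "?w\<^sup>2 / (2 * \<eta>) \<le> ?q t / (2 * \<eta>)"
        using pq(3)[of "2 * cos t - a"] \<eta> by (intro divide_right_mono) auto
      finally show "norm (?f t) \<le> ?q t / (2 * \<eta>) + \<eta> / 2" by simp
    qed
    also have "\<dots> = integral {0..pi} ?q / (2 * \<eta>) + \<eta> / 2 * pi"
      using iq by (subst integral_add) (auto intro!: integrable_on_divide)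
    also have "integral {0..pi} ?q = arcsine_mean a q 0 * pi" by (simp add: arcsine_mean_def)
    also have "arcsine_mean a q 0 * pi / (2 * \<eta>) \<le> \<eta>\<^sup>2 * pi / (2 * \<eta>)"
      using pq(4) \<eta> by (intro divide_right_mono mult_right_mono) auto
    also have "\<eta>\<^sup>2 * pi / (2 * \<eta>) + \<eta> / 2 * pi = \<eta> * pi"
      using \<eta> by (simp add: field_simps power2_eq_square)
    finally have b: "\<bar>integral {0..pi} ?f\<bar> \<le> \<eta> * pi" by simp
    have eq: "integral {0..pi} ?f / pi = arcsine_mean a p d - L"
    proof -
      have "integral {0..pi} ?f = integral {0..pi} (\<lambda>t. p (2 * cos t - a) * cos (of_int d * t))
          - integral {0..pi} (\<lambda>t. step (2 * cos t - a) * cos (of_int d * t))"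
        by (intro integral_diff arcsine_integrable cont has_integral_integrable[OF S])
      then show ?thesis unfolding integral_unique[OF S] arcsine_mean_def L_def by (simp add: diff_divide_distrib mult.commute)
    qed
    have bound: "\<bar>z / pi\<bar> \<le> 2 * \<eta>" if "\<bar>z\<bar> \<le> \<eta> * pi" for z
    proof -
      have "\<bar>z / pi\<bar> = \<bar>z\<bar> / pi" by (simp add: abs_divide)
      also have "\<dots> \<le> \<eta>" using that by (simp add: pos_divide_le_eq)
      finally show ?thesis using \<eta> by linarith
    qed
    have "\<bar>arcsine_mean a p d - L\<bar> \<le> 2 * \<eta>" using bound[OF b] unfolding eq .
    with pq(1-3) small polynomial_limit[OF pq(1) r x d]
    show "\<exists>p q c. real_polynomial_function p \<and> real_polynomial_function q \<and>
        (\<forall>u. (step u - p u)\<^sup>2 \<le> q u) \<and> arcsine_mean a q 0 < 2 * \<eta>\<^sup>2 \<and>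
        (\<lambda>n. bessel_mean p (x n) (y n) (r n)) \<longlonglongrightarrow> c \<and> \<bar>c - L\<bar> \<le> 2 * \<eta>"
      by blast
  qed
  then show ?thesis by (simp only: L_def)
qed

section \<open>Limits at and beyond the edges\<close>

lemma floor_ratio_limit:
  assumes r: "filterlim r at_top sequentially"
  shows "(\<lambda>n. of_int \<lfloor>b * r n\<rfloor> / r n :: real) \<longlonglongrightarrow> b"
proof -
  have inv: "(\<lambda>n. 1 / r n) \<longlonglongrightarrow> 0"
    using tendsto_inverse_0_at_top[OF r] by (simp add: divide_inverse)
  have pos: "eventually (\<lambda>n. r n > 0) sequentially" using r by (simp add: filterlim_at_top_dense)
  show ?thesis
  proof (rule tendsto_sandwich)
    show "(\<lambda>n. b - 1 / r n) \<longlonglongrightarrow> b" using tendsto_diff[OF tendsto_const inv, of b] by simp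
    show "eventually (\<lambda>n. b - 1 / r n \<le> of_int \<lfloor>b * r n\<rfloor> / r n) sequentially"
      using pos
    proof eventually_elim
      case (elim n)
      have "b * r n - 1 \<le> of_int \<lfloor>b * r n\<rfloor>" by linarith
      then have "(b * r n - 1) / r n \<le> of_int \<lfloor>b * r n\<rfloor> / r n" using elim by (intro divide_right_mono) auto
      then show ?case using elim by (simp add: diff_divide_distrib)
    qed
    show "eventually (\<lambda>n. of_int \<lfloor>b * r n\<rfloor> / r n \<le> b) sequentially"
      using pos by eventually_elim (simp add: pos_divide_le_eq)
  qed simp
qed

text \<open>The diagonal decreases in x, so x is compared with a point of slope 2 cos t just inside
  the edge, where the limit t / pi is below \<epsilon>. Assuming the lower bound for every b < 2
  covers a = 2, a > 2 and infinite a together.\<close>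

lemma kernel_diag_right:
  fixes x :: "nat \<Rightarrow> int"
  assumes r: "filterlim r at_top sequentially"
    and x: "\<And>b. b < 2 \<Longrightarrow> eventually (\<lambda>n. of_int (x n) > b * r n) sequentially"
  shows "(\<lambda>n. bkernel (x n) (x n) (r n)) \<longlonglongrightarrow> 0"
proof (rule tendstoI)
  fix \<epsilon> :: real assume "\<epsilon> > 0"
  define t where "t = min 1 (\<epsilon> * pi / 2)"
  have t: "0 < t" "t < pi" "t / pi < \<epsilon>"
  proof -
    show "0 < t" using \<open>\<epsilon> > 0\<close> by (simp add: t_def)
    have "1 < pi" using pi_gt3 by simp
    then show "t < pi" by (simp add: t_def)
    have "t \<le> \<epsilon> * pi / 2" by (simp add: t_def)
    also have "\<dots> < \<epsilon> * pi" using \<open>\<epsilon> > 0\<close> by simp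
    finally show "t / pi < \<epsilon>" by (simp add: pos_divide_less_eq)
  qed
  define b where "b = 2 * cos t"
  have b: "-2 < b" "b < 2" using cos_monotone_0_pi[of 0 t] cos_monotone_0_pi[of t pi] t by (auto simp: b_def)
  have "arccos (b / 2) = t" using t by (simp add: b_def arccos_cos)
  then have "(\<lambda>n. bkernel \<lfloor>b * r n\<rfloor> \<lfloor>b * r n\<rfloor> (r n)) \<longlonglongrightarrow> t / pi"
    using kernel_limit_near[OF b r floor_ratio_limit[OF r], of "\<lambda>n. \<lfloor>b * r n\<rfloor>" 0] by simp
  then have ev: "eventually (\<lambda>n. bkernel \<lfloor>b * r n\<rfloor> \<lfloor>b * r n\<rfloor> (r n) < \<epsilon>) sequentially"
    using t(3) by (rule order_tendstoD(2))
  have pos: "eventually (\<lambda>n. r n > 0) sequentially" using r by (simp add: filterlim_at_top_dense)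
  show "eventually (\<lambda>n. dist (bkernel (x n) (x n) (r n)) 0 < \<epsilon>) sequentially"
    using ev pos x[OF b(2)]
  proof eventually_elim
    case (elim n)
    have "bkernel (x n) (x n) (r n) \<le> bkernel \<lfloor>b * r n\<rfloor> \<lfloor>b * r n\<rfloor> (r n)"
      using elim(3) by (intro bkernel_diag_antimono) linarith
    then show ?case using elim bkernel_diag_bounds[of "r n" "x n"] by simp
  qed
qed

text \<open>As at the right edge, with a comparison point of slope 2 cos (pi - t), where the limit 1
  - t / pi exceeds 1 - \<epsilon>.\<close>

lemma kernel_diag_left:
  fixes x :: "nat \<Rightarrow> int"
  assumes r: "filterlim r at_top sequentially"
    and x: "\<And>b. b > -2 \<Longrightarrow> eventually (\<lambda>n. of_int (x n) < b * r n) sequentially"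
  shows "(\<lambda>n. bkernel (x n) (x n) (r n)) \<longlonglongrightarrow> 1"
proof (rule tendstoI)
  fix \<epsilon> :: real assume "\<epsilon> > 0"
  define t where "t = min 1 (\<epsilon> * pi / 2)"
  have t: "0 < t" "t < pi" "t / pi < \<epsilon>"
  proof -
    show "0 < t" using \<open>\<epsilon> > 0\<close> by (simp add: t_def)
    have "1 < pi" using pi_gt3 by simp
    then show "t < pi" by (simp add: t_def)
    have "t \<le> \<epsilon> * pi / 2" by (simp add: t_def)
    also have "\<dots> < \<epsilon> * pi" using \<open>\<epsilon> > 0\<close> by simp
    finally show "t / pi < \<epsilon>" by (simp add: pos_divide_less_eq)
  qed
  define b where "b = 2 * cos (pi - t)"
  have b: "-2 < b" "b < 2" using cos_monotone_0_pi[of 0 t] cos_monotone_0_pi[of t pi] t by (auto simp: b_def)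
  have "arccos (b / 2) = pi - t" using t arccos_cos[of "pi - t"] by (simp add: b_def)
  then have "(\<lambda>n. bkernel \<lfloor>b * r n\<rfloor> \<lfloor>b * r n\<rfloor> (r n)) \<longlonglongrightarrow> (pi - t) / pi"
    using kernel_limit_near[OF b r floor_ratio_limit[OF r], of "\<lambda>n. \<lfloor>b * r n\<rfloor>" 0] by simp
  moreover have "1 - \<epsilon> < (pi - t) / pi" using t by (simp add: diff_divide_distrib)
  ultimately have ev: "eventually (\<lambda>n. bkernel \<lfloor>b * r n\<rfloor> \<lfloor>b * r n\<rfloor> (r n) > 1 - \<epsilon>) sequentially"
    by (rule order_tendstoD(1))
  have pos: "eventually (\<lambda>n. r n > 0) sequentially" using r by (simp add: filterlim_at_top_dense)
  show "eventually (\<lambda>n. dist (bkernel (x n) (x n) (r n)) 1 < \<epsilon>) sequentially"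
    using ev pos x[OF b(1)]
  proof eventually_elim
    case (elim n)
    have "bkernel \<lfloor>b * r n\<rfloor> \<lfloor>b * r n\<rfloor> (r n) \<le> bkernel (x n) (x n) (r n)"
      using elim(3) by (intro bkernel_diag_antimono) (simp add: le_floor_iff)
    then show ?case using elim bkernel_diag_bounds[of "r n" "x n"] by (simp add: dist_real_def)
  qed
qed

lemma tendsto_zero_of_square:
  fixes f g :: "nat \<Rightarrow> real"
  assumes "g \<longlonglongrightarrow> 0" "eventually (\<lambda>n. (f n)\<^sup>2 \<le> g n) sequentially"
  shows "f \<longlonglongrightarrow> 0"
proof -
  have "(\<lambda>n. sqrt (g n)) \<longlonglongrightarrow> 0" using tendsto_real_sqrt[OF assms(1)] by simp
  moreover have "eventually (\<lambda>n. norm (f n) \<le> sqrt (g n)) sequentially"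
    using assms(2) by eventually_elim (simp add: real_le_rsqrt)
  ultimately show ?thesis by (rule Lim_null_comparison[rotated])
qed

lemma kernel_right:
  fixes x y :: "nat \<Rightarrow> int"
  assumes r: "filterlim r at_top sequentially"
    and x: "\<And>b. b < 2 \<Longrightarrow> eventually (\<lambda>n. of_int (x n) > b * r n) sequentially"
  shows "(\<lambda>n. bkernel (x n) (y n) (r n)) \<longlonglongrightarrow> 0"
proof (rule tendsto_zero_of_square[OF kernel_diag_right[OF r x]])
  have "eventually (\<lambda>n. r n > 0) sequentially" using r by (simp add: filterlim_at_top_dense)
  then show "eventually (\<lambda>n. (bkernel (x n) (y n) (r n))\<^sup>2 \<le> bkernel (x n) (x n) (r n)) sequentially"
    by eventually_elim (simp add: bkernel_sq_le)
qed

lemma kernel_left: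
  fixes x y :: "nat \<Rightarrow> int"
  assumes r: "filterlim r at_top sequentially"
    and x: "\<And>b. b > -2 \<Longrightarrow> eventually (\<lambda>n. of_int (x n) < b * r n) sequentially"
    and ne: "eventually (\<lambda>n. x n \<noteq> y n) sequentially"
  shows "(\<lambda>n. bkernel (x n) (y n) (r n)) \<longlonglongrightarrow> 0"
proof (rule tendsto_zero_of_square)
  show "(\<lambda>n. 1 - bkernel (x n) (x n) (r n)) \<longlonglongrightarrow> 0"
    using tendsto_diff[OF tendsto_const kernel_diag_left[OF r x], of 1] by simp
  have "eventually (\<lambda>n. r n > 0) sequentially" using r by (simp add: filterlim_at_top_dense)
  then show "eventually (\<lambda>n. (bkernel (x n) (y n) (r n))\<^sup>2 \<le> 1 - bkernel (x n) (x n) (r n)) sequentially"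
    using ne by eventually_elim (simp add: bkernel_sq_le)
qed

section \<open>Depoissonization\<close>

text \<open>If convergence failed at z, Montel's theorem would give a convergent subsequence of one
  staying away from G z; its limit agrees with G on the real line, hence everywhere. Monotonicity of
  B turns the bound by the real part into boundedness on compact sets.\<close>

lemma vitali_entire:
  fixes F :: "nat \<Rightarrow> complex \<Rightarrow> complex"
  assumes hol: "\<And>n. F n holomorphic_on UNIV" and G: "G holomorphic_on UNIV"
    and bd: "\<And>n z. cmod (F n z) \<le> B \<bar>Re z\<bar>" and mono: "\<And>s t. s \<le> t \<Longrightarrow> B s \<le> (B t :: real)"
    and real: "\<And>t :: real. (\<lambda>n. F n (of_real t)) \<longlonglongrightarrow> G (of_real t)"
  shows "(\<lambda>n. F n z) \<longlonglongrightarrow> G z"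
proof (rule ccontr)
  assume "\<not> (\<lambda>n. F n z) \<longlonglongrightarrow> G z"
  then obtain e where e: "e > 0" "\<And>N. \<exists>n\<ge>N. e \<le> dist (F n z) (G z)"
    unfolding lim_sequentially by (auto simp: not_less)
  then have "infinite {n. e \<le> dist (F n z) (G z)}"
    unfolding infinite_nat_iff_unbounded_le by auto
  then obtain \<sigma> :: "nat \<Rightarrow> nat" where \<sigma>: "strict_mono \<sigma>" "\<And>n. e \<le> dist (F (\<sigma> n) z) (G z)"
    using infinite_enumerate by blast
  have bounded: "\<exists>C. \<forall>h\<in>range F. \<forall>z\<in>K. cmod (h z) \<le> C" if K: "compact K" for K
  proof -
    obtain R where R: "\<And>z. z \<in> K \<Longrightarrow> cmod z \<le> R"
      using compact_imp_bounded[OF K] by (auto simp: bounded_iff)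
    have "cmod (F n z) \<le> B R" if z: "z \<in> K" for n z
      using bd[of n z] mono[OF order_trans[OF abs_Re_le_cmod R[OF z]]] by linarith
    then show ?thesis by auto
  qed
  obtain g \<rho> where g: "g holomorphic_on UNIV" "strict_mono (\<rho> :: nat \<Rightarrow> nat)"
    and lim: "\<And>w. w \<in> UNIV \<Longrightarrow> (\<lambda>n. F (\<sigma> (\<rho> n)) w) \<longlonglongrightarrow> g w"
    by (rule Montel[of UNIV "range F" "\<lambda>n. F (\<sigma> n)"]) (use hol bounded in auto)
  have sub: "strict_mono (\<sigma> \<circ> \<rho>)" using \<sigma>(1) g(2) by (rule strict_mono_o)
  have eq: "g (of_real t) = G (of_real t)" for t :: real
  proof -
    have "(\<lambda>n. F (\<sigma> (\<rho> n)) (of_real t)) \<longlonglongrightarrow> G (of_real t)"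
      using LIMSEQ_subseq_LIMSEQ[OF real sub] by (simp add: o_def)
    then show ?thesis using LIMSEQ_unique lim[of "of_real t"] by blast
  qed
  have "g z - G z = 0"
  proof (rule analytic_continuation[where f = "\<lambda>z. g z - G z" and w = z and S = UNIV and U = "range complex_of_real" and \<xi> = 0])
    show "(\<lambda>z. g z - G z) holomorphic_on UNIV" using g(1) G by (intro holomorphic_intros)
    show "0 islimpt range complex_of_real"
    proof (rule islimptI)
      fix T :: "complex set" assume "0 \<in> T" "open T"
      then obtain r where r: "r > 0" "ball 0 r \<subseteq> T" by (auto simp: open_contains_ball)
      then have "complex_of_real (r / 2) \<in> ball 0 r" by (simp add: dist_norm norm_divide)
      then show "\<exists>y\<in>range complex_of_real. y \<in> T \<and> y \<noteq> 0" using r by (intro bexI[of _ "complex_of_real (r / 2)"] rangeI) auto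
    qed
  qed (auto simp: eq)
  then have "(\<lambda>n. F (\<sigma> (\<rho> n)) z) \<longlonglongrightarrow> G z" using lim[of z] by simp
  then obtain n where "dist (F (\<sigma> (\<rho> n)) z) (G z) < e"
    using e(1) unfolding lim_sequentially by blast
  then show False using \<sigma>(2)[of "\<rho> n"] by simp
qed

section \<open>Tilted Poisson sums\<close>

definition poisson_weight :: "nat \<Rightarrow> nat \<Rightarrow> real" where
  "poisson_weight n k = exp (- real n) * real n ^ k / fact k"

text \<open>Distance from the mean in standard deviations. At n = 0 division by zero makes it 0, and
  the exponential identities hold there too.\<close>

definition deviation :: "nat \<Rightarrow> nat \<Rightarrow> real" where
  "deviation n k = (real k - real n) / sqrt (real n)"

lemma poisson_weight_nonneg: "0 \<le> poisson_weight n k"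
  by (simp add: poisson_weight_def)

text \<open>The tilt is geometric in k, so up to normalisation it changes the Poisson mean n into n
  * exp (z / sqrt n).\<close>

lemma exp_deviation:
  fixes z :: "'a :: {banach, real_normed_field}"
  shows "exp (z * of_real (deviation n k)) = exp (z / of_real (sqrt (real n))) ^ k * exp (- (z * of_real (sqrt (real n))))"
proof -
  have s: "real n / sqrt (real n) = sqrt (real n)" by (simp add: real_div_sqrt)
  have "z * of_real (deviation n k) = z * (of_real (real k / sqrt (real n)) - of_real (real n / sqrt (real n)))"
    by (simp only: deviation_def diff_divide_distrib of_real_diff)
  also have "\<dots> = of_nat k * (z / of_real (sqrt (real n))) + - (z * of_real (sqrt (real n)))"
    unfolding s by (simp add: algebra_simps)
  finally show ?thesis by (simp only: exp_add exp_of_nat_mult)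
qed

lemma poisson_exponent:
  fixes z :: "'a :: {banach, real_normed_field}"
  shows "exp (- of_nat n) * exp (- (z * of_real (sqrt (real n)))) * exp (of_nat n * exp (z / of_real (sqrt (real n)))) =
    exp (of_nat n * (exp (z / of_real (sqrt (real n))) - 1 - z / of_real (sqrt (real n))))"
proof -
  have s: "real n / sqrt (real n) = sqrt (real n)" by (simp add: real_div_sqrt)
  have "of_nat n * (z / of_real (sqrt (real n))) = z * of_real (real n / sqrt (real n))" by simp
  then have e: "of_nat n * (z / of_real (sqrt (real n))) = z * of_real (sqrt (real n))" unfolding s .
  have "of_nat n * (exp (z / of_real (sqrt (real n))) - 1 - z / of_real (sqrt (real n))) =
     - of_nat n + - (z * of_real (sqrt (real n))) + of_nat n * exp (z / of_real (sqrt (real n)))"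
    unfolding right_diff_distrib e by simp
  then show ?thesis by (simp only: exp_add)
qed

lemma poisson_tilted_sums:
  "(\<lambda>k. poisson_weight n k * exp (t * deviation n k)) sums
    exp (real n * (exp (t / sqrt (real n)) - 1 - t / sqrt (real n)))"
proof -
  let ?w = "exp (t / sqrt (real n))"
  have "(\<lambda>k. exp (- real n) * exp (- (t * sqrt (real n))) * ((real n * ?w) ^ k /\<^sub>R fact k)) sums
     (exp (- real n) * exp (- (t * sqrt (real n))) * exp (real n * ?w))"
    by (intro sums_mult exp_converges)
  moreover have "exp (- real n) * exp (- (t * sqrt (real n))) * ((real n * ?w) ^ k /\<^sub>R fact k) =
      poisson_weight n k * exp (t * deviation n k)" for k
    using exp_deviation[of t n k] by (simp add: poisson_weight_def divide_inverse power_mult_distrib mult_ac)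
  ultimately show ?thesis using poisson_exponent[of n t] by simp
qed

lemma sqrt_scaling_le:
  assumes "n > 0"
  shows "\<bar>t / sqrt (real n)\<bar> \<le> \<bar>t\<bar>"
proof -
  have "\<bar>t\<bar> * 1 \<le> \<bar>t\<bar> * sqrt (real n)" using assms by (intro mult_left_mono) auto
  then show ?thesis using assms by (simp add: abs_divide pos_divide_le_eq)
qed

text \<open>The Taylor remainder after the linear term is quadratic in t / sqrt n and absorbs the
  factor n, which makes the bound uniform in n.\<close>

lemma poisson_exponent_bound: "real n * (exp (t / sqrt (real n)) - 1 - t / sqrt (real n)) \<le> t\<^sup>2 * exp \<bar>t\<bar>"
proof (cases "n = 0")
  case False
  let ?x = "t / sqrt (real n)"
  have "\<bar>exp ?x - (1 + ?x)\<bar> \<le> exp \<bar>?x\<bar> * ?x\<^sup>2"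
    using Taylor_exp_field[of ?x 1] by (simp add: numeral_2_eq_2)
  then have "exp ?x - 1 - ?x \<le> exp \<bar>?x\<bar> * ?x\<^sup>2" by linarith
  also have "\<dots> \<le> exp \<bar>t\<bar> * ?x\<^sup>2"
    using sqrt_scaling_le[of n t] False by (intro mult_right_mono) auto
  finally have "real n * (exp ?x - 1 - ?x) \<le> real n * (exp \<bar>t\<bar> * ?x\<^sup>2)" by (intro mult_left_mono) auto
  then show ?thesis using False by (simp add: power_divide mult.commute)
qed simp

lemma poisson_exponent_limit:
  "(\<lambda>n. real n * (exp (t / sqrt (real n)) - 1 - t / sqrt (real n))) \<longlonglongrightarrow> t\<^sup>2 / 2"
proof (rule LIM_zero_cancel, rule Lim_null_comparison)
  show "(\<lambda>n. exp \<bar>t\<bar> * \<bar>t\<bar> ^ 3 / 2 / sqrt (real n)) \<longlonglongrightarrow> 0" by real_asymp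
  show "eventually (\<lambda>n. norm (real n * (exp (t / sqrt (real n)) - 1 - t / sqrt (real n)) - t\<^sup>2 / 2) \<le>
      exp \<bar>t\<bar> * \<bar>t\<bar> ^ 3 / 2 / sqrt (real n)) sequentially"
    using eventually_gt_at_top[of 0]
  proof eventually_elim
    case (elim n)
    define s where "s = sqrt (real n)"
    define x where "x = t / s"
    have s: "real n = s * s" "s > 0" using elim by (simp_all add: s_def)
    have x: "\<bar>x\<bar> \<le> \<bar>t\<bar>" using sqrt_scaling_le[OF elim, of t] by (simp add: x_def s_def)
    have "\<bar>exp x - (1 + x + x\<^sup>2 / 2)\<bar> \<le> exp \<bar>x\<bar> * \<bar>x\<bar> ^ 3 / 2"
      using Taylor_exp_field[of x 2] by (simp add: numeral_2_eq_2 numeral_3_eq_3)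
    also have "\<dots> \<le> exp \<bar>t\<bar> * \<bar>x\<bar> ^ 3 / 2" using x by (intro divide_right_mono mult_right_mono) auto
    finally have "real n * \<bar>exp x - (1 + x + x\<^sup>2 / 2)\<bar> \<le> real n * (exp \<bar>t\<bar> * \<bar>x\<bar> ^ 3 / 2)"
      by (intro mult_left_mono) auto
    also have "\<dots> = exp \<bar>t\<bar> * \<bar>t\<bar> ^ 3 / 2 / s"
      using s(2) unfolding s(1) x_def by (simp add: abs_divide power_divide field_simps power3_eq_cube)
    also have "real n * \<bar>exp x - (1 + x + x\<^sup>2 / 2)\<bar> = \<bar>real n * (exp x - 1 - x) - t\<^sup>2 / 2\<bar>"
    proof -
      have "real n * x\<^sup>2 = t\<^sup>2" using s(2) unfolding s(1) x_def by (simp add: power_divide power2_eq_square)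
      then have "real n * (exp x - 1 - x) - t\<^sup>2 / 2 = real n * (exp x - (1 + x + x\<^sup>2 / 2))"
        by (simp add: algebra_simps)
      then show ?thesis by (simp add: abs_mult)
    qed
    finally show ?case by (simp add: x_def s_def)
  qed
qed

definition poisson_transform :: "(nat \<Rightarrow> real) \<Rightarrow> nat \<Rightarrow> complex \<Rightarrow> complex" where
  "poisson_transform f n z = (\<Sum>k. of_real (f k * poisson_weight n k) * exp (z * of_real (deviation n k)))"

lemma poisson_transform_summable:
  assumes f: "\<And>k. \<bar>f k\<bar> \<le> 1"
  shows "summable (\<lambda>k. norm (of_real (f k * poisson_weight n k) * exp (z * of_real (deviation n k))))"
    and "cmod (poisson_transform f n z) \<le> exp (real n * (exp (Re z / sqrt (real n)) - 1 - Re z / sqrt (real n)))"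
proof -
  have le: "norm (of_real (f k * poisson_weight n k) * exp (z * of_real (deviation n k))) \<le>
      poisson_weight n k * exp (Re z * deviation n k)" for k
  proof -
    have "norm (of_real (f k * poisson_weight n k) * exp (z * of_real (deviation n k))) =
        \<bar>f k\<bar> * (poisson_weight n k * exp (Re z * deviation n k))"
      by (simp add: norm_mult abs_mult poisson_weight_nonneg mult.assoc)
    also have "\<dots> \<le> 1 * (poisson_weight n k * exp (Re z * deviation n k))"
      using f by (intro mult_right_mono) (auto simp: poisson_weight_nonneg)
    finally show ?thesis by simp
  qed
  have s: "(\<lambda>k. poisson_weight n k * exp (Re z * deviation n k)) sums exp (real n * (exp (Re z / sqrt (real n)) - 1 - Re z / sqrt (real n)))"
    by (rule poisson_tilted_sums)
  show sn: "summable (\<lambda>k. norm (of_real (f k * poisson_weight n k) * exp (z * of_real (deviation n k))))"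
    by (rule summable_comparison_test'[OF sums_summable[OF s]]) (use le in simp)
  have "cmod (poisson_transform f n z) \<le> (\<Sum>k. norm (of_real (f k * poisson_weight n k) * exp (z * of_real (deviation n k))))"
    unfolding poisson_transform_def by (rule summable_norm[OF sn])
  also have "\<dots> \<le> (\<Sum>k. poisson_weight n k * exp (Re z * deviation n k))"
    by (intro suminf_le le sn sums_summable[OF s])
  finally show "cmod (poisson_transform f n z) \<le> exp (real n * (exp (Re z / sqrt (real n)) - 1 - Re z / sqrt (real n)))"
    using s by (simp add: sums_iff)
qed

lemma summable_bounded_exp:
  fixes z :: "'a :: {banach, real_normed_field}"
  assumes f: "\<And>k. \<bar>f k\<bar> \<le> 1"
  shows "summable (\<lambda>k. of_real (f k / fact k) * z ^ k)"
proof (rule summable_norm_cancel, rule summable_comparison_test'[OF summable_norm_exp[of z]])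
  fix k
  have "\<bar>f k\<bar> * (norm z ^ k / fact k) \<le> 1 * (norm z ^ k / fact k)" using f by (intro mult_right_mono) auto
  moreover have "norm (of_real (f k / fact k) * z ^ k) = \<bar>f k\<bar> * (norm z ^ k / fact k)"
    unfolding norm_mult norm_of_real norm_power by (simp add: abs_divide)
  moreover have "norm (z ^ k /\<^sub>R fact k) = norm z ^ k / fact k"
    by (simp add: norm_power divide_inverse mult.commute)
  ultimately show "norm (norm (of_real (f k / fact k) * z ^ k)) \<le> norm (z ^ k /\<^sub>R fact k)" by simp
qed

lemma poisson_transform_eq:
  assumes f: "\<And>k. \<bar>f k\<bar> \<le> 1"
  shows "poisson_transform f n z = exp (- of_nat n) * exp (- (z * of_real (sqrt (real n)))) *
    (\<Sum>k. of_real (f k / fact k) * (of_nat n * exp (z / of_real (sqrt (real n)))) ^ k)"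
proof -
  let ?w = "exp (z / of_real (sqrt (real n)))"
  have e: "complex_of_real (exp (- real n)) = exp (- of_nat n)" by (simp flip: exp_of_real)
  have "of_real (f k * poisson_weight n k) * exp (z * of_real (deviation n k)) =
     exp (- of_nat n) * exp (- (z * of_real (sqrt (real n)))) * (of_real (f k / fact k) * (of_nat n * ?w) ^ k)" for k
    unfolding exp_deviation by (simp add: poisson_weight_def e power_mult_distrib divide_inverse mult_ac)
  then show ?thesis
    unfolding poisson_transform_def by (simp only: suminf_mult[OF summable_bounded_exp[OF f]])
qed

lemma poisson_transform_holomorphic:
  assumes f: "\<And>k. \<bar>f k\<bar> \<le> 1"
  shows "poisson_transform f n holomorphic_on UNIV"
proof -
  define g where "g = Abs_fps (\<lambda>k. complex_of_real (f k / fact k))"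
  have rad: "fps_conv_radius g = \<infinity>"
    unfolding fps_conv_radius_def g_def
    by (intro conv_radius_inftyI'') (simp only: fps_nth_Abs_fps summable_bounded_exp[OF f])
  let ?s = "complex_of_real (sqrt (real n))"
  have "(eval_fps g \<circ> (\<lambda>z. of_nat n * exp (z * inverse ?s))) holomorphic_on UNIV"
    by (rule holomorphic_on_compose_gen[of _ _ _ UNIV]) (use rad in \<open>auto intro!: holomorphic_intros\<close>)
  then have "(\<lambda>z. eval_fps g (of_nat n * exp (z / ?s))) holomorphic_on UNIV"
    by (simp add: o_def divide_inverse)
  then have "(\<lambda>z. exp (- of_nat n) * exp (- (z * ?s)) * eval_fps g (of_nat n * exp (z / ?s))) holomorphic_on UNIV"
    by (intro holomorphic_intros)
  moreover have "poisson_transform f n = (\<lambda>z. exp (- of_nat n) * exp (- (z * ?s)) * eval_fps g (of_nat n * exp (z / ?s)))"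
    by (rule ext) (simp add: poisson_transform_eq[OF f] eval_fps_def g_def)
  ultimately show ?thesis by simp
qed

definition poisson_mean :: "(nat \<Rightarrow> real) \<Rightarrow> real \<Rightarrow> real" where
  "poisson_mean f \<theta> = exp (- \<theta>) * (\<Sum>k. f k / fact k * \<theta> ^ k)"

lemma poisson_transform_real:
  assumes f: "\<And>k. \<bar>f k\<bar> \<le> 1"
  shows "poisson_transform f n (of_real t) =
    of_real (exp (real n * (exp (t / sqrt (real n)) - 1 - t / sqrt (real n))) * poisson_mean f (real n * exp (t / sqrt (real n))))"
proof -
  let ?\<theta> = "real n * exp (t / sqrt (real n))"
  have \<theta>: "of_nat n * exp (complex_of_real t / of_real (sqrt (real n))) = of_real ?\<theta>"
    by (simp flip: exp_of_real)
  have "summable (\<lambda>k. f k / fact k * ?\<theta> ^ k)"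
    using summable_bounded_exp[of f ?\<theta>] f by simp
  then have "(\<Sum>k. complex_of_real (f k / fact k) * of_real ?\<theta> ^ k) = of_real (\<Sum>k. f k / fact k * ?\<theta> ^ k)"
    by (subst suminf_of_real) simp_all
  moreover have "exp (- of_nat n) * exp (- (complex_of_real t * of_real (sqrt (real n)))) =
      of_real (exp (- real n) * exp (- (t * sqrt (real n))))"
    by (simp flip: exp_of_real)
  ultimately have "poisson_transform f n (of_real t) = of_real (exp (- real n) * exp (- (t * sqrt (real n))) * (\<Sum>k. f k / fact k * ?\<theta> ^ k))"
    unfolding poisson_transform_eq[OF f] \<theta> by (simp only: of_real_mult)
  also have "exp (- real n) * exp (- (t * sqrt (real n))) =
      exp (real n * (exp (t / sqrt (real n)) - 1 - t / sqrt (real n))) * exp (- ?\<theta>)"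
    using poisson_exponent[of n t, symmetric] by (simp add: exp_minus field_simps)
  finally show ?thesis by (simp add: poisson_mean_def mult.assoc)
qed

text \<open>The factor exp (z^2 / 2) is the limit of the transform for f = 1, the central limit
  theorem for the Poisson law; the bound in terms of Re z comes from the boundedness of f.\<close>

lemma poisson_transform_limit:
  assumes f: "\<And>n k. \<bar>f n k\<bar> \<le> 1"
    and lim: "\<And>t. (\<lambda>n. poisson_mean (f n) (real n * exp (t / sqrt (real n)))) \<longlonglongrightarrow> c"
  shows "(\<lambda>n. poisson_transform (f n) n z) \<longlonglongrightarrow> of_real c * exp (z\<^sup>2 / 2)"
proof (rule vitali_entire[where B = "\<lambda>s. exp ((max 0 s)\<^sup>2 * exp (max 0 s))" and z = z
      and F = "\<lambda>n. poisson_transform (f n) n" and G = "\<lambda>z. of_real c * exp (z\<^sup>2 / 2)"])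
  show "cmod (poisson_transform (f n) n z) \<le> exp ((max 0 \<bar>Re z\<bar>)\<^sup>2 * exp (max 0 \<bar>Re z\<bar>))" for n z
  proof (rule order_trans[OF poisson_transform_summable(2)[OF f]])
    show "exp (real n * (exp (Re z / sqrt (real n)) - 1 - Re z / sqrt (real n))) \<le> exp ((max 0 \<bar>Re z\<bar>)\<^sup>2 * exp (max 0 \<bar>Re z\<bar>))"
      using poisson_exponent_bound[of n "Re z"] by simp
  qed
  show "exp ((max 0 s)\<^sup>2 * exp (max 0 s)) \<le> exp ((max 0 t)\<^sup>2 * exp (max 0 t))" if "s \<le> t" for s t :: real
    unfolding exp_le_cancel_iff using that by (intro mult_mono power_mono) auto
  show "(\<lambda>n. poisson_transform (f n) n (of_real t)) \<longlonglongrightarrow> of_real c * exp ((of_real t)\<^sup>2 / 2)" for t :: real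
  proof -
    have "(\<lambda>n. exp (real n * (exp (t / sqrt (real n)) - 1 - t / sqrt (real n))) *
       poisson_mean (f n) (real n * exp (t / sqrt (real n)))) \<longlonglongrightarrow> exp (t\<^sup>2 / 2) * c"
      by (intro tendsto_intros poisson_exponent_limit lim)
    from tendsto_of_real[OF this, where ?'a = complex]
    have "(\<lambda>n. poisson_transform (f n) n (of_real t)) \<longlonglongrightarrow> of_real (exp (t\<^sup>2 / 2) * c)"
      by (simp only: poisson_transform_real[OF f])
    moreover have "complex_of_real (exp (t\<^sup>2 / 2) * c) = of_real c * exp ((of_real t)\<^sup>2 / 2)"
      by (simp add: mult.commute flip: exp_of_real)
    ultimately show ?thesis by (simp only:)
  qed
qed (auto intro!: holomorphic_intros poisson_transform_holomorphic f)

section \<open>Gaussian averaging\<close>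

text \<open>The limit of the localised total mass; in closed form 1 / sqrt (1 + T^2).\<close>

definition gauss_factor :: "real \<Rightarrow> real" where
  "gauss_factor T = (\<integral>t. exp (- (T * t)\<^sup>2 / 2) \<partial>std_normal_distribution)"

text \<open>Averaging the oscillations on the imaginary axis over a normal variable gives its
  characteristic function, that is, a Gaussian cut-off in the deviation.\<close>

lemma gauss_average:
  assumes f: "\<And>k. \<bar>f k\<bar> \<le> 1"
  shows "(\<lambda>k. f k * poisson_weight n k * exp (- (T * deviation n k)\<^sup>2 / 2)) sums
    Re (\<integral>t. poisson_transform f n (\<i> * of_real (T * t)) \<partial>std_normal_distribution)"
proof -
  interpret real_distribution std_normal_distribution by (rule real_dist_normal_dist)
  let ?N = "std_normal_distribution"
  let ?a = "\<lambda>k. complex_of_real (f k * poisson_weight n k)"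
  let ?g = "\<lambda>k t. ?a k * iexp (T * deviation n k * t)"
  have e: "exp (\<i> * of_real (T * t) * of_real (deviation n k)) = iexp (T * deviation n k * t)" for k t
    by (simp add: mult_ac)
  have norm: "norm (?g k t) = \<bar>f k * poisson_weight n k\<bar>" for k t by (simp add: norm_mult abs_mult)
  have sn: "summable (\<lambda>k. \<bar>f k * poisson_weight n k\<bar>)"
    using poisson_transform_summable(1)[of f n 0] f by (simp add: abs_mult norm_mult)
  have int: "integrable ?N (?g k)" for k by (intro integrable_mult_right integrable_iexp) auto
  have "(\<lambda>k. \<integral>t. ?g k t \<partial>?N) sums (\<integral>t. (\<Sum>k. ?g k t) \<partial>?N)"
  proof (rule sums_integral[OF int])
    show "AE t in ?N. summable (\<lambda>k. norm (?g k t))" unfolding norm using sn by simp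
    show "summable (\<lambda>k. \<integral>t. norm (?g k t) \<partial>?N)" unfolding norm using sn prob_space by simp
  qed
  moreover have "(\<integral>t. ?g k t \<partial>?N) = of_real (f k * poisson_weight n k * exp (- (T * deviation n k)\<^sup>2 / 2))" for k
  proof -
    have "(\<integral>t. iexp (T * deviation n k * t) \<partial>?N) = char ?N (T * deviation n k)" by (simp add: char_def)
    then show ?thesis by (simp add: char_std_normal_distribution)
  qed
  moreover have "(\<Sum>k. ?g k t) = poisson_transform f n (\<i> * of_real (T * t))" for t
    unfolding poisson_transform_def e ..
  ultimately have "(\<lambda>k. complex_of_real (f k * poisson_weight n k * exp (- (T * deviation n k)\<^sup>2 / 2))) sums
     (\<integral>t. poisson_transform f n (\<i> * of_real (T * t)) \<partial>?N)" by (simp only:)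
  from sums_Re[OF this] show ?thesis by (simp only: Re_complex_of_real)
qed

text \<open>On the imaginary axis the transform is bounded by the total Poisson mass 1, which serves
  as dominating function.\<close>

lemma gauss_average_limit:
  assumes f: "\<And>n k. \<bar>f n k\<bar> \<le> 1"
    and lim: "\<And>t. (\<lambda>n. poisson_mean (f n) (real n * exp (t / sqrt (real n)))) \<longlonglongrightarrow> c"
  shows "(\<lambda>n. \<Sum>k. f n k * poisson_weight n k * exp (- (T * deviation n k)\<^sup>2 / 2)) \<longlonglongrightarrow> c * gauss_factor T"
proof -
  interpret real_distribution std_normal_distribution by (rule real_dist_normal_dist)
  let ?N = "std_normal_distribution"
  have cont: "continuous_on UNIV (\<lambda>t. poisson_transform (f n) n (\<i> * of_real (T * t)))" for n
  proof -
    have "continuous_on UNIV (poisson_transform (f n) n)"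
      by (intro holomorphic_on_imp_continuous_on poisson_transform_holomorphic f)
    then show ?thesis by (rule continuous_on_compose2) (auto intro!: continuous_intros)
  qed
  have "(\<lambda>n. \<integral>t. poisson_transform (f n) n (\<i> * of_real (T * t)) \<partial>?N) \<longlonglongrightarrow>
      (\<integral>t. complex_of_real (c * exp (- (T * t)\<^sup>2 / 2)) \<partial>?N)"
  proof (rule integral_dominated_convergence[where w = "\<lambda>t. 1"])
    show "(\<lambda>t. poisson_transform (f n) n (\<i> * of_real (T * t))) \<in> borel_measurable ?N" for n
      using borel_measurable_continuous_onI[OF cont[of n]] by simp
    show "AE t in ?N. (\<lambda>n. poisson_transform (f n) n (\<i> * of_real (T * t))) \<longlonglongrightarrow> complex_of_real (c * exp (- (T * t)\<^sup>2 / 2))"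
    proof (rule AE_I2)
      fix t :: real
      have "(\<i> * complex_of_real (T * t))\<^sup>2 / 2 = of_real (- (T * t)\<^sup>2 / 2)" by (simp add: power_mult_distrib)
      then have "of_real c * exp ((\<i> * of_real (T * t))\<^sup>2 / 2) = complex_of_real (c * exp (- (T * t)\<^sup>2 / 2))"
        by (simp only: exp_of_real of_real_mult)
      then show "(\<lambda>n. poisson_transform (f n) n (\<i> * of_real (T * t))) \<longlonglongrightarrow> complex_of_real (c * exp (- (T * t)\<^sup>2 / 2))"
        using poisson_transform_limit[OF f lim, of "\<i> * of_real (T * t)"] by (simp only:)
    qed
    show "AE t in ?N. norm (poisson_transform (f n) n (\<i> * of_real (T * t))) \<le> 1" for n
    proof (rule AE_I2)
      fix t :: real
      show "norm (poisson_transform (f n) n (\<i> * of_real (T * t))) \<le> 1"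
        using poisson_transform_summable(2)[of "f n" n "\<i> * of_real (T * t)"] f by simp
    qed
  qed auto
  from tendsto_Re[OF this]
  have "(\<lambda>n. Re (\<integral>t. poisson_transform (f n) n (\<i> * of_real (T * t)) \<partial>?N)) \<longlonglongrightarrow> c * gauss_factor T"
    by (simp only: integral_complex_of_real Re_complex_of_real integral_mult_right_zero gauss_factor_def)
  moreover have "(\<Sum>k. f n k * poisson_weight n k * exp (- (T * deviation n k)\<^sup>2 / 2)) =
      Re (\<integral>t. poisson_transform (f n) n (\<i> * of_real (T * t)) \<partial>?N)" for n
    using gauss_average[of "f n" n T] f by (simp add: sums_iff)
  ultimately show ?thesis by simp
qed

text \<open>On |t| <= 1 / T, an interval of length 2 / T, the integrand stays above a
  constant.\<close>

lemma gauss_factor_lower: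
  obtains \<kappa> where "\<kappa> > 0" "\<And>T. T \<ge> 1 \<Longrightarrow> gauss_factor T \<ge> \<kappa> / T"
proof (rule that)
  let ?\<kappa> = "2 * (std_normal_density 1 * exp (- 1 / 2))"
  show "?\<kappa> > 0" by (simp add: normal_density_pos)
  fix T :: real assume T: "T \<ge> 1"
  interpret real_distribution std_normal_distribution by (rule real_dist_normal_dist)
  have int: "integrable std_normal_distribution (\<lambda>t. exp (- (T * t)\<^sup>2 / 2))"
    by (rule integrable_const_bound[of _ 1]) auto
  then have int': "integrable lborel (\<lambda>t. std_normal_density t * exp (- (T * t)\<^sup>2 / 2))"
    by (subst (asm) integrable_density) auto
  have "?\<kappa> / T = (\<integral>t. indicator {- 1 / T..1 / T} t *\<^sub>R (std_normal_density 1 * exp (- 1 / 2)) \<partial>lborel)"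
    using T by simp
  also have "\<dots> \<le> (\<integral>t. std_normal_density t * exp (- (T * t)\<^sup>2 / 2) \<partial>lborel)"
  proof (rule integral_mono)
    have "integrable lborel (indicator {- 1 / T..1 / T} :: real \<Rightarrow> real)"
      using T by (intro integrable_real_indicator) auto
    then show "integrable lborel (\<lambda>t. indicator {- 1 / T..1 / T} t *\<^sub>R (std_normal_density 1 * exp (- 1 / 2)))"
      by (rule integrable_scaleR_left)
    fix t :: real
    show "indicator {- 1 / T..1 / T} t *\<^sub>R (std_normal_density 1 * exp (- 1 / 2)) \<le> std_normal_density t * exp (- (T * t)\<^sup>2 / 2)"
    proof (cases "t \<in> {- 1 / T..1 / T}")
      case True
      then have "\<bar>t\<bar> \<le> 1 / T" by auto
      then have Tt: "\<bar>T * t\<bar> \<le> 1" using T by (simp add: abs_mult pos_le_divide_eq mult.commute)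
      have "1 / T \<le> 1" using T by simp
      then have "\<bar>t\<bar> \<le> 1" using \<open>\<bar>t\<bar> \<le> 1 / T\<close> by linarith
      then have "t\<^sup>2 \<le> 1" "(T * t)\<^sup>2 \<le> 1" using Tt by (simp_all only: abs_square_le_1)
      then have "std_normal_density 1 \<le> std_normal_density t" "exp (- 1 / 2) \<le> exp (- (T * t)\<^sup>2 / 2)"
        by (auto simp: std_normal_density_def divide_right_mono)
      then have "std_normal_density 1 * exp (- 1 / 2) \<le> std_normal_density t * exp (- (T * t)\<^sup>2 / 2)"
        by (intro mult_mono) (auto simp: normal_density_nonneg)
      then show ?thesis using True by simp
    next
      case False
      then show ?thesis by (simp add: normal_density_nonneg)
    qed
  qed (rule int')
  also have "\<dots> = gauss_factor T"
    unfolding gauss_factor_def by (subst integral_density) auto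
  finally show "gauss_factor T \<ge> ?\<kappa> / T" .
qed

text \<open>In T the cut-off at distance \<delta> decays like a Gaussian, the mass that is kept only
  like 1 / T.\<close>

lemma gauss_factor_dominates:
  assumes "\<delta> > 0" "\<epsilon> > 0"
  obtains T where "gauss_factor T > 0" "exp (- (T * \<delta>)\<^sup>2 / 2) \<le> \<epsilon> * gauss_factor T"
proof -
  obtain \<kappa> where \<kappa>: "\<kappa> > 0" "\<And>T. T \<ge> 1 \<Longrightarrow> gauss_factor T \<ge> \<kappa> / T" using gauss_factor_lower by blast
  have "((\<lambda>T. T * exp (- (T * \<delta>)\<^sup>2 / 2)) \<longlongrightarrow> 0) at_top" using assms(1) by real_asymp
  then have "eventually (\<lambda>T. T * exp (- (T * \<delta>)\<^sup>2 / 2) < \<epsilon> * \<kappa>) at_top"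
    using \<kappa>(1) assms(2) by (intro order_tendstoD(2)) auto
  then have "eventually (\<lambda>T. T * exp (- (T * \<delta>)\<^sup>2 / 2) < \<epsilon> * \<kappa> \<and> T \<ge> 1) at_top"
    using eventually_ge_at_top[of 1] by eventually_elim auto
  then obtain T where T: "T * exp (- (T * \<delta>)\<^sup>2 / 2) < \<epsilon> * \<kappa>" "T \<ge> 1"
    using eventually_happens'[OF trivial_limit_at_top_linorder] by blast
  have "exp (- (T * \<delta>)\<^sup>2 / 2) \<le> \<epsilon> * (\<kappa> / T)" using T by (simp add: pos_le_divide_eq mult.commute)
  also have "\<dots> \<le> \<epsilon> * gauss_factor T" using \<kappa>(2)[OF T(2)] assms(2) by (intro mult_left_mono) auto
  finally have "exp (- (T * \<delta>)\<^sup>2 / 2) \<le> \<epsilon> * gauss_factor T" .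
  moreover have "0 < \<kappa> / T" using \<kappa>(1) T(2) by simp
  then have "gauss_factor T > 0" using \<kappa>(2)[OF T(2)] by linarith
  ultimately show thesis by (intro that)
qed

text \<open>All indices between k and n are at least n / 4, where one step changes g by at most 2 *
  L / sqrt n, and there are at most \<delta> * sqrt n steps.\<close>

lemma lipschitz_sqrt_near:
  fixes g :: "nat \<Rightarrow> real"
  assumes lip: "\<And>k. \<bar>g (Suc k) - g k\<bar> \<le> L / sqrt (real (Suc k))" and "L \<ge> 0"
    and near: "\<bar>real k - real n\<bar> \<le> \<delta> * sqrt (real n)" and \<delta>: "0 \<le> \<delta>" "\<delta> \<le> 1 / 2" and n: "n > 0"
  shows "\<bar>g k - g n\<bar> \<le> 2 * L * \<delta>"
proof -
  have sq: "sqrt (real n) \<le> real n" using n by (intro real_le_lsqrt) (auto simp: power2_eq_square)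
  have chain: "\<bar>g (m + j) - g m\<bar> \<le> real j * (2 * L / sqrt (real n))" if m: "real n / 4 \<le> real m" for m j
  proof (induction j)
    case (Suc j)
    have "sqrt (real n / 4) \<le> sqrt (real (Suc (m + j)))" using m by (intro real_sqrt_le_mono) auto
    then have "sqrt (real n) / 2 \<le> sqrt (real (Suc (m + j)))" by (simp add: real_sqrt_divide)
    then have "L / sqrt (real (Suc (m + j))) \<le> L / (sqrt (real n) / 2)"
      using n \<open>L \<ge> 0\<close> by (intro divide_left_mono mult_pos_pos) auto
    also have "\<dots> = 2 * L / sqrt (real n)" by simp
    finally have "\<bar>g (Suc (m + j)) - g (m + j)\<bar> \<le> 2 * L / sqrt (real n)"
      using lip[of "m + j"] by linarith
    moreover have "real (Suc j) * u = real j * u + u" for u by (simp add: algebra_simps)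
    note this[of "2 * L / sqrt (real n)"]
    ultimately show ?case using Suc unfolding add_Suc_right by linarith
  qed simp
  have main: "\<bar>real k - real n\<bar> * (2 * L / sqrt (real n)) \<le> 2 * L * \<delta>"
  proof -
    have "\<bar>real k - real n\<bar> * (2 * L / sqrt (real n)) \<le> (\<delta> * sqrt (real n)) * (2 * L / sqrt (real n))"
      using near \<open>L \<ge> 0\<close> by (intro mult_right_mono) auto
    then show ?thesis using n by (simp add: mult_ac)
  qed
  have "\<delta> * sqrt (real n) \<le> 1 / 2 * real n" using sq \<delta> by (intro mult_mono) auto
  then have k: "real n / 4 \<le> real k" using near by linarith
  show ?thesis
  proof (cases "n \<le> k")
    case True
    then show ?thesis using chain[of n "k - n"] main by (simp add: of_nat_diff)
  next
    case False
    then show ?thesis using chain[of k "n - k"] main k by (simp add: of_nat_diff abs_minus_commute)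
  qed
qed

text \<open>The first index of f stands for the configuration, the second for the size of the
  diagrams: Poisson means are taken with the configuration frozen, and the conclusion concerns the
  diagonal. The value f n n is compared with the ratio of the Gaussian averages of f n and of
  1.\<close>

theorem depoissonization:
  fixes f :: "nat \<Rightarrow> nat \<Rightarrow> real"
  assumes f: "\<And>n k. 0 \<le> f n k" "\<And>n k. f n k \<le> 1"
    and lip: "\<And>n k. \<bar>f n (Suc k) - f n k\<bar> \<le> L / sqrt (real (Suc k))"
    and lim: "\<And>t. (\<lambda>n. poisson_mean (f n) (real n * exp (t / sqrt (real n)))) \<longlonglongrightarrow> c"
  shows "(\<lambda>n. f n n) \<longlonglongrightarrow> c"
proof (rule tendstoI)
  fix \<epsilon> :: real assume \<epsilon>: "\<epsilon> > 0"
  have f1: "\<bar>f n k\<bar> \<le> 1" for n k using f by simp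
  have L: "L \<ge> 0" using order_trans[OF abs_ge_zero lip[of 0 0]] by simp
  \<comment> \<open>Chosen to make the Lipschitz error at most \<epsilon> / 8; L + 1 avoids division
    by zero when L = 0.\<close>
  define \<delta> where "\<delta> = min (1 / 2) (\<epsilon> / (16 * (L + 1)))"
  have \<delta>: "0 < \<delta>" "\<delta> \<le> 1 / 2"
    using \<epsilon> L min.cobounded1[of "1 / 2" "\<epsilon> / (16 * (L + 1))"] by (simp_all add: \<delta>_def)
  have "2 * L * \<delta> \<le> 2 * (L + 1) * (\<epsilon> / (16 * (L + 1)))"
    using L \<epsilon> by (intro mult_mono) (auto simp: \<delta>_def)
  also have "\<dots> = \<epsilon> / 8" using L by (simp add: field_simps)
  finally have L\<delta>: "2 * L * \<delta> \<le> \<epsilon> / 8" .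
  have "\<epsilon> / 16 > 0" using \<epsilon> by simp
  from gauss_factor_dominates[OF \<delta>(1) this]
  obtain T where T: "gauss_factor T > 0" "exp (- (T * \<delta>)\<^sup>2 / 2) \<le> \<epsilon> / 16 * gauss_factor T" .
  define w where "w n k = poisson_weight n k * exp (- (T * deviation n k)\<^sup>2 / 2)" for n k
  define E where "E = exp (- (T * \<delta>)\<^sup>2 / 2)"
  let ?g = "gauss_factor T"
  have one: "poisson_mean (\<lambda>k. 1) \<theta> = 1" for \<theta>
  proof -
    have "(\<Sum>k. 1 / fact k * \<theta> ^ k) = exp \<theta>" by (simp add: exp_def divide_inverse)
    then show ?thesis by (simp add: poisson_mean_def flip: exp_add)
  qed
  have pw: "poisson_weight n sums 1" for n
    using poisson_tilted_sums[of n 0] by simp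
  have w_le: "0 \<le> w n k" "w n k \<le> poisson_weight n k" for n k
    by (auto simp: w_def poisson_weight_nonneg intro!: mult_left_le)
  have sw: "summable (w n)" for n
    by (rule summable_comparison_test'[OF sums_summable[OF pw]]) (use w_le in auto)
  have fw: "\<bar>f n k * w n k\<bar> \<le> 1 * w n k" for n k
  proof -
    have "\<bar>f n k * w n k\<bar> = \<bar>f n k\<bar> * w n k" using w_le(1)[of n k] by (simp add: abs_mult)
    also have "\<dots> \<le> 1 * w n k" using f1 w_le(1) by (intro mult_right_mono) auto
    finally show ?thesis .
  qed
  have sf: "summable (\<lambda>k. f n k * w n k)" for n
    by (rule summable_comparison_test'[OF sw]) (use fw in auto)
  have lim1: "(\<lambda>n. \<Sum>k. f n k * w n k) \<longlonglongrightarrow> c * ?g"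
    using gauss_average_limit[OF f1 lim, of T] by (simp add: mult.assoc w_def)
  have lim2: "(\<lambda>n. suminf (w n)) \<longlonglongrightarrow> 1 * ?g"
    using gauss_average_limit[of "\<lambda>n k. 1" 1 T] one by (simp add: w_def[abs_def])
  have "(\<lambda>n. (\<Sum>k. f n k * w n k) - c * suminf (w n)) \<longlonglongrightarrow> c * ?g - c * (1 * ?g)"
    by (intro tendsto_intros lim1 lim2)
  then have "(\<lambda>n. (\<Sum>k. f n k * w n k) - c * suminf (w n)) \<longlonglongrightarrow> 0" by simp
  moreover have "\<epsilon> / 16 * ?g > 0" using \<epsilon> T by simp
  ultimately have ev1: "eventually (\<lambda>n. dist ((\<Sum>k. f n k * w n k) - c * suminf (w n)) 0 < \<epsilon> / 16 * ?g) sequentially"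
    by (rule tendstoD)
  have ev2: "eventually (\<lambda>n. suminf (w n) > ?g / 2) sequentially"
    using lim2 T(1) by (intro order_tendstoD(1)) auto
  show "eventually (\<lambda>n. dist (f n n) c < \<epsilon>) sequentially"
    using ev1 ev2 eventually_gt_at_top[of 0]
  proof eventually_elim
    case (elim n)
    define W where "W = suminf (w n)"
    define A where "A = (\<Sum>k. f n k * w n k)"
    have W: "W > ?g / 2" "W > 0" using elim T by (auto simp: W_def)
    \<comment> \<open>Within \<delta> * sqrt n of n the Lipschitz bound applies; further out the
      Gaussian factor is at most E and the values of f differ by at most 1.\<close>
    have tm: "\<bar>(f n k - f n n) * w n k\<bar> \<le> \<epsilon> / 8 * w n k + E * poisson_weight n k" for k
    proof -
      have abs: "\<bar>(f n k - f n n) * w n k\<bar> = \<bar>f n k - f n n\<bar> * w n k" using w_le(1)[of n k] by (simp add: abs_mult)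
      show ?thesis
      proof (cases "\<bar>real k - real n\<bar> \<le> \<delta> * sqrt (real n)")
        case True
        then have "\<bar>f n k - f n n\<bar> \<le> 2 * L * \<delta>" using \<delta> elim L by (intro lipschitz_sqrt_near lip) auto
        then have "\<bar>f n k - f n n\<bar> * w n k \<le> \<epsilon> / 8 * w n k"
          using L\<delta> w_le(1) by (intro mult_right_mono) auto
        moreover have "0 \<le> E * poisson_weight n k" by (simp add: E_def poisson_weight_nonneg)
        ultimately show ?thesis unfolding abs by linarith
      next
        case False
        then have "\<delta> \<le> \<bar>deviation n k\<bar>" using elim by (simp add: deviation_def abs_divide pos_le_divide_eq)
        then have "\<delta>\<^sup>2 \<le> (deviation n k)\<^sup>2" using \<delta> by (metis abs_le_square_iff abs_of_pos)
        then have "T\<^sup>2 * \<delta>\<^sup>2 \<le> T\<^sup>2 * (deviation n k)\<^sup>2" by (intro mult_left_mono) auto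
        then have "exp (- (T * deviation n k)\<^sup>2 / 2) \<le> E" by (simp add: power_mult_distrib E_def)
        then have "w n k \<le> E * poisson_weight n k"
          unfolding w_def by (subst mult.commute) (intro mult_right_mono poisson_weight_nonneg)
        moreover have "\<bar>f n k - f n n\<bar> * w n k \<le> 1 * w n k"
          using f[of n k] f[of n n] w_le(1) by (intro mult_right_mono) auto
        moreover have "0 \<le> \<epsilon> / 8 * w n k" using \<epsilon> w_le(1)[of n k] by simp
        ultimately show ?thesis unfolding abs by linarith
      qed
    qed
    have s1: "(\<lambda>k. \<epsilon> / 8 * w n k + E * poisson_weight n k) sums (\<epsilon> / 8 * W + E * 1)"
      unfolding W_def by (intro sums_add sums_mult summable_sums sw pw)
    have s2: "(\<lambda>k. (f n k - f n n) * w n k) sums (A - f n n * W)"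
      unfolding left_diff_distrib W_def A_def by (intro sums_diff sums_mult summable_sums sf sw)
    have s3: "summable (\<lambda>k. \<bar>(f n k - f n n) * w n k\<bar>)"
      by (rule summable_comparison_test'[OF sums_summable[OF s1]]) (use tm in auto)
    then have "\<bar>\<Sum>k. (f n k - f n n) * w n k\<bar> \<le> (\<Sum>k. \<bar>(f n k - f n n) * w n k\<bar>)" by (rule summable_rabs)
    also have "\<dots> \<le> (\<Sum>k. \<epsilon> / 8 * w n k + E * poisson_weight n k)"
      by (intro suminf_le tm sums_summable[OF s1] s3)
    finally have 1: "\<bar>A - f n n * W\<bar> \<le> \<epsilon> / 8 * W + E"
      using s1 s2 by (simp add: sums_iff)
    have 2: "\<epsilon> / 16 * ?g \<le> \<epsilon> / 8 * W" using W(1) \<epsilon> by simp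
    have 3: "\<bar>A - c * W\<bar> \<le> \<epsilon> / 8 * W"
      using elim(1) 2 by (simp add: A_def W_def)
    have "E \<le> \<epsilon> / 8 * W" using T(2) 2 by (simp add: E_def)
    with 1 3 have "\<bar>f n n * W - c * W\<bar> \<le> 3 * (\<epsilon> / 8 * W)" by linarith
    moreover have "\<bar>f n n * W - c * W\<bar> = \<bar>f n n - c\<bar> * W"
      using W(2) by (simp add: abs_mult flip: left_diff_distrib)
    ultimately have "\<bar>f n n - c\<bar> * W \<le> (\<epsilon> * 3 / 8) * W" by simp
    then have "\<bar>f n n - c\<bar> \<le> \<epsilon> * 3 / 8" using W(2) by (simp only: mult_le_cancel_right_pos)
    then show ?case using \<epsilon> by (simp add: dist_real_def)
  qed
qed

section \<open>Limits of the Plancherel correlations\<close>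

lemma leibniz_reindex:
  assumes "bij_betw e A B" "finite A"
  shows "leibniz B F = leibniz A (\<lambda>i j. F (e i) (e j))"
proof -
  have inj: "inj_on e A" and B: "e ` A = B" using assms(1) by (auto simp: bij_betw_def)
  note bij' = bij_betw_inv_into[OF assms(1)]
  have "leibniz A (\<lambda>i j. F (e i) (e j)) = leibniz B F"
    unfolding leibniz_def
  proof (rule sum.reindex_bij_witness[where j = "map_permutation A e" and i = "map_permutation B (inv_into A e)"])
    fix p assume "p \<in> {p. p permutes A}"
    then have p: "p permutes A" by simp
    show "map_permutation B (inv_into A e) (map_permutation A e p) = p"
      by (rule map_permutation_compose_inv[OF assms(1) p]) (use inj in auto)
    show "map_permutation A e p \<in> {p. p permutes B}"
      using map_permutation_permutes[OF assms(1) p] by simp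
    have "(\<Prod>i\<in>B. F i (map_permutation A e p i)) = (\<Prod>i\<in>A. F (e i) (map_permutation A e p (e i)))"
      by (subst prod.reindex_bij_betw[OF assms(1), symmetric]) simp
    also have "\<dots> = (\<Prod>i\<in>A. F (e i) (e (p i)))"
      by (intro prod.cong) (auto simp: map_permutation_apply inj)
    finally show "of_int (sign (map_permutation A e p)) * (\<Prod>i\<in>B. F i (map_permutation A e p i)) =
        of_int (sign p) * (\<Prod>i\<in>A. F (e i) (e (p i)))"
      using sign_map_permutation[OF inj p assms(2)] by simp
  next
    fix q assume "q \<in> {p. p permutes B}"
    then have q: "q permutes B" by simp
    show "map_permutation A e (map_permutation B (inv_into A e) q) = q"
      by (rule map_permutation_compose_inv[OF bij' q]) (use f_inv_into_f[of _ e A] B in auto)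
    show "map_permutation B (inv_into A e) q \<in> {p. p permutes A}"
      using map_permutation_permutes[OF bij' q] by simp
  qed
  then show ?thesis by simp
qed

lemma leibniz_cong:
  assumes "\<And>i j. i \<in> I \<Longrightarrow> j \<in> I \<Longrightarrow> A i j = B i j"
  shows "leibniz I A = leibniz I B"
proof -
  have "A i (p i) = B i (p i)" if "p permutes I" "i \<in> I" for p i
    using assms permutes_in_image[OF that(1), of i] that(2) by auto
  then show ?thesis unfolding leibniz_def by (auto intro!: sum.cong prod.cong)
qed

lemma permutes_restrict:
  assumes p: "p permutes A" and "B \<subseteq> A" "finite A" "p ` B \<subseteq> B"
  shows "(\<lambda>x. if x \<in> B then p x else x) permutes B"
proof (rule bij_imp_permutes)
  have "inj_on p B" using permutes_inj[OF p] by (rule inj_on_subset) simp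
  moreover have "finite B" using assms finite_subset by blast
  ultimately have "bij_betw p B B" using endo_inj_surj[of B p] assms(4) by (simp add: bij_betw_def)
  then show "bij_betw (\<lambda>x. if x \<in> B then p x else x) B B" by (subst bij_betw_cong[of _ _ p]) auto
qed auto

text \<open>A permutation sending a point of I into J contributes 0 already when one off-diagonal
  block vanishes. The others map I into itself, hence by finiteness also J, and are products of a
  permutation of I and one of J.\<close>

lemma leibniz_block:
  fixes A :: "'i \<Rightarrow> 'i \<Rightarrow> 'a :: idom"
  assumes fin: "finite I" "finite J" and disj: "I \<inter> J = {}"
    and zero: "\<And>i j. i \<in> I \<Longrightarrow> j \<in> J \<Longrightarrow> A i j = 0"
  shows "leibniz (I \<union> J) A = leibniz I A * leibniz J A"
proof -
  let ?P = "{p. p permutes (I \<union> J) \<and> p ` I \<subseteq> I}"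
  let ?t = "\<lambda>I p. of_int (sign p) * (\<Prod>i\<in>I. A i (p i))"
  let ?r = "\<lambda>B p x. if x \<in> B then p x else x"
  have vanish: "(\<Prod>i\<in>I \<union> J. A i (p i)) = 0" if p: "p permutes (I \<union> J)" "\<not> p ` I \<subseteq> I" for p
  proof -
    obtain i where i: "i \<in> I" "p i \<notin> I" using p(2) by auto
    then have "p i \<in> J" using permutes_in_image[OF p(1), of i] by auto
    then have "A i (p i) = 0" using zero i by auto
    then show ?thesis using fin i by (intro prod_zero) auto
  qed
  have P: "p ` J \<subseteq> J" if "p \<in> ?P" for p
  proof -
    have "inj p" using that permutes_inj by auto
    then have "p ` I = I" using that fin(1) by (intro endo_inj_surj) (auto intro: inj_on_subset)
    then show ?thesis using that \<open>inj p\<close> disj permutes_in_image[of p "I \<union> J"] by (auto dest: injD) (metis IntI Un_iff disj empty_iff image_iff injD)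
  qed
  have "leibniz (I \<union> J) A = (\<Sum>p\<in>?P. ?t (I \<union> J) p)"
    unfolding leibniz_def
    by (rule sum.mono_neutral_right) (use fin vanish in \<open>auto simp: finite_permutations\<close>)
  also have "\<dots> = (\<Sum>(p, q)\<in>{p. p permutes I} \<times> {q. q permutes J}. ?t I p * ?t J q)"
  proof (rule sum.reindex_bij_witness[where i = "\<lambda>(p, q). p \<circ> q" and j = "\<lambda>p. (?r I p, ?r J p)"])
    fix p assume p: "p \<in> ?P"
    have pI: "?r I p permutes I" and pJ: "?r J p permutes J"
      using p P[OF p] fin by (auto intro!: permutes_restrict[of p "I \<union> J"])
    show "(?r I p, ?r J p) \<in> {p. p permutes I} \<times> {q. q permutes J}" using pI pJ by simp
    have comp: "?r I p \<circ> ?r J p = p"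
    proof
      fix x
      show "(?r I p \<circ> ?r J p) x = p x"
        using p P[OF p] disj permutes_not_in[of p "I \<union> J" x] by auto
    qed
    then show "(\<lambda>(p, q). p \<circ> q) (?r I p, ?r J p) = p" by simp
    have "permutation (?r I p)" "permutation (?r J p)"
      using pI pJ fin by (auto simp: permutation_permutes)
    then have "sign p = sign (?r I p) * sign (?r J p)" using sign_compose comp by metis
    moreover have "(\<Prod>i\<in>I \<union> J. A i (p i)) = (\<Prod>i\<in>I. A i (?r I p i)) * (\<Prod>i\<in>J. A i (?r J p i))"
      using fin disj by (simp add: prod.union_disjoint)
    ultimately show "(\<lambda>(p, q). ?t I p * ?t J q) (?r I p, ?r J p) = ?t (I \<union> J) p"
      by (simp add: mult_ac)
  next
    fix u assume "u \<in> {p. p permutes I} \<times> {q. q permutes J}"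
    then obtain p q where u: "u = (p, q)" "p permutes I" "q permutes J" by auto
    have qI: "q x = x" if "x \<in> I" for x using u(3) that disj by (auto intro: permutes_not_in)
    have pJ: "p x = x" if "x \<in> J" for x using u(2) that disj by (auto intro: permutes_not_in)
    have mem: "p x \<in> I \<longleftrightarrow> x \<in> I" "q x \<in> J \<longleftrightarrow> x \<in> J" for x
      using u permutes_in_image by metis+
    have "p \<circ> q permutes (I \<union> J)"
      by (rule permutes_compose[OF permutes_subset[OF u(3)] permutes_subset[OF u(2)]]) auto
    then show "(\<lambda>(p, q). p \<circ> q) u \<in> ?P" using u(1) qI mem by auto
    show "(?r I ((\<lambda>(p, q). p \<circ> q) u), ?r J ((\<lambda>(p, q). p \<circ> q) u)) = u"
      using u qI pJ mem permutes_not_in[OF u(2)] permutes_not_in[OF u(3)] by (auto simp: fun_eq_iff)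
  qed
  also have "\<dots> = leibniz I A * leibniz J A"
    by (simp add: leibniz_def sum_product sum.cartesian_product)
  finally show ?thesis .
qed

section \<open>From power series to functions of r\<close>

lemma conv_radius_infinity_add:
  "fps_conv_radius f = \<infinity> \<Longrightarrow> fps_conv_radius g = \<infinity> \<Longrightarrow> fps_conv_radius (f + g) = \<infinity>"
  using fps_conv_radius_add[of f g] by simp

lemma conv_radius_infinity_mult:
  "fps_conv_radius f = \<infinity> \<Longrightarrow> fps_conv_radius g = \<infinity> \<Longrightarrow> fps_conv_radius (f * g) = \<infinity>"
  for f g :: "real fps"
  using fps_conv_radius_mult[of f g] by simp

lemma eval_fps_sum_entire:
  fixes f :: "'i \<Rightarrow> real fps"
  assumes "\<And>i. i \<in> I \<Longrightarrow> fps_conv_radius (f i) = \<infinity>"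
  shows "fps_conv_radius (\<Sum>i\<in>I. f i) = \<infinity> \<and> eval_fps (\<Sum>i\<in>I. f i) r = (\<Sum>i\<in>I. eval_fps (f i) r)"
  using assms
  by (induction I rule: infinite_finite_induct) (auto simp: conv_radius_infinity_add eval_fps_add)

lemma eval_fps_prod_entire:
  fixes f :: "'i \<Rightarrow> real fps"
  assumes "\<And>i. i \<in> I \<Longrightarrow> fps_conv_radius (f i) = \<infinity>"
  shows "fps_conv_radius (\<Prod>i\<in>I. f i) = \<infinity> \<and> eval_fps (\<Prod>i\<in>I. f i) r = (\<Prod>i\<in>I. eval_fps (f i) r)"
  using assms
  by (induction I rule: infinite_finite_induct) (auto simp: conv_radius_infinity_mult eval_fps_mult)

lemma eval_det_fps:
  "fps_conv_radius (det_fps s x y) = \<infinity> \<and> eval_fps (det_fps s x y) r = leibniz {..<s} (\<lambda>i j. bkernel (x i) (y j) r)"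
proof -
  have prod: "fps_conv_radius (\<Prod>i<s. kernel_fps (x i) (y (p i))) = \<infinity>"
    "eval_fps (\<Prod>i<s. kernel_fps (x i) (y (p i))) r = (\<Prod>i<s. bkernel (x i) (y (p i)) r)" for p
    using eval_fps_prod_entire[of "{..<s}" "\<lambda>i. kernel_fps (x i) (y (p i))" r] by (auto simp: bkernel_def)
  have c: "fps_conv_radius (of_int m * f) = \<infinity>" "eval_fps (of_int m * f) r = of_int m * eval_fps f r"
    if "fps_conv_radius f = \<infinity>" for m and f :: "real fps"
    using that by (simp_all add: conv_radius_infinity_mult eval_fps_mult flip: fps_of_int)
  show ?thesis
    unfolding det_fps_def leibniz_def
    using eval_fps_sum_entire[of "{p. p permutes {..<s}}" "\<lambda>p. of_int (sign p) * (\<Prod>i<s. kernel_fps (x i) (y (p i)))" r]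
    by (simp add: c prod)
qed

text \<open>Only equal numbers of lowerings and raisings contribute, so the series is even, with
  coefficient rho / k! at r^(2k).\<close>

lemma corr_fps_same:
  assumes "distinct xs"
  shows "fps_conv_radius (corr_fps xs xs) = \<infinity>"
    and "eval_fps (corr_fps xs xs) r = exp (r\<^sup>2) * poisson_mean (\<lambda>k. rho k (set xs)) (r\<^sup>2)"
proof -
  let ?f = "\<lambda>k. rho k (set xs)"
  have even: "fps_nth (corr_fps xs xs) (2 * k) = ?f k / fact k" for k
  proof -
    have "fps_nth (corr_fps xs xs) (2 * k) = (\<Sum>i\<le>2 * k. if i = k then ?f k / fact k else 0)"
      unfolding corr_fps_def fps_nth_Abs_fps by (intro sum.cong) (auto simp: corr_same[OF assms])
    then show ?thesis by simp
  qed
  have odd: "fps_nth (corr_fps xs xs) j = 0" if "j \<notin> range (\<lambda>k. 2 * k)" for j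
  proof -
    have "i \<noteq> j - i" if "i \<le> j" for i
      using that \<open>j \<notin> range (\<lambda>k. 2 * k)\<close> by (auto simp: image_iff) (metis add_diff_cancel_right' le_add_diff_inverse mult_2)
    then show ?thesis
      unfolding corr_fps_def fps_nth_Abs_fps by (intro sum.neutral) (auto simp: corr_same[OF assms])
  qed
  have mono: "strict_mono (\<lambda>k::nat. 2 * k)" by (auto simp: strict_mono_def)
  have b: "\<bar>?f k\<bar> \<le> 1" for k using rho_nonneg[of k "set xs"] rho_le_1[of k "set xs"] by simp
  have s: "summable (\<lambda>k. ?f k / fact k * (z\<^sup>2) ^ k)" for z :: real
    using summable_bounded_exp[of ?f "z\<^sup>2"] b by simp
  have eq: "fps_nth (corr_fps xs xs) (2 * k) * z ^ (2 * k) = ?f k / fact k * (z\<^sup>2) ^ k" for z :: real and k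
    unfolding even by (simp add: power_mult)
  have sums: "(\<lambda>j. fps_nth (corr_fps xs xs) j * z ^ j) sums (\<Sum>k. ?f k / fact k * (z\<^sup>2) ^ k)" for z :: real
  proof (subst sums_mono_reindex[OF mono, symmetric])
    show "fps_nth (corr_fps xs xs) j * z ^ j = 0" if "j \<notin> range (\<lambda>k. 2 * k)" for j
      using odd[OF that] by simp
    show "(\<lambda>k. fps_nth (corr_fps xs xs) (2 * k) * z ^ (2 * k)) sums (\<Sum>k. ?f k / fact k * (z\<^sup>2) ^ k)"
      unfolding eq using s by (rule summable_sums)
  qed
  show "fps_conv_radius (corr_fps xs xs) = \<infinity>"
    unfolding fps_conv_radius_def by (intro conv_radius_inftyI'' sums_summable[OF sums])
  have "eval_fps (corr_fps xs xs) r = (\<Sum>k. ?f k / fact k * (r\<^sup>2) ^ k)"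
    unfolding eval_fps_def using sums[of r] by (simp add: sums_iff)
  then show "eval_fps (corr_fps xs xs) r = exp (r\<^sup>2) * poisson_mean ?f (r\<^sup>2)"
    by (simp add: poisson_mean_def exp_minus)
qed

theorem poissonized_determinantal:
  fixes x :: "'i \<Rightarrow> int"
  assumes "finite I" "inj_on x I"
  shows "poisson_mean (\<lambda>k. rho k (x ` I)) (r\<^sup>2) = leibniz I (\<lambda>i j. bkernel (x i) (x j) r)"
proof -
  obtain e where "bij_betw e {0..<card I} I" using ex_bij_betw_nat_finite[OF assms(1)] by blast
  then have e: "bij_betw e {..<card I} I" by (simp add: lessThan_atLeast0)
  let ?s = "card I" and ?y = "x \<circ> e"
  let ?xs = "map ?y [0..<?s]"
  have "inj_on ?y {..<?s}" using e assms(2) by (auto simp: bij_betw_def intro: comp_inj_on)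
  then have dist: "distinct ?xs" by (simp add: distinct_map lessThan_atLeast0)
  have "set ?xs = x ` (e ` {..<?s})" by (simp add: image_comp lessThan_atLeast0)
  then have set: "set ?xs = x ` I" using e by (simp add: bij_betw_def)
  have Z: "fps_conv_radius Z_fps = \<infinity>" "eval_fps Z_fps r = exp (r\<^sup>2)"
  proof -
    have "rho k {} = 1" for k
      using sum_dim_squared[of k] by (simp add: rho_def plancherel_def flip: sum_divide_distrib)
    then have "poisson_mean (\<lambda>k. rho k (set [])) (r\<^sup>2) = 1"
      using exp_converges[of "r\<^sup>2"] by (simp add: poisson_mean_def sums_iff divide_inverse exp_minus)
    then show "fps_conv_radius Z_fps = \<infinity>" "eval_fps Z_fps r = exp (r\<^sup>2)"
      using corr_fps_same[of "[]"] by (simp_all add: Z_fps_def)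
  qed
  have "exp (r\<^sup>2) * poisson_mean (\<lambda>k. rho k (x ` I)) (r\<^sup>2) = eval_fps (corr_fps ?xs ?xs) r"
    using corr_fps_same(2)[OF dist] set by simp
  also have "\<dots> = eval_fps (Z_fps * det_fps ?s ?y ?y) r" by (simp only: corr_fps_eq_det)
  also have "\<dots> = exp (r\<^sup>2) * leibniz {..<?s} (\<lambda>i j. bkernel (?y i) (?y j) r)"
    using eval_det_fps[of ?s ?y ?y r] Z by (simp add: eval_fps_mult)
  also have "leibniz {..<?s} (\<lambda>i j. bkernel (?y i) (?y j) r) = leibniz I (\<lambda>i j. bkernel (x i) (x j) r)"
    using leibniz_reindex[OF e finite_lessThan, of "\<lambda>i j. bkernel (x i) (x j) r"] by simp
  finally show ?thesis by simp
qed

section \<open>Kernel entries along a regular sequence\<close>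

text \<open>Integers within 1 / 2 of a common real limit coincide, so finite limits are eventually
  attained.\<close>

lemma int_sequence_limit:
  fixes m :: "nat \<Rightarrow> int"
  assumes "(\<lambda>n. ereal (of_int (m n))) \<longlonglongrightarrow> L"
  shows "\<bar>L\<bar> \<noteq> \<infinity> \<Longrightarrow> \<exists>D. L = ereal (of_int D) \<and> eventually (\<lambda>n. m n = D) sequentially"
    and "\<bar>L\<bar> = \<infinity> \<Longrightarrow> filterlim (\<lambda>n. \<bar>m n\<bar>) at_top sequentially"
proof -
  assume "\<bar>L\<bar> \<noteq> \<infinity>"
  then obtain l where L: "L = ereal l" by auto
  then have lim: "(\<lambda>n. real_of_int (m n)) \<longlonglongrightarrow> l" using assms by simp
  have "eventually (\<lambda>n. dist (real_of_int (m n)) l < 1 / 2) sequentially"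
    by (rule tendstoD[OF lim]) simp
  then obtain N where N: "\<And>n. n \<ge> N \<Longrightarrow> dist (real_of_int (m n)) l < 1 / 2"
    unfolding eventually_sequentially by blast
  have ev: "m n = m N" if "n \<ge> N" for n
  proof -
    have "\<bar>real_of_int (m n) - real_of_int (m N)\<bar> < 1"
      using N[OF that] N[OF order_refl] unfolding dist_real_def by linarith
    then show ?thesis by linarith
  qed
  then have evN: "eventually (\<lambda>n. m n = m N) sequentially" unfolding eventually_sequentially by blast
  then have "(\<lambda>n. real_of_int (m n)) \<longlonglongrightarrow> real_of_int (m N)"
    by (intro tendsto_eventually) (rule eventually_mono, assumption, simp)
  then have "l = real_of_int (m N)" by (rule LIMSEQ_unique[OF lim])
  then show "\<exists>D. L = ereal (of_int D) \<and> eventually (\<lambda>n. m n = D) sequentially" using L evN by blast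
next
  assume inf: "\<bar>L\<bar> = \<infinity>"
  show "filterlim (\<lambda>n. \<bar>m n\<bar>) at_top sequentially"
    unfolding filterlim_at_top
  proof
    fix Z :: int
    show "eventually (\<lambda>n. Z \<le> \<bar>m n\<bar>) sequentially"
    proof (cases "L = \<infinity>")
      case True
      then have "eventually (\<lambda>n. ereal (of_int Z) < ereal (of_int (m n))) sequentially"
        using assms by (intro order_tendstoD(1)[OF assms]) simp
      then show ?thesis by eventually_elim simp
    next
      case False
      then have "L = -\<infinity>" using inf by (cases L) auto
      then have "eventually (\<lambda>n. ereal (of_int (m n)) < ereal (of_int (- Z))) sequentially"
        by (intro order_tendstoD(2)[OF assms]) simp
      then show ?thesis by eventually_elim simp
    qed
  qed
qed

text \<open>Requiring r only to be asymptotic to sqrt n treats all tilts of the Poisson mean at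
  once.\<close>

context
  fixes r :: "nat \<Rightarrow> real"
  assumes r: "(\<lambda>n. r n / sqrt (real n)) \<longlonglongrightarrow> 1"
begin

lemma scale_at_top: "filterlim r at_top sequentially"
proof -
  have "filterlim (\<lambda>n. r n / sqrt (real n) * sqrt (real n)) at_top sequentially"
    by (rule filterlim_tendsto_pos_mult_at_top[OF r]) (auto intro: filterlim_compose[OF sqrt_at_top filterlim_real_sequentially])
  then show ?thesis
    by (rule filterlim_mono_eventually) (auto simp: eventually_sequentially intro!: exI[of _ 1])
qed

lemma scale_limit:
  assumes "(\<lambda>n. of_int (x n) / sqrt (real n)) \<longlonglongrightarrow> a"
  shows "(\<lambda>n. of_int (x n) / r n) \<longlonglongrightarrow> a"
proof -
  have "(\<lambda>n. (of_int (x n) / sqrt (real n)) / (r n / sqrt (real n))) \<longlonglongrightarrow> a / 1"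
    by (intro tendsto_divide assms r) simp
  then show ?thesis unfolding div_by_1
    by (rule Lim_transform_eventually) (auto simp: eventually_sequentially intro!: exI[of _ 1])
qed

lemma scale_above:
  fixes x :: "nat \<Rightarrow> int"
  assumes x: "(\<lambda>n. ereal (of_int (x n) / sqrt (real n))) \<longlonglongrightarrow> a" and b: "ereal b < a"
  shows "eventually (\<lambda>n. of_int (x n) > b * r n) sequentially"
proof -
  obtain c where c: "ereal b < ereal c" "ereal c < a" using ereal_dense2[OF b] by blast
  have "(\<lambda>n. b * (r n / sqrt (real n))) \<longlonglongrightarrow> b * 1" by (intro tendsto_intros r)
  then have "eventually (\<lambda>n. b * (r n / sqrt (real n)) < c) sequentially" using c by (intro order_tendstoD(2)) auto
  moreover have "eventually (\<lambda>n. ereal c < ereal (of_int (x n) / sqrt (real n))) sequentially"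
    using x c(2) by (rule order_tendstoD(1))
  ultimately show ?thesis using eventually_gt_at_top[of 0]
  proof eventually_elim
    case (elim n)
    then have "b * r n / sqrt (real n) < of_int (x n) / sqrt (real n)" by simp
    then show ?case using elim(3) by (simp add: divide_less_cancel)
  qed
qed

lemma scale_below:
  fixes x :: "nat \<Rightarrow> int"
  assumes x: "(\<lambda>n. ereal (of_int (x n) / sqrt (real n))) \<longlonglongrightarrow> a" and b: "a < ereal b"
  shows "eventually (\<lambda>n. of_int (x n) < b * r n) sequentially"
proof -
  obtain c where c: "a < ereal c" "ereal c < ereal b" using ereal_dense2[OF b] by blast
  have "(\<lambda>n. b * (r n / sqrt (real n))) \<longlonglongrightarrow> b * 1" by (intro tendsto_intros r)
  then have "eventually (\<lambda>n. c < b * (r n / sqrt (real n))) sequentially" using c by (intro order_tendstoD(1)) auto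
  moreover have "eventually (\<lambda>n. ereal (of_int (x n) / sqrt (real n)) < ereal c) sequentially"
    using x c(1) by (rule order_tendstoD(2))
  ultimately show ?thesis using eventually_gt_at_top[of 0]
  proof eventually_elim
    case (elim n)
    then have "of_int (x n) / sqrt (real n) < b * r n / sqrt (real n)" by simp
    then show ?case using elim(3) by (simp add: divide_less_cancel)
  qed
qed

lemma kernel_entry_limit:
  assumes reg: "regular_with s x a d" and ij: "i < s" "j < s"
  shows "(\<lambda>n. bkernel (x i n) (x j n) (r n)) \<longlonglongrightarrow> sine_kernel (d i j) (a i)"
proof -
  have ai: "(\<lambda>n. ereal (of_int (x i n) / sqrt (real n))) \<longlonglongrightarrow> a i"
    and dij: "(\<lambda>n. ereal (of_int (x i n - x j n))) \<longlonglongrightarrow> d i j"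
    and mono: "\<And>n. n \<ge> 1 \<Longrightarrow> strict_mono_on {..<s} (\<lambda>i. x i n)"
    using reg ij by (auto simp: regular_with_def)
  have ne: "x i n \<noteq> x j n" if "n \<ge> 1" "i \<noteq> j" for n
    using strict_mono_on_imp_inj_on[OF mono[OF that(1)]] ij that(2) by (auto dest: inj_onD)
  \<comment> \<open>Distinct integers differ by at least 1, so the limit difference 0 marks the
    diagonal; the clause a \<le> -2 of the kernel distinguishes exactly this.\<close>
  have "d i j \<noteq> 0" if "i \<noteq> j"
  proof
    assume "d i j = 0"
    then obtain D where D: "d i j = ereal (of_int D)" "eventually (\<lambda>n. x i n - x j n = D) sequentially"
      using int_sequence_limit(1)[OF dij] by auto
    then have "D = 0" using \<open>d i j = 0\<close> by (simp add: zero_ereal_def)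
    have "eventually (\<lambda>n. x i n = x j n \<and> n \<ge> 1) sequentially"
      using D(2) eventually_ge_at_top[of 1] by eventually_elim (simp add: \<open>D = 0\<close>)
    then obtain n where "x i n = x j n" "n \<ge> 1" by (auto simp: eventually_sequentially)
    then show False using ne that by blast
  qed
  moreover have "d i j = 0" if "i = j"
    using dij that LIMSEQ_unique[OF tendsto_const, of "0 :: ereal" "d i j"] by (simp add: zero_ereal_def)
  ultimately have d0: "d i j = 0 \<longleftrightarrow> i = j" by blast
  note top = scale_at_top
  consider "a i \<ge> 2" | "\<not> a i \<ge> 2" "a i \<le> -2" | "-2 < a i" "a i < 2" by fastforce
  then show ?thesis
  proof cases
    case 1
    have "eventually (\<lambda>n. of_int (x i n) > b * r n) sequentially" if "b < 2" for b
      by (rule scale_above[OF ai]) (use 1 that in \<open>metis ereal_less(6) less_ereal.simps(1) numeral_eq_ereal order_less_le_trans\<close>)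
    from kernel_right[OF top this] show ?thesis using 1 by (simp add: sine_kernel_def)
  next
    case 2
    have below: "eventually (\<lambda>n. of_int (x i n) < b * r n) sequentially" if "b > -2" for b
    proof (rule scale_below[OF ai])
      have "(-2 :: ereal) = ereal (-2)" by simp
      then show "a i < ereal b" using 2 that by (metis less_ereal.simps(1) order_le_less_trans)
    qed
    show ?thesis
    proof (cases "i = j")
      case True
      then show ?thesis using kernel_diag_left[OF top below] 2 d0 by (simp add: sine_kernel_def)
    next
      case False
      have "eventually (\<lambda>n. x i n \<noteq> x j n) sequentially"
        using ne False by (auto simp: eventually_sequentially)
      from kernel_left[OF top below this] show ?thesis using 2 False d0 by (simp add: sine_kernel_def)
    qed
  next
    case 3
    then have "\<bar>a i\<bar> \<noteq> \<infinity>" by (cases "a i") auto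
    then obtain A where A: "a i = ereal A" by auto
    then have bd: "-2 < A" "A < 2" using 3 by simp_all
    have "(\<lambda>n. of_int (x i n) / sqrt (real n)) \<longlonglongrightarrow> A" using ai A by simp
    note lim = scale_limit[OF this]
    have S: "sine_kernel k (a i) = (if \<bar>k\<bar> = \<infinity> then 0 else if k = 0 then arccos (A / 2) / pi
       else sin (arccos (A / 2) * real_of_ereal k) / (pi * real_of_ereal k))" for k
      using 3 A by (simp add: sine_kernel_def)
    show ?thesis
    proof (cases "\<bar>d i j\<bar> = \<infinity>")
      case True
      from kernel_limit_far[OF bd top lim int_sequence_limit(2)[OF dij True]]
      show ?thesis unfolding S using True by simp
    next
      case False
      then obtain D where D: "d i j = ereal (of_int D)" "eventually (\<lambda>n. x i n - x j n = D) sequentially"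
        using int_sequence_limit(1)[OF dij] by auto
      from kernel_limit_near[OF bd top lim D(2)]
      show ?thesis unfolding S D(1) by (cases "D = 0") (simp_all add: zero_ereal_def)
    qed
  qed
qed

end

section \<open>Convergence and splitting of the determinants\<close>

lemma leibniz_tendsto:
  fixes A :: "'n \<Rightarrow> 'i \<Rightarrow> 'i \<Rightarrow> real"
  assumes "\<And>i j. i \<in> I \<Longrightarrow> j \<in> I \<Longrightarrow> ((\<lambda>n. A n i j) \<longlongrightarrow> B i j) F"
  shows "((\<lambda>n. leibniz I (A n)) \<longlongrightarrow> leibniz I B) F"
proof -
  have "((\<lambda>n. A n i (p i)) \<longlongrightarrow> B i (p i)) F" if "p permutes I" "i \<in> I" for p i
    using assms permutes_in_image[OF that(1), of i] that(2) by auto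
  then show ?thesis
    unfolding leibniz_def by (intro tendsto_sum tendsto_mult tendsto_const tendsto_prod) auto
qed

text \<open>Stated for subfamilies I and with the scale of row i in the kernel, so that it applies
  to the parts of a splitting as well as to the whole set.\<close>

theorem correlation_limit:
  assumes reg: "regular_with s x a d" and I: "I \<subseteq> {..<s}"
  shows "(\<lambda>n. rho n ((\<lambda>i. x i n) ` I)) \<longlonglongrightarrow> leibniz I (\<lambda>i j. sine_kernel (d i j) (a i))"
proof (rule depoissonization[where L = "2 * real s" and f = "\<lambda>n k. rho k ((\<lambda>i. x i n) ` I)"])
  have fin: "finite I" using I finite_subset by blast
  let ?X = "\<lambda>n. (\<lambda>i. x i n) ` I"
  show "0 \<le> rho k (?X n)" "rho k (?X n) \<le> 1" for n k by (rule rho_nonneg, rule rho_le_1)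
  show "\<bar>rho (Suc k) (?X n) - rho k (?X n)\<bar> \<le> 2 * real s / sqrt (real (Suc k))" for n k
  proof -
    have "card (?X n) \<le> card I" using fin by (rule card_image_le)
    also have "\<dots> \<le> s" using card_mono[OF _ I] by simp
    finally have "2 * real (card (?X n)) / sqrt (real (Suc k)) \<le> 2 * real s / sqrt (real (Suc k))"
      by (intro divide_right_mono) auto
    then show ?thesis using rho_Suc_Lipschitz[of "?X n" k] fin by simp
  qed
  fix t :: real
  \<comment> \<open>The Poisson parameter is r^2, and the tilt disappears in the ratio of r to sqrt
    n.\<close>
  define r where "r n = sqrt (real n * exp (t / sqrt (real n)))" for n
  have "(\<lambda>n. sqrt (exp (t / sqrt (real n)))) \<longlonglongrightarrow> 1" by real_asymp
  moreover have "eventually (\<lambda>n. sqrt (exp (t / sqrt (real n))) = r n / sqrt (real n)) sequentially"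
    using eventually_gt_at_top[of 0] by eventually_elim (simp add: r_def real_sqrt_mult)
  ultimately have r: "(\<lambda>n. r n / sqrt (real n)) \<longlonglongrightarrow> 1" by (rule Lim_transform_eventually)
  have lim: "(\<lambda>n. leibniz I (\<lambda>i j. bkernel (x i n) (x j n) (r n))) \<longlonglongrightarrow> leibniz I (\<lambda>i j. sine_kernel (d i j) (a i))"
    using I by (intro leibniz_tendsto kernel_entry_limit[OF r reg]) auto
  have "eventually (\<lambda>n. leibniz I (\<lambda>i j. bkernel (x i n) (x j n) (r n)) =
      poisson_mean (\<lambda>k. rho k (?X n)) (real n * exp (t / sqrt (real n)))) sequentially"
    using eventually_ge_at_top[of 1]
  proof eventually_elim
    case (elim n)
    have "strict_mono_on {..<s} (\<lambda>i. x i n)" using reg elim by (auto simp: regular_with_def)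
    from inj_on_subset[OF strict_mono_on_imp_inj_on[OF this] I] have "inj_on (\<lambda>i. x i n) I" .
    from poissonized_determinantal[OF fin this, of "r n"]
    show ?case by (simp add: r_def)
  qed
  with lim show "(\<lambda>n. poisson_mean (\<lambda>k. rho k (?X n)) (real n * exp (t / sqrt (real n)))) \<longlonglongrightarrow>
      leibniz I (\<lambda>i j. sine_kernel (d i j) (a i))" by (rule Lim_transform_eventually)
qed

lemma nonsplit_same_scale:
  assumes reg: "regular_with s x a d" and ns: "nonsplit s x" and i: "i < s"
  shows "a i = a 0"
proof -
  obtain C where C: "\<And>n i j. n \<ge> 1 \<Longrightarrow> i < s \<Longrightarrow> j < s \<Longrightarrow> \<bar>x i n - x j n\<bar> \<le> C"
    using ns by (auto simp: nonsplit_def)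
  have s0: "0 < s" using i by simp
  have lim: "(\<lambda>n. ereal (of_int (x i n) / sqrt (real n))) \<longlonglongrightarrow> a i" if "i < s" for i
    using reg that by (auto simp: regular_with_def)
  have "(\<lambda>n. (of_int (x i n) - of_int (x 0 n)) / sqrt (real n)) \<longlonglongrightarrow> 0"
  proof (rule Lim_null_comparison)
    show "(\<lambda>n. of_int C / sqrt (real n)) \<longlonglongrightarrow> 0" by real_asymp
    show "eventually (\<lambda>n. norm ((of_int (x i n) - of_int (x 0 n)) / sqrt (real n)) \<le> of_int C / sqrt (real n)) sequentially"
      using eventually_ge_at_top[of 1]
    proof eventually_elim
      case (elim n)
      have "\<bar>real_of_int (x i n) - of_int (x 0 n)\<bar> \<le> of_int C" using C[OF elim i s0] by linarith
      then show ?case by (simp add: divide_right_mono)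
    qed
  qed
  \<comment> \<open>Adding a null sequence is legitimate in the extended reals even if a 0 is
    infinite.\<close>
  then have "(\<lambda>n. ereal (of_int (x 0 n) / sqrt (real n)) + ereal ((of_int (x i n) - of_int (x 0 n)) / sqrt (real n))) \<longlonglongrightarrow> a 0 + ereal 0"
    by (intro tendsto_add_ereal_general1 lim[OF s0]) auto
  then have "(\<lambda>n. ereal (of_int (x i n) / sqrt (real n))) \<longlonglongrightarrow> a 0"
    by (simp add: diff_divide_distrib zero_ereal_def[symmetric])
  then show ?thesis using lim[OF i] LIMSEQ_unique by blast
qed

lemma regular_sequence_limit:
  assumes "regular_sequence X"
  obtains L where "(\<lambda>n. rho n (X n)) \<longlonglongrightarrow> L"
proof -
  obtain s x a d where reg: "regular_with s x a d" and X: "\<And>n. n \<ge> 1 \<Longrightarrow> X n = points s x n"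
    using assms by (auto simp: regular_sequence_def)
  have "(\<lambda>n. rho n (points s x n)) \<longlonglongrightarrow> leibniz {..<s} (\<lambda>i j. sine_kernel (d i j) (a i))"
    using correlation_limit[OF reg order_refl] by (simp add: points_def)
  then have "(\<lambda>n. rho n (X n)) \<longlonglongrightarrow> leibniz {..<s} (\<lambda>i j. sine_kernel (d i j) (a i))"
    by (rule Lim_transform_eventually) (use X in \<open>auto simp: eventually_sequentially intro!: exI[of _ 1]\<close>)
  then show thesis by (rule that)
qed

text \<open>The index set cut out by \<open>X' n\<close> may vary with \<open>n\<close>; it is constant along a subsequence, which suffices
  because all the limits involved exist.\<close>
lemma splits_subsequence:
  assumes reg: "regular_with s x a d" and split: "splits_into (points s x) X' X''"
  obtains I J \<phi> where "I \<union> J = {..<s}" "I \<inter> J = {}" "strict_mono (\<phi> :: nat \<Rightarrow> nat)"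
    "\<And>n. X' (\<phi> n) = (\<lambda>i. x i (\<phi> n)) ` I" "\<And>n. X'' (\<phi> n) = (\<lambda>i. x i (\<phi> n)) ` J"
proof -
  define I where "I n = {i \<in> {..<s}. x i n \<in> X' n}" for n
  have U: "\<And>n. n \<ge> 1 \<Longrightarrow> (\<lambda>i. x i n) ` {..<s} = X' n \<union> X'' n"
    and far: "filterlim (\<lambda>n. setdist (real_of_int ` X' n) (real_of_int ` X'' n)) at_top sequentially"
    using split by (auto simp: splits_into_def points_def)
  have "eventually (\<lambda>n. setdist (real_of_int ` X' n) (real_of_int ` X'' n) \<ge> 1) sequentially"
    using far by (simp add: filterlim_at_top)
  then obtain N where N: "\<And>n. n \<ge> N \<Longrightarrow> setdist (real_of_int ` X' n) (real_of_int ` X'' n) \<ge> 1"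
    by (auto simp: eventually_sequentially)
  have disj: "X' n \<inter> X'' n = {}" if "n \<ge> N" for n
  proof (rule ccontr)
    assume "X' n \<inter> X'' n \<noteq> {}"
    then obtain z where "z \<in> X' n" "z \<in> X'' n" by auto
    then have "setdist (real_of_int ` X' n) (real_of_int ` X'' n) \<le> dist (real_of_int z) (real_of_int z)"
      by (intro setdist_le_dist) auto
    then show False using N[OF that] by simp
  qed
  have "I ` {max N 1..} \<subseteq> Pow {..<s}" by (auto simp: I_def)
  then have "finite (I ` {max N 1..})" by (rule finite_subset) simp
  moreover have "infinite {max N 1..}" by (rule infinite_Ici)
  ultimately obtain n0 where n0: "infinite {n \<in> {max N 1..}. I n = I n0}"
    using pigeonhole_infinite by blast
  obtain \<phi> :: "nat \<Rightarrow> nat" where \<phi>: "strict_mono \<phi>" "\<And>n. \<phi> n \<in> {n \<in> {max N 1..}. I n = I n0}"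
    using infinite_enumerate[OF n0] by blast
  show thesis
  proof (rule that[of "I n0" "{..<s} - I n0" \<phi>])
    fix n
    have n: "\<phi> n \<ge> N" "\<phi> n \<ge> 1" "I n0 = {i \<in> {..<s}. x i (\<phi> n) \<in> X' (\<phi> n)}"
      using \<phi>(2)[of n] by (auto simp: I_def)
    show "X' (\<phi> n) = (\<lambda>i. x i (\<phi> n)) ` I n0"
    proof (intro equalityI subsetI)
      fix z assume z: "z \<in> X' (\<phi> n)"
      then have "z \<in> (\<lambda>i. x i (\<phi> n)) ` {..<s}" using U[OF n(2)] by blast
      then show "z \<in> (\<lambda>i. x i (\<phi> n)) ` I n0" using z unfolding n(3) by auto
    qed (auto simp: n(3))
    show "X'' (\<phi> n) = (\<lambda>i. x i (\<phi> n)) ` ({..<s} - I n0)"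
    proof (intro equalityI subsetI)
      fix z assume z: "z \<in> X'' (\<phi> n)"
      then have "z \<in> (\<lambda>i. x i (\<phi> n)) ` {..<s}" "z \<notin> X' (\<phi> n)" using U[OF n(2)] disj[OF n(1)] by blast+
      then show "z \<in> (\<lambda>i. x i (\<phi> n)) ` ({..<s} - I n0)" unfolding n(3) by auto
    next
      fix z assume "z \<in> (\<lambda>i. x i (\<phi> n)) ` ({..<s} - I n0)"
      then have "z \<in> (\<lambda>i. x i (\<phi> n)) ` {..<s}" "z \<notin> X' (\<phi> n)" unfolding n(3) by auto
      then show "z \<in> X'' (\<phi> n)" using U[OF n(2)] by blast
    qed
  qed (use \<phi>(1) in \<open>auto simp: I_def\<close>)
qed

lemma sine_kernel_infinite: "\<bar>k\<bar> = \<infinity> \<Longrightarrow> sine_kernel k a = 0"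
  by (auto simp: sine_kernel_def)

text \<open>Differences across the split diverge, so the kernel entries between I and J vanish and
  the determinant factors. The limits of both parts exist by regularity and are identified along the
  subsequence.\<close>

theorem correlation_limit_split:
  assumes reg: "regular_with s x a d" and split: "splits_into (points s x) X' X''"
  shows "\<exists>L' L''. (\<lambda>n. rho n (X' n)) \<longlonglongrightarrow> L' \<and> (\<lambda>n. rho n (X'' n)) \<longlonglongrightarrow> L'' \<and>
    (\<lambda>n. rho n (points s x n)) \<longlonglongrightarrow> L' * L''"
proof -
  let ?S = "\<lambda>i j. sine_kernel (d i j) (a i)"
  have X': "regular_sequence X'" and X'': "regular_sequence X''" using split by (auto simp: splits_into_def)
  obtain L' where L': "(\<lambda>n. rho n (X' n)) \<longlonglongrightarrow> L'" by (rule regular_sequence_limit[OF X'])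
  obtain L'' where L'': "(\<lambda>n. rho n (X'' n)) \<longlonglongrightarrow> L''" by (rule regular_sequence_limit[OF X''])
  obtain I J \<phi> where IJ: "I \<union> J = {..<s}" "I \<inter> J = {}" and \<phi>: "strict_mono (\<phi> :: nat \<Rightarrow> nat)"
    and X: "\<And>n. X' (\<phi> n) = (\<lambda>i. x i (\<phi> n)) ` I" "\<And>n. X'' (\<phi> n) = (\<lambda>i. x i (\<phi> n)) ` J"
    using splits_subsequence[OF reg split] by metis
  have sub: "I \<subseteq> {..<s}" "J \<subseteq> {..<s}" using IJ by auto
  have "L' = leibniz I ?S"
  proof (rule LIMSEQ_unique)
    show "(\<lambda>n. rho (\<phi> n) (X' (\<phi> n))) \<longlonglongrightarrow> L'" using LIMSEQ_subseq_LIMSEQ[OF L' \<phi>] by (simp add: o_def)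
    show "(\<lambda>n. rho (\<phi> n) (X' (\<phi> n))) \<longlonglongrightarrow> leibniz I ?S"
      using LIMSEQ_subseq_LIMSEQ[OF correlation_limit[OF reg sub(1)] \<phi>] by (simp add: o_def X)
  qed
  moreover have "L'' = leibniz J ?S"
  proof (rule LIMSEQ_unique)
    show "(\<lambda>n. rho (\<phi> n) (X'' (\<phi> n))) \<longlonglongrightarrow> L''" using LIMSEQ_subseq_LIMSEQ[OF L'' \<phi>] by (simp add: o_def)
    show "(\<lambda>n. rho (\<phi> n) (X'' (\<phi> n))) \<longlonglongrightarrow> leibniz J ?S"
      using LIMSEQ_subseq_LIMSEQ[OF correlation_limit[OF reg sub(2)] \<phi>] by (simp add: o_def X)
  qed
  moreover have "leibniz {..<s} ?S = leibniz I ?S * leibniz J ?S"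
    unfolding IJ(1)[symmetric]
  proof (rule leibniz_block)
    show "finite I" "finite J" using sub finite_subset by blast+
    fix i j assume ij: "i \<in> I" "j \<in> J"
    then have "i < s" "j < s" using sub by auto
    then have dij: "(\<lambda>n. ereal (of_int (x i n - x j n))) \<longlonglongrightarrow> d i j" using reg by (auto simp: regular_with_def)
    \<comment> \<open>A finite limit D would keep the distance between the two parts at most |D|
      along \<phi>.\<close>
    have "\<bar>d i j\<bar> = \<infinity>"
    proof (rule ccontr)
      assume "\<bar>d i j\<bar> \<noteq> \<infinity>"
      from int_sequence_limit(1)[OF dij this]
      obtain D where "eventually (\<lambda>n. x i n - x j n = D) sequentially" by auto
      then have ev: "eventually (\<lambda>n. x i (\<phi> n) - x j (\<phi> n) = D) sequentially"
        by (rule eventually_subseq[OF \<phi>])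
      have "filterlim (\<lambda>n. setdist (real_of_int ` X' n) (real_of_int ` X'' n)) at_top sequentially"
        using split by (simp add: splits_into_def)
      then have "eventually (\<lambda>n. setdist (real_of_int ` X' n) (real_of_int ` X'' n) \<ge> \<bar>real_of_int D\<bar> + 1) sequentially"
        by (simp add: filterlim_at_top)
      then have "eventually (\<lambda>n. setdist (real_of_int ` X' (\<phi> n)) (real_of_int ` X'' (\<phi> n)) \<ge> \<bar>real_of_int D\<bar> + 1) sequentially"
        by (rule eventually_subseq[OF \<phi>])
      with ev have "eventually (\<lambda>n. False) sequentially"
      proof eventually_elim
        case (elim n)
        have "setdist (real_of_int ` X' (\<phi> n)) (real_of_int ` X'' (\<phi> n)) \<le> dist (real_of_int (x i (\<phi> n))) (real_of_int (x j (\<phi> n)))"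
          using ij X by (intro setdist_le_dist) auto
        also have "\<dots> = \<bar>real_of_int D\<bar>" using elim(1) by (simp add: dist_real_def flip: of_int_diff)
        finally show ?case using elim(2) by simp
      qed
      then show False by simp
    qed
    then show "sine_kernel (d i j) (a i) = 0" by (rule sine_kernel_infinite)
  qed (rule IJ(2))
  ultimately have "(\<lambda>n. rho n (points s x n)) \<longlonglongrightarrow> L' * L''"
    using correlation_limit[OF reg order_refl] by (simp add: points_def)
  with L' L'' show ?thesis by blast
qed

theorem theorem3:
  fixes s :: nat
    and x :: "nat \<Rightarrow> nat \<Rightarrow> int"
    and a :: "nat \<Rightarrow> ereal"
    and d :: "nat \<Rightarrow> nat \<Rightarrow> ereal"
  assumes "s \<ge> 1"
    and "regular_with s x a d"
  shows "(\<forall>X' X''. splits_into (points s x) X' X'' \<longrightarrow>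
            (\<exists>L' L''. (\<lambda>n. rho n (X' n)) \<longlonglongrightarrow> L' \<and>
                      (\<lambda>n. rho n (X'' n)) \<longlonglongrightarrow> L'' \<and>
                      (\<lambda>n. rho n (points s x n)) \<longlonglongrightarrow> L' * L'')) \<and>
         (nonsplit s x \<longrightarrow>
            (\<forall>i<s. a i = a 0) \<and>
            (\<lambda>n. rho n (points s x n)) \<longlonglongrightarrow>
              Determinant.det (Matrix.mat s s (\<lambda>(i, j). sine_kernel (d i j) (a 0))))"
proof (intro conjI allI impI)
  fix X' X'' assume "splits_into (points s x) X' X''"
  then show "\<exists>L' L''. (\<lambda>n. rho n (X' n)) \<longlonglongrightarrow> L' \<and> (\<lambda>n. rho n (X'' n)) \<longlonglongrightarrow> L'' \<and>
      (\<lambda>n. rho n (points s x n)) \<longlonglongrightarrow> L' * L''"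
    by (rule correlation_limit_split[OF assms(2)])
next
  fix i assume "nonsplit s x" "i < s"
  then show "a i = a 0" by (rule nonsplit_same_scale[OF assms(2)])
next
  assume ns: "nonsplit s x"
  \<comment> \<open>The limit theorem puts a i into row i; bounded mutual distances make all of
    these equal to a 0.\<close>
  have "Determinant.det (Matrix.mat s s (\<lambda>(i, j). sine_kernel (d i j) (a 0))) = leibniz {..<s} (\<lambda>i j. sine_kernel (d i j) (a i))"
    unfolding det_eq_leibniz
  proof (rule leibniz_cong)
    fix i j assume "i \<in> {..<s}"
    then have "a i = a 0" by (intro nonsplit_same_scale[OF assms(2) ns]) simp
    then show "sine_kernel (d i j) (a 0) = sine_kernel (d i j) (a i)" by (simp only:)
  qed
  then show "(\<lambda>n. rho n (points s x n)) \<longlonglongrightarrow>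
      Determinant.det (Matrix.mat s s (\<lambda>(i, j). sine_kernel (d i j) (a 0)))"
    using correlation_limit[OF assms(2) order_refl] by (simp add: points_def)
qed

end
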